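(* Let $I\subset\mathbb R$ be a compact interval and let $H(t)$, $t\in I$, be a family of operators. Assume there exist $\mu\ge0$ and $\sigma>0$ such that: (1) for every $r\ge0$, $t\mapsto H(t)$ is norm-continuous as a map $I\to\mathcal L(\mathcal H^{r+\mu},\mathcal H^r)$; (2) there is a function $c_{\mu+\sigma}:I\to[0,\infty)$, $c_{\mu+\sigma}\in L^1(I)$, such that the following energy commutator bound holds for $r=\mu+\sigma$: $$\left|\mathrm i\left(\langle H(t)v,\Lambda^{2r}v\rangle-\langle\Lambda^{2r}v,H(t)v\rangle\right)\right|\le c_r(t)\|v\|_r^2\qquad\text{for every }v\in\mathcal H^\infty\text{ and almost every }t\in I;$$ (3) each $H(t)$ is symmetric on the common core $\mathcal H^\infty$. Then for every $u\in\mathcal H^{\mu+\sigma}$ the family $U_N(t,s)P_Nu$ is Cauchy in $\mathcal H$ as $N\to\infty$, uniformly for $(t,s)\in I\times I$; consequently the limit $U(t,s)u:=\lim_{N\to\infty}U_N(t,s)P_Nu$ exists uniformly on $I\times I$. Moreover, there is a constant $C_{I,\mu,\sigma}>0$ (independent of $M$, $N$, $u$) such that whenever $M\ge N$, $$\sup_{s,t\in I}\|U_M(t,s)P_Mu-U_N(t,s)P_Nu\|\le C_{I,\mu,\sigma}(1+N)^{-\sigma}\|u\|_{\mu+\sigma}.$$ The limiting family extends uniquely to a strongly continuous unitary propagator on $\mathcal H$ (i.e. a strongly continuous family of unitaries with $U(t,r)U(r,s)=U(t,s)$, $U(s,s)=\mathbf 1$). If the preceding assumptions hold at every level of the Hilbert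 scale (i.e. in addition the energy commutator bound holds for every $r\ge0$ with some $c_r\in L^1(I)$), then $U(t,s)$ preserves $\mathcal H^\infty$, and for $u\in\mathcal H^\infty$ one has $\mathrm i\partial_tU(t,s)u=H(t)U(t,s)u$.
   Context: $\mathcal H$ is a complex separable Hilbert space, $H_0$ a positive self-adjoint operator on $\mathcal H$ with compact resolvent (spectrum contained in $[0,\infty)$), and $\Lambda=1+H_0$. For $N>0$, $P_N=\mathbf 1_{[0,N]}(H_0)$ and $\mathcal H_N=P_N\mathcal H$ (finite-dimensional). For $r\ge0$, $\mathcal H^r=D(\Lambda^r)$ with norm $\|u\|_r=\|\Lambda^ru\|$, and $\mathcal H^\infty=\bigcap_{r\ge0}\mathcal H^r$. $H_N(t)=P_NH(t)P_N$ is viewed as a self-adjoint operator on $\mathcal H_N$, and $U_N(t,s)$ is its unitary propagator: $\mathrm i\partial_tU_N(t,s)=H_N(t)U_N(t,s)$, $U_N(s,s)=\mathbf 1_{\mathcal H_N}$. *)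

theory Defs
  imports "HOL-Analysis.Analysis"
begin

section \<open>Complex Hilbert spaces\<close>

text \<open>The inner product is antilinear in its first and linear in its second argument.\<close>

class chilbert_space = banach +
  fixes scaleC :: "complex \<Rightarrow> 'a \<Rightarrow> 'a"  (infixr "*\<^sub>C" 75)
    and cinner :: "'a \<Rightarrow> 'a \<Rightarrow> complex"
  assumes scaleC_add_right: "z *\<^sub>C (x + y) = z *\<^sub>C x + z *\<^sub>C y"
    and scaleC_add_left: "(z + w) *\<^sub>C x = z *\<^sub>C x + w *\<^sub>C x"
    and scaleC_scaleC: "z *\<^sub>C (w *\<^sub>C x) = (z * w) *\<^sub>C x"
    and scaleC_of_real: "complex_of_real r *\<^sub>C x = r *\<^sub>R x"
    and cinner_commute: "cinner x y = cnj (cinner y x)"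
    and cinner_add_right: "cinner x (y + y') = cinner x y + cinner x y'"
    and cinner_scaleC_right: "cinner x (z *\<^sub>C y) = z * cinner x y"
    and cinner_self: "cinner x x = complex_of_real ((norm x)\<^sup>2)"

definition csubspace :: "'a::chilbert_space set \<Rightarrow> bool" where
  "csubspace S \<longleftrightarrow> 0 \<in> S \<and> (\<forall>x\<in>S. \<forall>y\<in>S. x + y \<in> S) \<and> (\<forall>z. \<forall>x\<in>S. z *\<^sub>C x \<in> S)"

definition clinear_on :: "'a::chilbert_space set \<Rightarrow> ('a \<Rightarrow> 'a) \<Rightarrow> bool" where
  "clinear_on S T \<longleftrightarrow> csubspace S \<and> (\<forall>x\<in>S. \<forall>y\<in>S. T (x + y) = T x + T y)
     \<and> (\<forall>z. \<forall>x\<in>S. T (z *\<^sub>C x) = z *\<^sub>C T x)"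

definition unitary_op :: "('a::chilbert_space \<Rightarrow> 'a) \<Rightarrow> bool" where
  "unitary_op V \<longleftrightarrow> clinear_on UNIV V \<and> surj V \<and> (\<forall>x y. cinner (V x) (V y) = cinner x y)"

definition orth_proj :: "'a::chilbert_space set \<Rightarrow> 'a \<Rightarrow> 'a" where
  "orth_proj S u = (THE p. p \<in> S \<and> (\<forall>w\<in>S. cinner w (u - p) = 0))"


section \<open>Unbounded operators\<close>

text \<open>An unbounded operator is given by its domain \<open>D\<close> and a function \<open>T\<close>, whose values
  outside \<open>D\<close> are irrelevant.\<close>

definition op_graph :: "'a set \<Rightarrow> ('a \<Rightarrow> 'a) \<Rightarrow> ('a \<times> 'a) set" where
  "op_graph D T = {(x, T x) | x. x \<in> D}"

definition adjoint_graph :: "'a::chilbert_space set \<Rightarrow> ('a \<Rightarrow> 'a) \<Rightarrow> ('a \<times> 'a) set" where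
  "adjoint_graph D T = {(y, z). \<forall>x\<in>D. cinner y (T x) = cinner z x}"

definition self_adjoint :: "'a::chilbert_space set \<Rightarrow> ('a \<Rightarrow> 'a) \<Rightarrow> bool" where
  "self_adjoint D T \<longleftrightarrow> clinear_on D T \<and> closure D = UNIV \<and> adjoint_graph D T = op_graph D T"

definition positive_op :: "'a::chilbert_space set \<Rightarrow> ('a \<Rightarrow> 'a) \<Rightarrow> bool" where
  "positive_op D T \<longleftrightarrow> (\<forall>x\<in>D. cinner x (T x) \<in> \<real> \<and> 0 \<le> Re (cinner x (T x)))"

definition resolvent :: "'a::chilbert_space set \<Rightarrow> ('a \<Rightarrow> 'a) \<Rightarrow> complex \<Rightarrow> 'a \<Rightarrow> 'a" where
  "resolvent D T z = inv_into D (\<lambda>x. T x - z *\<^sub>C x)"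

definition resolvent_set :: "'a::chilbert_space set \<Rightarrow> ('a \<Rightarrow> 'a) \<Rightarrow> complex set" where
  "resolvent_set D T =
     {z. bij_betw (\<lambda>x. T x - z *\<^sub>C x) D UNIV \<and> bounded_linear (resolvent D T z)}"

definition compact_op :: "('a::real_normed_vector \<Rightarrow> 'a) \<Rightarrow> bool" where
  "compact_op K \<longleftrightarrow> bounded_linear K \<and> (\<forall>B. bounded B \<longrightarrow> compact (closure (K ` B)))"

definition has_compact_resolvent :: "'a::chilbert_space set \<Rightarrow> ('a \<Rightarrow> 'a) \<Rightarrow> bool" where
  "has_compact_resolvent D T \<longleftrightarrow> (\<exists>z\<in>resolvent_set D T. compact_op (resolvent D T z))"

definition eigenspace :: "'a::chilbert_space set \<Rightarrow> ('a \<Rightarrow> 'a) \<Rightarrow> real \<Rightarrow> 'a set" where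
  "eigenspace D T l = {x \<in> D. T x = l *\<^sub>R x}"

definition eigenvalues :: "'a::chilbert_space set \<Rightarrow> ('a \<Rightarrow> 'a) \<Rightarrow> real set" where
  "eigenvalues D T = {l. eigenspace D T l \<noteq> {0}}"

text \<open>Functional calculus \<open>f(T)\<close> of a self-adjoint operator with compact resolvent. The spectral
  measure of such an operator is carried by its (real) eigenvalues, with mass at \<open>l\<close> the
  orthogonal projection onto the eigenspace; hence \<open>f(T)\<close> is the sum of \<open>f(l)\<close> times these
  projections, with its maximal domain.\<close>

definition fcalc_dom :: "'a::chilbert_space set \<Rightarrow> ('a \<Rightarrow> 'a) \<Rightarrow> (real \<Rightarrow> real) \<Rightarrow> 'a set" where
  "fcalc_dom D T f =
     {u. (\<lambda>l. (f l)\<^sup>2 * (norm (orth_proj (eigenspace D T l) u))\<^sup>2) summable_on eigenvalues D T}"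

definition fcalc :: "'a::chilbert_space set \<Rightarrow> ('a \<Rightarrow> 'a) \<Rightarrow> (real \<Rightarrow> real) \<Rightarrow> 'a \<Rightarrow> 'a" where
  "fcalc D T f u = (\<Sum>\<^sub>\<infinity>l\<in>eigenvalues D T. f l *\<^sub>R orth_proj (eigenspace D T l) u)"


section \<open>The Hilbert scale and spectral truncation\<close>

text \<open>In the following, \<open>D\<close> and \<open>H0\<close> are the domain and the action of the reference operator.\<close>

text \<open>\<open>Lam_pow D H0 r\<close> is the power \<open>\<Lambda>\<^sup>r\<close> of \<open>\<Lambda> = 1 + H0\<close>, which has the same domain as \<open>H0\<close>.\<close>

definition Lam_pow :: "'a::chilbert_space set \<Rightarrow> ('a \<Rightarrow> 'a) \<Rightarrow> real \<Rightarrow> 'a \<Rightarrow> 'a" where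
  "Lam_pow D H0 r = fcalc D (\<lambda>x. x + H0 x) (\<lambda>l. l powr r)"

definition hscale :: "'a::chilbert_space set \<Rightarrow> ('a \<Rightarrow> 'a) \<Rightarrow> real \<Rightarrow> 'a set" where
  "hscale D H0 r = fcalc_dom D (\<lambda>x. x + H0 x) (\<lambda>l. l powr r)"

definition hscale_norm :: "'a::chilbert_space set \<Rightarrow> ('a \<Rightarrow> 'a) \<Rightarrow> real \<Rightarrow> 'a \<Rightarrow> real" where
  "hscale_norm D H0 r u = norm (Lam_pow D H0 r u)"

definition hscale_infty :: "'a::chilbert_space set \<Rightarrow> ('a \<Rightarrow> 'a) \<Rightarrow> 'a set" where
  "hscale_infty D H0 = (\<Inter>r\<in>{0..}. hscale D H0 r)"

definition trunc_proj :: "'a::chilbert_space set \<Rightarrow> ('a \<Rightarrow> 'a) \<Rightarrow> real \<Rightarrow> 'a \<Rightarrow> 'a" where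
  "trunc_proj D H0 N = fcalc D H0 (indicator {0..N})"

definition hscale_bounded ::
    "'a::chilbert_space set \<Rightarrow> ('a \<Rightarrow> 'a) \<Rightarrow> real \<Rightarrow> real \<Rightarrow> ('a \<Rightarrow> 'a) \<Rightarrow> bool" where
  "hscale_bounded D H0 p q A \<longleftrightarrow> clinear_on (hscale D H0 p) A \<and> A ` hscale D H0 p \<subseteq> hscale D H0 q
     \<and> (\<exists>C. \<forall>u\<in>hscale D H0 p. hscale_norm D H0 q (A u) \<le> C * hscale_norm D H0 p u)"

text \<open>The operator norm from level \<open>p\<close> to level \<open>q\<close>, analogous to \<^const>\<open>onorm\<close>; it is only used
  for operators satisfying \<^const>\<open>hscale_bounded\<close>.\<close>

definition hscale_onorm ::
    "'a::chilbert_space set \<Rightarrow> ('a \<Rightarrow> 'a) \<Rightarrow> real \<Rightarrow> real \<Rightarrow> ('a \<Rightarrow> 'a) \<Rightarrow> real" where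
  "hscale_onorm D H0 p q A =
     (SUP u\<in>hscale D H0 p. hscale_norm D H0 q (A u) / hscale_norm D H0 p u)"

definition hscale_norm_continuous ::
    "'a::chilbert_space set \<Rightarrow> ('a \<Rightarrow> 'a) \<Rightarrow> real \<Rightarrow> real \<Rightarrow> real set \<Rightarrow> (real \<Rightarrow> 'a \<Rightarrow> 'a) \<Rightarrow> bool" where
  "hscale_norm_continuous D H0 p q I H \<longleftrightarrow> (\<forall>t\<in>I. hscale_bounded D H0 p q (H t)) \<and>
     (\<forall>t\<in>I. ((\<lambda>s. hscale_onorm D H0 p q (\<lambda>u. H s u - H t u)) \<longlongrightarrow> 0) (at t within I))"

definition energy_commutator_bound ::
    "'a::chilbert_space set \<Rightarrow> ('a \<Rightarrow> 'a) \<Rightarrow> real set \<Rightarrow> (real \<Rightarrow> 'a \<Rightarrow> 'a) \<Rightarrow> real \<Rightarrow> (real \<Rightarrow> real) \<Rightarrow> bool" where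
  "energy_commutator_bound D H0 I H r c \<longleftrightarrow> (\<forall>v\<in>hscale_infty D H0. AE t in lebesgue. t \<in> I \<longrightarrow>
     cmod (\<i> * (cinner (H t v) (Lam_pow D H0 (2 * r) v) - cinner (Lam_pow D H0 (2 * r) v) (H t v)))
       \<le> c t * (hscale_norm D H0 r v)\<^sup>2)"

definition nonneg_L1 :: "real set \<Rightarrow> (real \<Rightarrow> real) \<Rightarrow> bool" where
  "nonneg_L1 I c \<longleftrightarrow> (\<forall>t\<in>I. 0 \<le> c t) \<and> set_integrable lebesgue I c"


section \<open>Propagators\<close>

definition trunc_ham ::
    "'a::chilbert_space set \<Rightarrow> ('a \<Rightarrow> 'a) \<Rightarrow> (real \<Rightarrow> 'a \<Rightarrow> 'a) \<Rightarrow> real \<Rightarrow> real \<Rightarrow> 'a \<Rightarrow> 'a" where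
  "trunc_ham D H0 H N t v = trunc_proj D H0 N (H t (trunc_proj D H0 N v))"

text \<open>For \<open>v\<close> in the range of the spectral truncation, \<open>trunc_prop D H0 I H N t s v\<close> is the value at
  time \<open>t\<close> of the solution in that range of the truncated Schroedinger equation on \<open>I\<close> that starts
  from \<open>v\<close> at time \<open>s\<close>. At the end points of \<open>I\<close> the derivative is one-sided.\<close>

definition trunc_prop ::
    "'a::chilbert_space set \<Rightarrow> ('a \<Rightarrow> 'a) \<Rightarrow> real set \<Rightarrow> (real \<Rightarrow> 'a \<Rightarrow> 'a)
       \<Rightarrow> real \<Rightarrow> real \<Rightarrow> real \<Rightarrow> 'a \<Rightarrow> 'a" where
  "trunc_prop D H0 I H N t s v = (THE w. \<exists>x. x s = v \<and> x t = w \<and>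
     (\<forall>\<tau>\<in>I. x \<tau> \<in> range (trunc_proj D H0 N) \<and>
       (\<exists>x'. (x has_vector_derivative x') (at \<tau> within I) \<and> \<i> *\<^sub>C x' = trunc_ham D H0 H N \<tau> (x \<tau>))))"

definition unitary_propagator ::
    "real set \<Rightarrow> (real \<Rightarrow> real \<Rightarrow> 'a::chilbert_space \<Rightarrow> 'a) \<Rightarrow> bool" where
  "unitary_propagator I U \<longleftrightarrow>
     (\<forall>t\<in>I. \<forall>s\<in>I. unitary_op (U t s)) \<and>
     (\<forall>u. continuous_on (I \<times> I) (\<lambda>(t, s). U t s u)) \<and>
     (\<forall>t\<in>I. \<forall>r\<in>I. \<forall>s\<in>I. U t r \<circ> U r s = U t s) \<and>
     (\<forall>s\<in>I. U s s = id)"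

end

theory Submission
  imports Defs
begin

text \<open>The eigenprojections of \<open>\<Lambda>\<close> resolve the identity, because the inverse of \<open>\<Lambda>\<close> is compact, symmetric and
  injective. On the range of \<open>P\<^sub>N\<close> the energy \<open>\<parallel>u\<^sub>N\<parallel>\<^sub>r\<^sup>2\<close> of a truncated solution has the commutator as its
  derivative, so Gronwall's lemma for its logarithm bounds it independently of \<open>N\<close>. For \<open>M \<ge> N\<close> the
  difference \<open>u\<^sub>M - u\<^sub>N\<close> solves the equation truncated at \<open>M\<close> with source \<open>(P\<^sub>M - P\<^sub>N) H u\<^sub>N\<close>, and the energy bound
  at level \<open>\<mu> + \<sigma>\<close> makes this source \<open>O((1 + N)\<^sup>-\<^sup>\<sigma>)\<close>; Duhamel's formula gives the rate. The truncated
  evolutions being contractions, convergence extends from the dense subspace to every vector.\<close>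

section \<open>Inner products and orthogonal projections\<close>

text \<open>The level \<open>\<mu> + \<sigma>\<close> is forced by the rate: \<open>H t\<close>
  costs \<open>\<mu>\<close> powers of Lambda, so a solution bounded at that level is mapped by
  \<open>H t\<close> to a vector bounded at level \<open>\<sigma>\<close>, whose part above the
  cutoff is smaller by the factor \<open>(1 + N) powr (- \<sigma>)\<close>. Two obstacles shape the
  energy bound. The weight \<open>c\<close> is merely integrable and the commutator inequality holds
  only almost everywhere; for the logarithm of the energy it becomes a bound on an integrand, where
  null sets are harmless. And \<open>H t\<close> is unbounded, so every differentiation is done at a
  fixed cutoff. Powers of Lambda commute with the cutoff, hence the truncated commutator is the full
  one evaluated at a truncated vector, and the constant does not see the cutoff. Convergence is
  obtained only in the norm of the Hilbert space. Regularity of the limit comes from uniform bounds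
  on finite sums of spectral components, differentiability from interpolation with bounds at higher
  levels. Cutoffs are indexed by the spectral value \<open>K\<close> of Lambda, so that
  \<open>K = 1 + N\<close>.\<close>

lemma scaleC_zero_left [simp]: "0 *\<^sub>C (x::'a::chilbert_space) = 0"
  using scaleC_of_real[of 0 x] by simp

lemma scaleC_one [simp]: "1 *\<^sub>C (x::'a::chilbert_space) = x"
  using scaleC_of_real[of 1 x] by simp

lemma scaleC_zero_right [simp]: "z *\<^sub>C (0::'a::chilbert_space) = 0"
  using scaleC_add_right[of z 0 "0::'a"] by simp

lemma scaleC_minus_right [simp]: "z *\<^sub>C (- x::'a::chilbert_space) = - (z *\<^sub>C x)"
  using scaleC_add_right[of z x "-x"] by (simp add: eq_neg_iff_add_eq_0 add.commute)

lemma scaleC_minus_left [simp]: "(- z) *\<^sub>C (x::'a::chilbert_space) = - (z *\<^sub>C x)"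
  using scaleC_add_left[of z "-z" x] by (simp add: eq_neg_iff_add_eq_0 add.commute)

lemma scaleC_diff_right: "z *\<^sub>C (x - y::'a::chilbert_space) = z *\<^sub>C x - z *\<^sub>C y"
  using scaleC_add_right[of z x "-y"] by simp

lemma scaleC_scaleR_commute: "z *\<^sub>C (r *\<^sub>R x) = r *\<^sub>R (z *\<^sub>C (x::'a::chilbert_space))"
  by (simp add: scaleC_of_real[symmetric] scaleC_scaleC mult.commute)

lemma scaleC_imaginary_unit [simp]: "\<i> *\<^sub>C (\<i> *\<^sub>C (x::'a::chilbert_space)) = - x"
  by (simp add: scaleC_scaleC)

lemma cinner_add_left: "cinner (x + y) (z::'a::chilbert_space) = cinner x z + cinner y z"
  by (subst (1 2 3) cinner_commute) (simp add: cinner_add_right)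

lemma cinner_scaleC_left: "cinner (z *\<^sub>C x) (y::'a::chilbert_space) = cnj z * cinner x y"
  by (subst (1 2) cinner_commute) (simp add: cinner_scaleC_right)

lemma cinner_scaleR_right: "cinner x (r *\<^sub>R y::'a::chilbert_space) = of_real r * cinner x y"
  by (simp add: scaleC_of_real[symmetric] cinner_scaleC_right)

lemma cinner_scaleR_left: "cinner (r *\<^sub>R x) (y::'a::chilbert_space) = of_real r * cinner x y"
  by (simp add: scaleC_of_real[symmetric] cinner_scaleC_left)

lemma cinner_zero_right [simp]: "cinner x (0::'a::chilbert_space) = 0"
  using cinner_add_right[of x 0 0] by simp

lemma cinner_zero_left [simp]: "cinner (0::'a::chilbert_space) x = 0"
  using cinner_add_left[of 0 0 x] by simp

lemma cinner_minus_right [simp]: "cinner x (- y::'a::chilbert_space) = - cinner x y"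
  using cinner_add_right[of x y "-y"] by (simp add: eq_neg_iff_add_eq_0 add.commute)

lemma cinner_minus_left [simp]: "cinner (- x) (y::'a::chilbert_space) = - cinner x y"
  using cinner_add_left[of x "-x" y] by (simp add: eq_neg_iff_add_eq_0 add.commute)

lemma cinner_diff_right: "cinner x (y - z::'a::chilbert_space) = cinner x y - cinner x z"
  using cinner_add_right[of x y "-z"] by simp

lemma cinner_diff_left: "cinner (x - y) (z::'a::chilbert_space) = cinner x z - cinner y z"
  using cinner_add_left[of x "-y" z] by simp

lemma cinner_eq_zero_iff [simp]: "cinner x x = 0 \<longleftrightarrow> (x::'a::chilbert_space) = 0"
  by (simp add: cinner_self)

lemma norm_square_cinner: "(norm (x::'a::chilbert_space))\<^sup>2 = Re (cinner x x)"
  by (simp add: cinner_self)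

lemma Re_cinner_commute: "Re (cinner x y) = Re (cinner y (x::'a::chilbert_space))"
  by (subst cinner_commute) simp

lemma norm_add_square:
  "(norm (x + y::'a::chilbert_space))\<^sup>2 = (norm x)\<^sup>2 + (norm y)\<^sup>2 + 2 * Re (cinner x y)"
  using Re_cinner_commute[of x y]
  by (simp add: norm_square_cinner cinner_add_left cinner_add_right)

lemma norm_diff_square:
  "(norm (x - y::'a::chilbert_space))\<^sup>2 = (norm x)\<^sup>2 + (norm y)\<^sup>2 - 2 * Re (cinner x y)"
  using norm_add_square[of x "-y"] by simp

lemma norm_add_square_orthogonal:
  assumes "cinner x (y::'a::chilbert_space) = 0"
  shows "(norm (x + y))\<^sup>2 = (norm x)\<^sup>2 + (norm y)\<^sup>2"
  using assms by (simp add: norm_add_square)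

lemma norm_scaleC [simp]: "norm (z *\<^sub>C (x::'a::chilbert_space)) = cmod z * norm x"
proof -
  have "cinner (z *\<^sub>C x) (z *\<^sub>C x) = (z * cnj z) * cinner x x"
    by (simp add: cinner_scaleC_left cinner_scaleC_right)
  also have "\<dots> = of_real ((cmod z * norm x)\<^sup>2)"
    by (simp only: complex_norm_square[symmetric] cinner_self power_mult_distrib of_real_mult)
  finally have "(norm (z *\<^sub>C x))\<^sup>2 = (cmod z * norm x)\<^sup>2"
    by (simp only: cinner_self of_real_eq_iff)
  then show ?thesis by simp
qed

text \<open>Pythagoras for the splitting of \<open>x\<close> along the line through
  \<open>y\<close>. It yields Cauchy-Schwarz, and it measures how far a non-orthogonal candidate is
  from minimising a distance.\<close>

lemma norm_minus_projection_square:
  fixes x y :: "'a::chilbert_space"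
  assumes "y \<noteq> 0"
  shows "(norm (x - (cinner y x / of_real ((norm y)\<^sup>2)) *\<^sub>C y))\<^sup>2
    = (norm x)\<^sup>2 - (cmod (cinner y x))\<^sup>2 / (norm y)\<^sup>2"
proof -
  define c where "c = cinner y x / of_real ((norm y)\<^sup>2)"
  define w where "w = x - c *\<^sub>C y"
  have 1: "cinner y w = 0"
    using assms by (simp add: w_def c_def cinner_diff_right cinner_scaleC_right cinner_self)
  have "x = w + c *\<^sub>C y" by (simp add: w_def)
  moreover have "cinner w (c *\<^sub>C y) = 0"
    using 1 by (metis cinner_commute cinner_scaleC_right complex_cnj_zero mult_zero_right)
  ultimately have "(norm x)\<^sup>2 = (norm w)\<^sup>2 + (norm (c *\<^sub>C y))\<^sup>2"
    by (metis norm_add_square_orthogonal)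
  moreover have "(norm (c *\<^sub>C y))\<^sup>2 = (cmod (cinner y x))\<^sup>2 / (norm y)\<^sup>2"
    using assms by (simp add: c_def norm_divide power_divide power2_eq_square norm_mult)
  ultimately show ?thesis by (simp add: w_def c_def)
qed

lemma Cauchy_Schwarz_cinner: "cmod (cinner x y) \<le> norm x * norm (y::'a::chilbert_space)"
proof (cases "x = 0")
  case False
  then have "(cmod (cinner x y))\<^sup>2 / (norm x)\<^sup>2 \<le> (norm y)\<^sup>2"
    using norm_minus_projection_square[OF False, of y] zero_le_power2[of "norm (y - (cinner x y / of_real ((norm x)\<^sup>2)) *\<^sub>C x)"]
    by linarith
  then have "(cmod (cinner x y))\<^sup>2 \<le> (norm x * norm y)\<^sup>2"
    using False by (simp add: divide_le_eq power_mult_distrib mult.commute)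
  then show ?thesis by (rule power2_le_imp_le) simp
qed simp

lemma bounded_linear_scaleC: "bounded_linear (\<lambda>x::'a::chilbert_space. z *\<^sub>C x)"
  by (rule bounded_linear_intro[where K="cmod z"])
    (auto simp: scaleC_add_right scaleC_scaleR_commute mult.commute)

text \<open>Over the reals the antilinear slot is linear as well, so limits and the product rule for
  derivatives become available for inner products along curves.\<close>

lemma bounded_bilinear_cinner: "bounded_bilinear (cinner :: 'a::chilbert_space \<Rightarrow> 'a \<Rightarrow> complex)"
proof
  show "\<exists>K. \<forall>a b. norm (cinner (a::'a) b) \<le> norm a * norm b * K"
    by (rule exI[of _ 1]) (simp add: Cauchy_Schwarz_cinner)
qed (simp_all add: cinner_add_left cinner_add_right cinner_scaleR_left cinner_scaleR_right scaleR_conv_of_real)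

lemmas tendsto_cinner = bounded_bilinear.tendsto[OF bounded_bilinear_cinner]
lemmas cinner_sum_left = bounded_bilinear.sum_left[OF bounded_bilinear_cinner]
lemmas cinner_sum_right = bounded_bilinear.sum_right[OF bounded_bilinear_cinner]

section \<open>Complex subspaces and the projection theorem\<close>

lemma csubspace_minus: "csubspace S \<Longrightarrow> x \<in> S \<Longrightarrow> - (x::'a::chilbert_space) \<in> S"
  by (metis csubspace_def scaleC_minus_left scaleC_one)

lemma csubspace_diff: "csubspace S \<Longrightarrow> x \<in> S \<Longrightarrow> y \<in> S \<Longrightarrow> x - (y::'a::chilbert_space) \<in> S"
  by (metis csubspace_def csubspace_minus diff_conv_add_uminus)

lemma csubspace_scaleR: "csubspace S \<Longrightarrow> x \<in> S \<Longrightarrow> r *\<^sub>R (x::'a::chilbert_space) \<in> S"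
  by (metis csubspace_def scaleC_of_real)

text \<open>A minimising sequence for the distance to \<open>u\<close> is Cauchy by the
  parallelogram law, and its limit is orthogonal because any remaining component along some
  \<open>y\<close> could be used to shorten the distance.\<close>

theorem projection_exists:
  fixes S :: "'a::chilbert_space set"
  assumes sub: "csubspace S" and cl: "closed S"
  shows "\<exists>p\<in>S. \<forall>w\<in>S. cinner w (u - p) = 0"
proof -
  define f where "f w = (norm (u - w))\<^sup>2" for w
  define d where "d = Inf (f ` S)"
  have S0: "0 \<in> S" using sub by (simp add: csubspace_def)
  have bdd: "bdd_below (f ` S)" by (rule bdd_belowI[of _ 0]) (auto simp: f_def)
  have dle: "d \<le> f w" if "w \<in> S" for w unfolding d_def using bdd that by (simp add: cINF_lower)
  have "\<exists>w\<in>S. f w < d + 1 / Suc n" for n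
    using cInf_lessD[of "f ` S" "d + 1 / Suc n"] S0 unfolding d_def by auto
  then obtain w where w: "\<And>n. w n \<in> S" "\<And>n. f (w n) < d + 1 / Suc n" by metis
  \<comment> \<open>The midpoint \<open>?h\<close> lies in \<open>S\<close>, so its squared distance
    to \<open>u\<close> is at least \<open>d\<close>; the parallelogram law converts this into
    closeness of \<open>w n\<close> and \<open>w m\<close>.\<close>
  have par: "(norm (w n - w m))\<^sup>2 \<le> 2 / Suc n + 2 / Suc m" for n m
  proof -
    let ?h = "(1/2::real) *\<^sub>R (w n + w m)"
    have "?h \<in> S" using w sub by (intro csubspace_scaleR[OF sub]) (auto simp: csubspace_def)
    then have "d \<le> f ?h" by (rule dle)
    moreover have "4 * f ?h = (norm ((u - w n) + (u - w m)))\<^sup>2"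
    proof -
      have "(u - w n) + (u - w m) = 2 *\<^sub>R (u - ?h)"
        by (simp add: algebra_simps scaleR_2)
      then show ?thesis by (simp add: f_def power_mult_distrib)
    qed
    moreover have "(norm ((u - w n) + (u - w m)))\<^sup>2 + (norm (w n - w m))\<^sup>2 = 2 * f (w n) + 2 * f (w m)"
      using norm_add_square[of "u - w n" "u - w m"] norm_diff_square[of "u - w m" "u - w n"] Re_cinner_commute[of "u - w n" "u - w m"]
      by (simp add: f_def)
    ultimately show ?thesis using w(2)[of n] w(2)[of m] by simp
  qed
  have "Cauchy w"
  proof (rule metric_CauchyI)
    fix e :: real assume "e > 0"
    then obtain k where k: "4 / e\<^sup>2 < real k" using reals_Archimedean2 by blast
    have "dist (w n) (w m) < e" if "n \<ge> k" "m \<ge> k" for n m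
    proof -
      have 0: "k > 0" using k \<open>e > 0\<close> by (cases k) (auto simp: not_less[symmetric])
      have "2 / Suc n + 2 / Suc m \<le> 2 / k + 2 / (k::real)"
        using that 0 by (intro add_mono divide_left_mono) auto
      also have "\<dots> < e\<^sup>2" using k 0 \<open>e > 0\<close> by (simp add: field_simps)
      finally have "(norm (w n - w m))\<^sup>2 < e\<^sup>2" using par[of n m] by simp
      then show ?thesis using \<open>e > 0\<close> by (simp add: dist_norm power2_less_imp_less)
    qed
    then show "\<exists>k. \<forall>n\<ge>k. \<forall>m\<ge>k. dist (w n) (w m) < e" by blast
  qed
  then obtain p where p: "w \<longlonglongrightarrow> p" using Cauchy_convergent convergent_def by blast
  have pS: "p \<in> S" using cl p w(1) closed_sequentially by blast
  have "(\<lambda>n. f (w n)) \<longlonglongrightarrow> f p" unfolding f_def by (intro tendsto_intros p)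
  moreover have "(\<lambda>n. d + 1 / Suc n) \<longlonglongrightarrow> d + 0"
    by (intro tendsto_intros LIMSEQ_Suc[OF lim_1_over_n])
  ultimately have "f p \<le> d + 0" by (rule LIMSEQ_le) (use w(2) less_imp_le in blast)
  then have fp: "f p \<le> d" by simp
  have "cinner y (u - p) = 0" if "y \<in> S" for y
  proof (cases "y = 0")
    case False
    \<comment> \<open>The optimal coefficient: moving \<open>p\<close> by
      \<open>z *\<^sub>C y\<close> lowers the squared distance by the full squared component along
      \<open>y\<close>.\<close>
    define z where "z = cinner y (u - p) / of_real ((norm y)\<^sup>2)"
    have "p + z *\<^sub>C y \<in> S" using pS sub that by (auto simp: csubspace_def)
    then have "f p \<le> f (p + z *\<^sub>C y)" using dle fp by fastforce
    moreover have "f (p + z *\<^sub>C y) = f p - (cmod (cinner y (u - p)))\<^sup>2 / (norm y)\<^sup>2"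
      using norm_minus_projection_square[OF False, of "u - p"] by (simp add: f_def z_def algebra_simps)
    ultimately have "(cmod (cinner y (u - p)))\<^sup>2 / (norm y)\<^sup>2 \<le> 0" by simp
    then show ?thesis using False by (simp add: divide_le_0_iff)
  qed simp
  then show ?thesis using pS by blast
qed

lemma orth_proj_unique:
  assumes "csubspace S" "p \<in> S" "\<forall>w\<in>S. cinner w (u - p) = 0"
  shows "orth_proj S u = p"
  unfolding orth_proj_def
proof (rule the_equality)
  fix q assume q: "q \<in> S \<and> (\<forall>w\<in>S. cinner w (u - q) = 0)"
  have "q - p \<in> S" using csubspace_diff assms q by blast
  then have "cinner (q - p) (u - p) = 0" "cinner (q - p) (u - q) = 0" using assms q by auto
  then have "cinner (q - p) (q - p) = 0" by (simp add: cinner_diff_right)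
  then show "q = p" by simp
qed (use assms in auto)

text \<open>Closedness supplies a witness for the definite description in \<open>orth_proj\<close>;
  without one its value would be unspecified.\<close>

lemma orth_proj:
  assumes "csubspace S" "closed S"
  shows orth_proj_in: "orth_proj S u \<in> S"
    and orth_proj_orthogonal: "w \<in> S \<Longrightarrow> cinner w (u - orth_proj S u) = 0"
  using projection_exists[OF assms, of u] orth_proj_unique[OF assms(1)] by auto

lemma orth_proj_id: "csubspace S \<Longrightarrow> u \<in> S \<Longrightarrow> orth_proj S u = u"
  by (rule orth_proj_unique) auto

lemma orth_proj_eq_zero: "csubspace S \<Longrightarrow> (\<And>w. w \<in> S \<Longrightarrow> cinner w u = 0) \<Longrightarrow> orth_proj S u = 0"
  by (rule orth_proj_unique) (auto simp: csubspace_def)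

lemma clinear_on_orth_proj:
  assumes "csubspace S" "closed S"
  shows "clinear_on UNIV (orth_proj S)"
proof -
  note o = orth_proj_in[OF assms] orth_proj_orthogonal[OF assms]
  have "orth_proj S (x + y) = orth_proj S x + orth_proj S y" for x y
  proof (rule orth_proj_unique[OF assms(1)])
    have "x + y - (orth_proj S x + orth_proj S y) = (x - orth_proj S x) + (y - orth_proj S y)" by simp
    then show "\<forall>w\<in>S. cinner w (x + y - (orth_proj S x + orth_proj S y)) = 0"
      using o(2) by (simp only: cinner_add_right) simp
  qed (use o(1) assms(1) in \<open>simp add: csubspace_def\<close>)
  moreover have "orth_proj S (z *\<^sub>C x) = z *\<^sub>C orth_proj S x" for x z
  proof (rule orth_proj_unique[OF assms(1)])
    show "\<forall>w\<in>S. cinner w (z *\<^sub>C x - z *\<^sub>C orth_proj S x) = 0"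
      using o(2) by (simp only: cinner_scaleC_right scaleC_diff_right[symmetric]) simp
  qed (use o(1) assms(1) in \<open>simp add: csubspace_def\<close>)
  ultimately show ?thesis by (auto simp: clinear_on_def csubspace_def)
qed

lemma cinner_orth_proj:
  assumes "csubspace S" "closed S"
  shows "cinner (orth_proj S u) v = cinner u (orth_proj S v)"
proof -
  note o = orth_proj_in[OF assms] orth_proj_orthogonal[OF assms]
  have "cinner (orth_proj S u) v = cinner (orth_proj S u) (orth_proj S v)"
    using o(2)[OF o(1), of u v] by (simp add: cinner_diff_right)
  moreover have "cinner (orth_proj S v) u = cinner (orth_proj S v) (orth_proj S u)"
    using o(2)[OF o(1), of v u] by (simp add: cinner_diff_right)
  ultimately show ?thesis by (metis cinner_commute)
qed

lemma norm_orth_proj: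
  assumes "csubspace S" "closed S"
  shows "norm (orth_proj S u) \<le> norm u"
proof -
  have "cinner (orth_proj S u) (u - orth_proj S u) = 0"
    using orth_proj_in[OF assms] orth_proj_orthogonal[OF assms] by blast
  then have "(norm u)\<^sup>2 = (norm (orth_proj S u))\<^sup>2 + (norm (u - orth_proj S u))\<^sup>2"
    using norm_add_square_orthogonal[of "orth_proj S u" "u - orth_proj S u"] by simp
  then show ?thesis by (metis le_add_same_cancel1 norm_ge_zero power2_le_imp_le zero_le_power2)
qed

section \<open>Spectral resolutions with discrete spectrum\<close>

lemma norm_sum_square_orthogonal:
  fixes x :: "'i \<Rightarrow> 'a::chilbert_space"
  assumes "finite F" "\<And>i j. i \<in> F \<Longrightarrow> j \<in> F \<Longrightarrow> i \<noteq> j \<Longrightarrow> cinner (x i) (x j) = 0"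
  shows "(norm (\<Sum>i\<in>F. x i))\<^sup>2 = (\<Sum>i\<in>F. (norm (x i))\<^sup>2)"
  using assms
proof (induction F)
  case (insert i F)
  have "cinner (x i) (\<Sum>j\<in>F. x j) = 0"
    unfolding cinner_sum_right using insert.prems insert.hyps by (intro sum.neutral ballI) auto
  then show ?case using insert by (simp add: norm_add_square_orthogonal)
qed simp

text \<open>Such a family need not be absolutely summable, so the Cauchy criterion is checked on the
  net of finite partial sums. By Pythagoras the difference of two of them is controlled by a tail of
  the numerical series of squares.\<close>

lemma orthogonal_summable_on:
  fixes x :: "'i \<Rightarrow> 'a::chilbert_space"
  assumes orth: "\<And>i j. i \<in> A \<Longrightarrow> j \<in> A \<Longrightarrow> i \<noteq> j \<Longrightarrow> cinner (x i) (x j) = 0"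
    and sq: "(\<lambda>i. (norm (x i))\<^sup>2) summable_on A"
  shows "x summable_on A"
proof -
  have "\<exists>P. eventually P (finite_subsets_at_top A) \<and>
              (\<forall>F F'. P F \<and> P F' \<longrightarrow> dist (sum x F) (sum x F') < e)" if "e > 0" for e
  proof -
    define g where "g = (\<lambda>i. (norm (x i))\<^sup>2)"
    have "(e/3)\<^sup>2 > 0" using that by simp
    then obtain F0 where F0: "finite F0" "F0 \<subseteq> A" "dist (sum g F0) (infsum g A) \<le> (e/3)\<^sup>2"
      using infsum_finite_approximation[of g A "(e/3)\<^sup>2"] sq unfolding g_def by blast
    define P where "P F \<longleftrightarrow> finite F \<and> F0 \<subseteq> F \<and> F \<subseteq> A" for F
    have close: "norm (sum x F - sum x F0) \<le> e/3" if "P F" for F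
    proof -
      have F: "finite F" "F0 \<subseteq> F" "F \<subseteq> A" using that by (auto simp: P_def)
      have "(norm (sum x F - sum x F0))\<^sup>2 = (norm (sum x (F - F0)))\<^sup>2"
        using F by (simp add: sum_diff F0)
      also have "\<dots> = sum g (F - F0)"
        unfolding g_def using F by (intro norm_sum_square_orthogonal orth) auto
      also have "\<dots> = sum g F - sum g F0" using F by (simp add: sum_diff F0)
      also have "\<dots> \<le> infsum g A - sum g F0"
        using F sq by (intro diff_right_mono finite_sum_le_infsum) (auto simp: g_def)
      also have "\<dots> \<le> (e/3)\<^sup>2" using abs_le_D2[OF F0(3)[unfolded dist_real_def]] by (simp only: minus_diff_eq)
      finally show ?thesis by (rule power2_le_imp_le) (use \<open>e > 0\<close> in simp)
    qed
    have "eventually P (finite_subsets_at_top A)"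
      unfolding eventually_finite_subsets_at_top P_def using F0 by blast
    moreover have "dist (sum x F) (sum x F') < e" if "P F" "P F'" for F F'
      using close[OF that(1)] close[OF that(2)] \<open>e > 0\<close>
        norm_triangle_ineq4[of "sum x F - sum x F0" "sum x F' - sum x F0"]
      by (simp add: dist_norm)
    ultimately show ?thesis by blast
  qed
  then have "cauchy_filter (filtermap (sum x) (finite_subsets_at_top A))"
    by (simp add: cauchy_filter_metric_filtermap)
  moreover have "complete (UNIV::'a set)"
    by (meson Cauchy_convergent UNIV_I complete_def convergent_def)
  ultimately obtain L' where "(sum x \<longlongrightarrow> L') (finite_subsets_at_top A)"
    using complete_uniform[where S=UNIV] by (force simp add: filterlim_def)
  then show ?thesis
    using summable_on_def has_sum_def by blast
qed

text \<open>What the spectral theorem provides for Lambda: \<open>S\<close> is the set of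
  eigenvalues and \<open>p l\<close> the eigenprojection. All later calculus with powers and cutoffs
  uses these properties only. Since \<open>S\<close> lies in \<open>[1, \<infinity>)\<close>, powers
  increase with the exponent.\<close>

locale spectral_resolution =
  fixes S :: "real set" and p :: "real \<Rightarrow> 'a::chilbert_space \<Rightarrow> 'a"
  assumes S_ge_1: "\<And>l. l \<in> S \<Longrightarrow> 1 \<le> l"
    and finite_below: "\<And>K. finite {l \<in> S. l \<le> K}"
    and clinear_p: "\<And>l. l \<in> S \<Longrightarrow> clinear_on UNIV (p l)"
    and norm_p: "\<And>l u. l \<in> S \<Longrightarrow> norm (p l u) \<le> norm u"
    and cinner_p: "\<And>l u v. l \<in> S \<Longrightarrow> cinner (p l u) v = cinner u (p l v)"
    and p_idem: "\<And>l u. l \<in> S \<Longrightarrow> p l (p l u) = p l u"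
    and p_orth: "\<And>l m u. l \<in> S \<Longrightarrow> m \<in> S \<Longrightarrow> l \<noteq> m \<Longrightarrow> p l (p m u) = 0"
    and p_total: "\<And>u. (\<And>l. l \<in> S \<Longrightarrow> p l u = 0) \<Longrightarrow> u = 0"
begin

section \<open>Componentwise calculus, Bessel and Parseval\<close>

lemma p_add: "l \<in> S \<Longrightarrow> p l (u + v) = p l u + p l v"
  and p_scaleC: "l \<in> S \<Longrightarrow> p l (z *\<^sub>C u) = z *\<^sub>C p l u"
  using clinear_p by (auto simp: clinear_on_def)

lemma bounded_linear_p: "l \<in> S \<Longrightarrow> bounded_linear (p l)"
  by (rule bounded_linear_intro[where K=1])
    (auto simp: p_add norm_p p_scaleC simp flip: scaleC_of_real)

lemma p_diff: "l \<in> S \<Longrightarrow> p l (u - v) = p l u - p l v"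
  and p_scaleR: "l \<in> S \<Longrightarrow> p l (r *\<^sub>R u) = r *\<^sub>R p l u"
  and p_sum: "l \<in> S \<Longrightarrow> p l (\<Sum>i\<in>F. f i) = (\<Sum>i\<in>F. p l (f i))"
  using bounded_linear.linear[OF bounded_linear_p]
  by (auto simp: linear_diff linear_scale linear_sum)

lemma p_zero: "l \<in> S \<Longrightarrow> p l 0 = 0"
  using p_scaleR[of l 0 0] by simp

lemma p_p: "l \<in> S \<Longrightarrow> m \<in> S \<Longrightarrow> p l (p m u) = (if l = m then p l u else 0)"
  using p_idem p_orth by auto

lemma cinner_p_p: "l \<in> S \<Longrightarrow> m \<in> S \<Longrightarrow> l \<noteq> m \<Longrightarrow> cinner (p l u) (p m v) = 0"
  by (simp add: cinner_p p_orth)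

text \<open>By totality an identity between vectors may be checked on spectral components; this is
  the standard way of proving operator identities below.\<close>

lemma p_ext: "(\<And>l. l \<in> S \<Longrightarrow> p l u = p l v) \<Longrightarrow> u = v"
  using p_total[of "u - v"] by (simp add: p_diff)

lemma norm_weighted_sum_square:
  assumes "finite F" "F \<subseteq> S"
  shows "(norm (\<Sum>l\<in>F. f l *\<^sub>R p l u))\<^sup>2 = (\<Sum>l\<in>F. (f l)\<^sup>2 * (norm (p l u))\<^sup>2)"
  using assms norm_sum_square_orthogonal[of F "\<lambda>l. f l *\<^sub>R p l u"] cinner_p_p
  by (simp add: cinner_scaleR_left cinner_scaleR_right power_mult_distrib subset_iff)

lemma cinner_weighted_sum:
  assumes "finite F" "F \<subseteq> S"
  shows "cinner (\<Sum>l\<in>F. f l *\<^sub>R p l u) u = of_real (\<Sum>l\<in>F. f l * (norm (p l u))\<^sup>2)"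
  unfolding cinner_sum_left of_real_sum
proof (rule sum.cong)
  fix l assume "l \<in> F"
  then have "cinner (p l u) u = cinner (p l u) (p l u)"
    using assms by (metis cinner_p p_idem subsetD)
  then show "cinner (f l *\<^sub>R p l u) u = of_real (f l * (norm (p l u))\<^sup>2)"
    by (simp add: cinner_scaleR_left cinner_self)
qed simp

lemma Bessel_inequality:
  assumes "finite F" "F \<subseteq> S"
  shows "(\<Sum>l\<in>F. (norm (p l u))\<^sup>2) \<le> (norm u)\<^sup>2"
proof -
  define w where "w = (\<Sum>l\<in>F. p l u)"
  have 1: "(norm w)\<^sup>2 = (\<Sum>l\<in>F. (norm (p l u))\<^sup>2)"
    using norm_weighted_sum_square[OF assms, of "\<lambda>_. 1"] by (simp add: w_def)
  have 2: "Re (cinner w u) = (norm w)\<^sup>2"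
    using cinner_weighted_sum[OF assms, of "\<lambda>_. 1"] by (simp add: 1) (simp add: w_def)
  show ?thesis using norm_diff_square[of w u] zero_le_power2[of "norm (w - u)"] 1 2 by linarith
qed

lemma has_sum_weighted:
  assumes "(\<lambda>l. (f l)\<^sup>2 * (norm (p l u))\<^sup>2) summable_on S"
  shows "((\<lambda>l. f l *\<^sub>R p l u) has_sum (\<Sum>\<^sub>\<infinity>l\<in>S. f l *\<^sub>R p l u)) S"
  using assms cinner_p_p
  by (intro has_sum_infsum orthogonal_summable_on)
    (auto simp: cinner_scaleR_left cinner_scaleR_right power_mult_distrib)

text \<open>The projection \<open>p m\<close> is continuous, so it passes under the infinite sum,
  and orthogonality leaves only the term with index \<open>m\<close>.\<close>

lemma p_weighted_sum:
  assumes "(\<lambda>l. (f l)\<^sup>2 * (norm (p l u))\<^sup>2) summable_on S" "m \<in> S"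
  shows "p m (\<Sum>\<^sub>\<infinity>l\<in>S. f l *\<^sub>R p l u) = f m *\<^sub>R p m u"
proof -
  have "((\<lambda>l. p m (f l *\<^sub>R p l u)) has_sum p m (\<Sum>\<^sub>\<infinity>l\<in>S. f l *\<^sub>R p l u)) S"
    by (rule has_sum_bounded_linear[OF bounded_linear_p has_sum_weighted]) (use assms in auto)
  moreover have "((\<lambda>l. p m (f l *\<^sub>R p l u)) has_sum f m *\<^sub>R p m u) S \<longleftrightarrow>
      ((\<lambda>l. p m (f l *\<^sub>R p l u)) has_sum f m *\<^sub>R p m u) {m}"
    using assms(2) by (intro has_sum_cong_neutral) (auto simp: p_scaleR p_orth)
  moreover have "((\<lambda>l. p m (f l *\<^sub>R p l u)) has_sum f m *\<^sub>R p m u) {m}"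
    using assms(2) by (intro has_sum_finiteI) (auto simp: p_scaleR p_idem)
  ultimately show ?thesis by (metis has_sum_unique)
qed

lemma summable_norm_p_square: "(\<lambda>l. (norm (p l u))\<^sup>2) summable_on S"
  by (rule nonneg_bdd_above_summable_on) (auto intro!: bdd_aboveI2 Bessel_inequality)

text \<open>Bessel makes the components summable; their sum has the same components as
  \<open>u\<close>, so totality identifies the two.\<close>

lemma has_sum_p: "((\<lambda>l. p l u) has_sum u) S"
proof -
  have s: "(\<lambda>l. (1::real)\<^sup>2 * (norm (p l u))\<^sup>2) summable_on S"
    using summable_norm_p_square by simp
  have "(\<Sum>\<^sub>\<infinity>l\<in>S. (1::real) *\<^sub>R p l u) = u"
    by (rule p_ext) (simp only: p_weighted_sum[OF s], simp)
  then show ?thesis using has_sum_weighted[OF s] by simp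
qed

lemma Parseval_has_sum: "((\<lambda>l. (norm (p l u))\<^sup>2) has_sum (norm u)\<^sup>2) S"
proof -
  have "((\<lambda>F. (norm (\<Sum>l\<in>F. p l u))\<^sup>2) \<longlongrightarrow> (norm u)\<^sup>2) (finite_subsets_at_top S)"
    using has_sum_p[of u] unfolding has_sum_def by (intro tendsto_intros)
  moreover have "\<forall>\<^sub>F F in finite_subsets_at_top S. (norm (\<Sum>l\<in>F. p l u))\<^sup>2 = (\<Sum>l\<in>F. (norm (p l u))\<^sup>2)"
    using norm_weighted_sum_square[of _ "\<lambda>_. 1" u]
    by (intro eventually_finite_subsets_at_top_weakI) auto
  ultimately show ?thesis unfolding has_sum_def by (rule Lim_transform_eventually)
qed

text \<open>Parseval reduces a norm estimate to a scalar inequality for each spectral value. The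
  bounds for powers and cutoffs are obtained this way.\<close>

lemma norm_le_of_components:
  assumes "C \<ge> 0" "\<And>l. l \<in> S \<Longrightarrow> norm (p l v) \<le> C * norm (p l w)"
  shows "norm v \<le> C * norm w"
proof -
  have "(norm v)\<^sup>2 \<le> C\<^sup>2 * (norm w)\<^sup>2"
  proof (rule has_sum_mono[OF Parseval_has_sum has_sum_cmult_right[OF Parseval_has_sum]])
    fix l assume "l \<in> S"
    then have "(norm (p l v))\<^sup>2 \<le> (C * norm (p l w))\<^sup>2" using assms by (intro power_mono) auto
    then show "(norm (p l v))\<^sup>2 \<le> C\<^sup>2 * (norm (p l w))\<^sup>2" by (simp add: power_mult_distrib)
  qed
  then have "(norm v)\<^sup>2 \<le> (C * norm w)\<^sup>2" by (simp add: power_mult_distrib)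
  then show ?thesis by (rule power2_le_imp_le) (use assms(1) in simp)
qed

section \<open>Powers of the operator, their domains and the spectral cutoffs\<close>

definition dom :: "real \<Rightarrow> 'a set" where
  "dom r = {u. (\<lambda>l. (l powr r)\<^sup>2 * (norm (p l u))\<^sup>2) summable_on S}"

definition pw :: "real \<Rightarrow> 'a \<Rightarrow> 'a" where
  "pw r u = (\<Sum>\<^sub>\<infinity>l\<in>S. (l powr r) *\<^sub>R p l u)"

text \<open>A finite sum, by \<open>finite_below\<close>. The cutoff \<open>K\<close> refers to the
  spectrum of Lambda, not of the reference operator, which is smaller by one.\<close>

definition tp :: "real \<Rightarrow> 'a \<Rightarrow> 'a" where
  "tp K u = (\<Sum>l | l \<in> S \<and> l \<le> K. p l u)"

lemma p_pw: "u \<in> dom r \<Longrightarrow> l \<in> S \<Longrightarrow> p l (pw r u) = (l powr r) *\<^sub>R p l u"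
  unfolding dom_def pw_def by (auto intro: p_weighted_sum)

lemma has_sum_norm_pw:
  assumes "u \<in> dom r"
  shows "((\<lambda>l. (l powr r)\<^sup>2 * (norm (p l u))\<^sup>2) has_sum (norm (pw r u))\<^sup>2) S"
  using Parseval_has_sum[of "pw r u"]
  by (rule has_sum_cong[THEN iffD1, rotated]) (simp add: p_pw assms power_mult_distrib)

text \<open>Each hypothesis involves finitely many components only, so it survives limits taken in
  the Hilbert space norm. This is how regularity is later passed to the limit propagator.\<close>

lemma dom_bounded:
  assumes "B \<ge> 0"
    and "\<And>F. finite F \<Longrightarrow> F \<subseteq> S \<Longrightarrow> (\<Sum>l\<in>F. (l powr r)\<^sup>2 * (norm (p l u))\<^sup>2) \<le> B\<^sup>2"
  shows "u \<in> dom r" "norm (pw r u) \<le> B"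
proof -
  show u: "u \<in> dom r" unfolding dom_def
    by (auto intro!: nonneg_bdd_above_summable_on bdd_aboveI2 assms)
  have "(norm (pw r u))\<^sup>2 \<le> B\<^sup>2"
    using has_sum_norm_pw[OF u] unfolding has_sum_def
    by (rule tendsto_upperbound) (auto intro!: assms)
  then show "norm (pw r u) \<le> B" using assms(1) by (rule power2_le_imp_le)
qed

lemma finite_sum_le_norm_pw:
  "u \<in> dom r \<Longrightarrow> finite F \<Longrightarrow> F \<subseteq> S \<Longrightarrow>
    (\<Sum>l\<in>F. (l powr r)\<^sup>2 * (norm (p l u))\<^sup>2) \<le> (norm (pw r u))\<^sup>2"
  using finite_sum_le_has_sum[OF has_sum_norm_pw] by auto

lemma dom_of_components:
  assumes "w \<in> dom r" "\<And>l. l \<in> S \<Longrightarrow> norm ((l powr s) *\<^sub>R p l v) \<le> norm ((l powr r) *\<^sub>R p l w)"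
  shows "v \<in> dom s"
proof (rule dom_bounded(1))
  fix F assume F: "finite F" "F \<subseteq> S"
  have "(\<Sum>l\<in>F. (l powr s)\<^sup>2 * (norm (p l v))\<^sup>2) \<le> (\<Sum>l\<in>F. (l powr r)\<^sup>2 * (norm (p l w))\<^sup>2)"
  proof (rule sum_mono)
    fix l assume "l \<in> F"
    then have "(norm ((l powr s) *\<^sub>R p l v))\<^sup>2 \<le> (norm ((l powr r) *\<^sub>R p l w))\<^sup>2"
      using assms F by (intro power_mono) auto
    then show "(l powr s)\<^sup>2 * (norm (p l v))\<^sup>2 \<le> (l powr r)\<^sup>2 * (norm (p l w))\<^sup>2"
      by (simp add: power_mult_distrib)
  qed
  also have "\<dots> \<le> (norm (pw r w))\<^sup>2" using assms F by (intro finite_sum_le_norm_pw)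
  finally show "(\<Sum>l\<in>F. (l powr s)\<^sup>2 * (norm (p l v))\<^sup>2) \<le> (norm (pw r w))\<^sup>2" .
qed simp

lemma dom_mono:
  assumes "s \<le> r"
  shows "dom r \<subseteq> dom s"
proof
  fix u assume "u \<in> dom r"
  then show "u \<in> dom s"
    using assms S_ge_1 by (elim dom_of_components) (auto intro!: mult_right_mono powr_mono)
qed

lemma norm_pw_mono:
  assumes "s \<le> r" "u \<in> dom r"
  shows "norm (pw s u) \<le> norm (pw r u)"
proof -
  have "u \<in> dom s" using assms dom_mono by auto
  have "norm (pw s u) \<le> 1 * norm (pw r u)"
  proof (rule norm_le_of_components)
    fix l assume l: "l \<in> S"
    have "l powr s \<le> l powr r" using assms(1) S_ge_1[OF l] by (rule powr_mono)
    then show "norm (p l (pw s u)) \<le> 1 * norm (p l (pw r u))"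
      by (simp add: p_pw l assms(2) \<open>u \<in> dom s\<close> mult_right_mono)
  qed simp
  then show ?thesis by simp
qed

lemma dom_0: "u \<in> dom 0"
  unfolding dom_def mem_Collect_eq
  by (rule summable_on_cong[THEN iffD1, OF _ summable_norm_p_square[of u]]) (use S_ge_1 in force)

lemma pw_0: "pw 0 u = u"
  by (rule p_ext) (use S_ge_1 in \<open>force simp: p_pw dom_0\<close>)

lemma norm_le_norm_pw: "0 \<le> r \<Longrightarrow> u \<in> dom r \<Longrightarrow> norm u \<le> norm (pw r u)"
  using norm_pw_mono[of 0 r u] by (simp add: pw_0)

lemma csubspace_dom: "csubspace (dom r)"
proof -
  have "0 \<in> dom r" by (rule dom_bounded(1)[of 0]) (auto simp: p_zero subset_iff)
  moreover have "u + v \<in> dom r" if "u \<in> dom r" "v \<in> dom r" for u v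
  proof (rule dom_bounded(1))
    fix F assume F: "finite F" "F \<subseteq> S"
    \<comment> \<open>Minkowski's inequality for the weighted partial sums is the triangle
      inequality for the corresponding finite sums of vectors.\<close>
    have "(\<Sum>l\<in>F. (l powr r) *\<^sub>R p l (u + v)) = (\<Sum>l\<in>F. (l powr r) *\<^sub>R p l u) + (\<Sum>l\<in>F. (l powr r) *\<^sub>R p l v)"
      unfolding sum.distrib[symmetric] using F by (intro sum.cong) (auto simp: p_add scaleR_add_right subset_iff)
    then have "norm (\<Sum>l\<in>F. (l powr r) *\<^sub>R p l (u + v)) \<le> norm (\<Sum>l\<in>F. (l powr r) *\<^sub>R p l u) + norm (\<Sum>l\<in>F. (l powr r) *\<^sub>R p l v)"
      by (simp add: norm_triangle_ineq)
    also have "\<dots> \<le> norm (pw r u) + norm (pw r v)"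
      using F finite_sum_le_norm_pw that
      by (intro add_mono power2_le_imp_le[OF _ norm_ge_zero]) (auto simp: norm_weighted_sum_square)
    finally have "(norm (\<Sum>l\<in>F. (l powr r) *\<^sub>R p l (u + v)))\<^sup>2 \<le> (norm (pw r u) + norm (pw r v))\<^sup>2"
      by (intro power_mono) auto
    then show "(\<Sum>l\<in>F. (l powr r)\<^sup>2 * (norm (p l (u + v)))\<^sup>2) \<le> (norm (pw r u) + norm (pw r v))\<^sup>2"
      using F by (simp add: norm_weighted_sum_square)
  qed simp
  moreover have "z *\<^sub>C u \<in> dom r" if "u \<in> dom r" for z u
    unfolding dom_def mem_Collect_eq
  proof (rule summable_on_cong[THEN iffD1, OF _ summable_on_cmult_right])
    show "(\<lambda>l. (l powr r)\<^sup>2 * (norm (p l u))\<^sup>2) summable_on S" using that by (simp add: dom_def)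
    show "(cmod z)\<^sup>2 * ((l powr r)\<^sup>2 * (norm (p l u))\<^sup>2) = (l powr r)\<^sup>2 * (norm (p l (z *\<^sub>C u)))\<^sup>2" if "l \<in> S" for l
      using that by (simp add: p_scaleC power_mult_distrib)
  qed
  ultimately show ?thesis by (simp add: csubspace_def)
qed

lemma dom_add: "u \<in> dom r \<Longrightarrow> v \<in> dom r \<Longrightarrow> u + v \<in> dom r"
  and dom_diff: "u \<in> dom r \<Longrightarrow> v \<in> dom r \<Longrightarrow> u - v \<in> dom r"
  and dom_scaleC: "u \<in> dom r \<Longrightarrow> z *\<^sub>C u \<in> dom r"
  and dom_zero: "0 \<in> dom r"
  using csubspace_dom[of r] csubspace_diff[OF csubspace_dom[of r]] by (auto simp: csubspace_def)

lemma pw_add: "u \<in> dom r \<Longrightarrow> v \<in> dom r \<Longrightarrow> pw r (u + v) = pw r u + pw r v"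
  and pw_diff: "u \<in> dom r \<Longrightarrow> v \<in> dom r \<Longrightarrow> pw r (u - v) = pw r u - pw r v"
  and pw_scaleC: "u \<in> dom r \<Longrightarrow> pw r (z *\<^sub>C u) = z *\<^sub>C pw r u"
  by (rule p_ext, simp add: p_pw p_add p_diff p_scaleC dom_add dom_diff dom_scaleC scaleR_add_right
      scaleR_diff_right scaleC_scaleR_commute)+

lemma pw_zero: "pw r 0 = 0"
  using pw_diff[of 0 r 0] dom_zero by simp

lemma p_finite_sum:
  assumes "finite F" "F \<subseteq> S" "l \<in> S"
  shows "p l (\<Sum>m\<in>F. f m *\<^sub>R p m u) = (if l \<in> F then f l *\<^sub>R p l u else 0)"
proof -
  have "p l (\<Sum>m\<in>F. f m *\<^sub>R p m u) = (\<Sum>m\<in>F. if l = m then f m *\<^sub>R p m u else 0)"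
    unfolding p_sum[OF assms(3)] using assms by (intro sum.cong) (auto simp: p_scaleR p_p)
  then show ?thesis using assms(1) by simp
qed

lemma p_tp: "l \<in> S \<Longrightarrow> p l (tp K u) = (if l \<le> K then p l u else 0)"
  using p_finite_sum[of "{l\<in>S. l \<le> K}" l "\<lambda>_. 1" u] finite_below by (simp add: tp_def)

lemma tp_add: "tp K (u + v) = tp K u + tp K v"
  and tp_diff: "tp K (u - v) = tp K u - tp K v"
  and tp_scaleC: "tp K (z *\<^sub>C u) = z *\<^sub>C tp K u"
  and tp_scaleR: "tp K (r *\<^sub>R u) = r *\<^sub>R tp K u"
  by (rule p_ext, simp add: p_tp p_add p_diff p_scaleC p_scaleR)+

lemma tp_tp: "tp K (tp M u) = tp (min K M) u"
  by (rule p_ext) (auto simp: p_tp)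

lemma tp_idem [simp]: "tp K (tp K u) = tp K u"
  by (simp add: tp_tp)

lemma norm_tp: "norm (tp K u) \<le> norm u"
  using norm_le_of_components[of 1 "tp K u" u] by (auto simp: p_tp)

lemma bounded_linear_tp: "bounded_linear (tp K)"
  by (rule bounded_linear_intro[where K=1]) (auto simp: tp_add tp_scaleR norm_tp)

lemma cinner_tp: "cinner (tp K u) v = cinner u (tp K v)"
  unfolding tp_def cinner_sum_left cinner_sum_right by (intro sum.cong) (auto simp: cinner_p)

lemma tp_in_dom: "tp K u \<in> dom r"
proof (rule dom_bounded(1))
  fix F assume F: "finite F" "F \<subseteq> S"
  have "(\<Sum>l\<in>F. (l powr r)\<^sup>2 * (norm (p l (tp K u)))\<^sup>2) = (\<Sum>l\<in>F \<inter> {l\<in>S. l \<le> K}. (l powr r)\<^sup>2 * (norm (p l u))\<^sup>2)"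
    using F by (intro sum.mono_neutral_cong_right) (auto simp: p_tp subset_iff split: if_splits)
  also have "\<dots> \<le> (\<Sum>l\<in>{l\<in>S. l \<le> K}. (l powr r)\<^sup>2 * (norm (p l u))\<^sup>2)"
    by (rule sum_mono2) (auto simp: finite_below)
  finally show "(\<Sum>l\<in>F. (l powr r)\<^sup>2 * (norm (p l (tp K u)))\<^sup>2)
    \<le> (sqrt (\<Sum>l\<in>{l\<in>S. l \<le> K}. (l powr r)\<^sup>2 * (norm (p l u))\<^sup>2))\<^sup>2"
    by (simp add: sum_nonneg)
qed (simp add: sum_nonneg)

lemma pw_tp: "u \<in> dom r \<Longrightarrow> pw r (tp K u) = tp K (pw r u)"
  by (rule p_ext) (simp add: p_pw p_tp tp_in_dom)

lemma norm_pw_tp_le: "u \<in> dom r \<Longrightarrow> norm (pw r (tp K u)) \<le> norm (pw r u)"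
  by (simp add: pw_tp norm_tp)

text \<open>Only spectral values up to \<open>K\<close> survive the cutoff. This inverse inequality
  is what makes \<open>H t\<close> bounded on truncated vectors.\<close>

lemma norm_pw_tp_le_powr:
  assumes "r \<ge> 0"
  shows "norm (pw r (tp K u)) \<le> K powr r * norm u"
proof (rule norm_le_of_components)
  fix l assume "l \<in> S"
  then show "norm (p l (pw r (tp K u))) \<le> K powr r * norm (p l u)"
    using assms S_ge_1[of l] by (auto simp: p_pw tp_in_dom p_tp intro!: mult_right_mono powr_mono2)
qed simp

text \<open>Only spectral values \<open>l > K\<close> remain, and there
  \<open>1 \<le> (l / K) powr r\<close>. This is the source of the convergence rate.\<close>

lemma norm_minus_tp_le:
  assumes "r \<ge> 0" "K > 0" "u \<in> dom r"
  shows "norm (u - tp K u) \<le> K powr (- r) * norm (pw r u)"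
proof (rule norm_le_of_components)
  fix l assume l: "l \<in> S"
  have "1 \<le> K powr (- r) * l powr r" if "K < l"
    using that assms powr_mono2[of r K l] by (simp add: powr_minus field_simps)
  from mult_right_mono[OF this, of "norm (p l u)"]
  show "norm (p l (u - tp K u)) \<le> K powr (- r) * norm (p l (pw r u))"
    using assms l by (auto simp: p_pw p_diff p_tp mult.assoc)
qed simp

lemma tendsto_tp: "((\<lambda>K. tp K u) \<longlongrightarrow> u) at_top"
proof (rule tendstoI)
  fix e :: real assume e: "e > 0"
  then obtain F where F: "finite F" "F \<subseteq> S" "dist (\<Sum>l\<in>F. p l u) u \<le> e/2"
    using has_sum_finite_approximation[OF has_sum_p[of u], of "e/2"] by auto
  define K0 where "K0 = Max (insert 0 F)"
  have K0: "l \<le> K0" if "l \<in> F" for l using F that by (auto simp: K0_def)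
  have "dist (tp K u) u < e" if "K \<ge> K0" for K
  proof -
    \<comment> \<open>Once \<open>K\<close> exceeds all of \<open>F\<close>, every component of the
      tail is either zero or also present in the error of the partial sum over
      \<open>F\<close>.\<close>
    have "norm (u - tp K u) \<le> 1 * norm (u - (\<Sum>l\<in>F. p l u))"
    proof (rule norm_le_of_components)
      fix l assume l: "l \<in> S"
      have "p l (\<Sum>m\<in>F. p m u) = (if l \<in> F then p l u else 0)"
        using p_finite_sum[of F l "\<lambda>_. 1" u] F l by simp
      then show "norm (p l (u - tp K u)) \<le> 1 * norm (p l (u - (\<Sum>l\<in>F. p l u)))"
        using K0[of l] that l by (auto simp: p_diff p_tp)
    qed simp
    then show ?thesis using F(3) e by (simp add: dist_norm norm_minus_commute)
  qed
  then show "\<forall>\<^sub>F K in at_top. dist (tp K u) u < e"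
    by (auto simp: eventually_at_top_linorder)
qed

text \<open>Cauchy-Schwarz for the pairing of \<open>u\<close> with its image under the power
  \<open>2 * r\<close>, carried out on finite partial sums. It upgrades convergence at level 0 to
  convergence at level \<open>r\<close> when level \<open>2 * r\<close> stays bounded.\<close>

lemma interpolation_inequality:
  assumes "r \<ge> 0" "u \<in> dom (2 * r)"
  shows "(norm (pw r u))\<^sup>2 \<le> norm u * norm (pw (2 * r) u)"
proof -
  have "norm (pw r u) \<le> sqrt (norm u * norm (pw (2 * r) u))"
  proof (rule dom_bounded(2))
    fix F assume F: "finite F" "F \<subseteq> S"
    define w where "w = (\<Sum>l\<in>F. (l powr (2 * r)) *\<^sub>R p l u)"
    have sq: "(l powr r)\<^sup>2 = l powr (2 * r)" if "l \<in> F" for l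
      using that F S_ge_1[of l] by (auto simp: powr_power mult.commute)
    have "(\<Sum>l\<in>F. (l powr r)\<^sup>2 * (norm (p l u))\<^sup>2) = Re (cinner w u)"
      unfolding w_def cinner_weighted_sum[OF F] by (simp add: sq)
    also have "\<dots> \<le> norm w * norm u"
      using Cauchy_Schwarz_cinner[of w u] complex_Re_le_cmod[of "cinner w u"] by linarith
    also have "\<dots> \<le> norm (pw (2 * r) u) * norm u"
    proof (rule mult_right_mono)
      have "(norm w)\<^sup>2 \<le> (norm (pw (2 * r) u))\<^sup>2"
        unfolding w_def norm_weighted_sum_square[OF F] by (rule finite_sum_le_norm_pw) (use assms F in auto)
      then show "norm w \<le> norm (pw (2 * r) u)" by (rule power2_le_imp_le) simp
    qed simp
    finally show "(\<Sum>l\<in>F. (l powr r)\<^sup>2 * (norm (p l u))\<^sup>2) \<le> (sqrt (norm u * norm (pw (2 * r) u)))\<^sup>2"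
      by (simp add: mult.commute)
  qed simp
  then have "(norm (pw r u))\<^sup>2 \<le> (sqrt (norm u * norm (pw (2 * r) u)))\<^sup>2"
    by (intro power_mono) auto
  then show ?thesis by simp
qed

lemma pw_tp_eq_sum: "pw r (tp K u) = (\<Sum>l | l \<in> S \<and> l \<le> K. (l powr r) *\<^sub>R p l u)"
  by (rule p_ext) (simp add: p_finite_sum finite_below p_pw tp_in_dom p_tp)

lemma cinner_pw_tp: "cinner (pw r (tp K u)) v = cinner u (pw r (tp K v))"
  unfolding pw_tp_eq_sum cinner_sum_left cinner_sum_right
  by (intro sum.cong) (auto simp: cinner_p cinner_scaleR_left cinner_scaleR_right)

text \<open>As a quadratic form of a bounded operator the energy is differentiable along truncated
  solutions, and the power \<open>2 * r\<close> of the commutator hypothesis appears.\<close>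

lemma norm_pw_tp_square: "(norm (pw r (tp K u)))\<^sup>2 = Re (cinner (pw (2 * r) (tp K u)) u)"
proof -
  let ?F = "{l\<in>S. l \<le> K}"
  have F: "finite ?F" "?F \<subseteq> S" using finite_below by auto
  have "(l powr r)\<^sup>2 = l powr (2 * r)" if "l \<in> ?F" for l
    using that S_ge_1[of l] by (auto simp: powr_power mult.commute)
  then show ?thesis
    unfolding pw_tp_eq_sum norm_weighted_sum_square[OF F] cinner_weighted_sum[OF F] by simp
qed

lemma bounded_linear_pw_tp: "bounded_linear (\<lambda>u. pw r (tp K u))"
proof (rule bounded_linear_intro[where K="K powr \<bar>r\<bar>"])
  fix u v :: 'a and c :: real
  show "pw r (tp K (u + v)) = pw r (tp K u) + pw r (tp K v)" by (simp add: tp_add pw_add tp_in_dom)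
  show "pw r (tp K (c *\<^sub>R u)) = c *\<^sub>R pw r (tp K u)"
    by (simp add: tp_scaleC pw_scaleC tp_in_dom flip: scaleC_of_real)
  \<comment> \<open>Passing to the absolute value of \<open>r\<close> covers negative exponents,
    since all spectral values are at least 1.\<close>
  have "norm (pw r (tp K u)) \<le> norm (pw \<bar>r\<bar> (tp K u))" by (rule norm_pw_mono) (auto simp: tp_in_dom)
  then show "norm (pw r (tp K u)) \<le> norm u * K powr \<bar>r\<bar>"
    using norm_pw_tp_le_powr[of "\<bar>r\<bar>" K u] by (simp add: mult.commute)
qed

end

section \<open>Positive operators with compact resolvent\<close>

text \<open>Self-adjointness enters as the two inclusions between the graphs of \<open>T\<close> and
  of its adjoint. Compactness is phrased for sequences bounded together with their images, a form
  that does not mention any resolvent point.\<close>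

locale strictly_positive_compact =
  fixes D :: "'a::chilbert_space set" and T :: "'a \<Rightarrow> 'a"
  assumes clinear_T: "clinear_on D T"
    and adjoint_imp: "\<And>y z. (\<And>x. x \<in> D \<Longrightarrow> cinner y (T x) = cinner z x) \<Longrightarrow> y \<in> D \<and> T y = z"
    and symmetric: "\<And>x y. x \<in> D \<Longrightarrow> y \<in> D \<Longrightarrow> cinner (T y) x = cinner y (T x)"
    and lower_bound: "\<And>x. x \<in> D \<Longrightarrow> (norm x)\<^sup>2 \<le> Re (cinner x (T x))"
    and compactness: "\<And>f B. (\<And>n::nat. f n \<in> D) \<Longrightarrow> (\<And>n. norm (f n) \<le> B) \<Longrightarrow>
      (\<And>n. norm (T (f n)) \<le> B) \<Longrightarrow> \<exists>r. strict_mono r \<and> convergent (f \<circ> r)"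
begin

lemma csubspace_D: "csubspace D" and T_add: "x \<in> D \<Longrightarrow> y \<in> D \<Longrightarrow> T (x + y) = T x + T y"
  and T_scaleC: "x \<in> D \<Longrightarrow> T (z *\<^sub>C x) = z *\<^sub>C T x"
  using clinear_T by (auto simp: clinear_on_def)

lemma D_add: "x \<in> D \<Longrightarrow> y \<in> D \<Longrightarrow> x + y \<in> D" and D_scaleC: "x \<in> D \<Longrightarrow> z *\<^sub>C x \<in> D"
  and D_zero: "0 \<in> D" and D_diff: "x \<in> D \<Longrightarrow> y \<in> D \<Longrightarrow> x - y \<in> D"
  and D_scaleR: "x \<in> D \<Longrightarrow> r *\<^sub>R x \<in> D"
  using csubspace_D csubspace_diff[OF csubspace_D] csubspace_scaleR[OF csubspace_D]
  by (auto simp: csubspace_def)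

lemma T_scaleR: "x \<in> D \<Longrightarrow> T (r *\<^sub>R x) = r *\<^sub>R T x"
  by (simp add: T_scaleC flip: scaleC_of_real)

lemma T_zero: "T 0 = 0"
  using T_scaleR[OF D_zero, of 0] by simp

lemma T_diff: "x \<in> D \<Longrightarrow> y \<in> D \<Longrightarrow> T (x - y) = T x - T y"
  using T_add[of "x - y" y] D_diff[of x y] by simp

text \<open>The adjoint relation is stable under limits, and \<open>adjoint_imp\<close> brings the
  limit back into the domain.\<close>

lemma closed_graph:
  assumes "\<And>n::nat. f n \<in> D" "f \<longlonglongrightarrow> x" "(\<lambda>n. T (f n)) \<longlonglongrightarrow> y"
  shows "x \<in> D \<and> T x = y"
proof (rule adjoint_imp)
  fix w assume w: "w \<in> D"
  have "(\<lambda>n. cinner (f n) (T w)) \<longlonglongrightarrow> cinner x (T w)"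
    by (intro tendsto_cinner assms tendsto_const)
  moreover have "(\<lambda>n. cinner (T (f n)) w) \<longlonglongrightarrow> cinner y w"
    by (intro tendsto_cinner assms tendsto_const)
  moreover have "cinner (f n) (T w) = cinner (T (f n)) w" for n
    using symmetric w assms(1) by simp
  ultimately show "cinner x (T w) = cinner y w" by (metis (no_types, lifting) LIMSEQ_unique ext)
qed

lemma norm_le_norm_T:
  assumes "x \<in> D"
  shows "norm x \<le> norm (T x)"
proof -
  have "norm x * norm x \<le> norm x * norm (T x)"
    using lower_bound[OF assms] complex_Re_le_cmod[of "cinner x (T x)"] Cauchy_Schwarz_cinner[of x "T x"]
    unfolding power2_eq_square by linarith
  then show ?thesis by (cases "x = 0") auto
qed

text \<open>The range is closed because \<open>T\<close> is bounded below. A vector orthogonal to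
  the range satisfies the adjoint relation with value 0, so it lies in the kernel of
  \<open>T\<close>, which is trivial.\<close>

lemma surj_T: "T ` D = UNIV"
proof -
  have sub: "csubspace (T ` D)"
    unfolding csubspace_def using T_zero D_zero
    by (auto simp flip: T_add T_scaleC intro!: D_add D_scaleC imageI)
  have cl: "closed (T ` D)"
  proof (rule closed_sequential_limits[THEN iffD2], safe)
    fix g y assume g: "\<forall>n::nat. g n \<in> T ` D" "g \<longlonglongrightarrow> y"
    then have "\<forall>n. \<exists>x. x \<in> D \<and> g n = T x" by blast
    then obtain f where f: "\<And>n. f n \<in> D" "\<And>n. g n = T (f n)" by metis
    have "Cauchy g" using g(2) by (rule LIMSEQ_imp_Cauchy)
    moreover have "dist (f n) (f m) \<le> dist (g n) (g m)" for n m
      using norm_le_norm_T[OF D_diff[OF f(1) f(1)], of n m] by (simp add: dist_norm f T_diff)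
    ultimately have "Cauchy f" unfolding Cauchy_def by (meson le_less_trans)
    then obtain x where x: "f \<longlonglongrightarrow> x" using Cauchy_convergent convergent_def by blast
    have "g = (\<lambda>n. T (f n))" using f(2) by (rule ext)
    then have "x \<in> D \<and> T x = y" using closed_graph[OF f(1) x] g(2) by simp
    then show "y \<in> T ` D" by blast
  qed
  have "u \<in> T ` D" for u
  proof -
    obtain q where q: "q \<in> T ` D" "\<And>w. w \<in> T ` D \<Longrightarrow> cinner w (u - q) = 0"
      using projection_exists[OF sub cl] by metis
    have "u - q \<in> D \<and> T (u - q) = 0"
    proof (rule adjoint_imp)
      fix x assume "x \<in> D"
      then have "cinner (T x) (u - q) = 0" using q(2) by blast
      then show "cinner (u - q) (T x) = cinner 0 x" by (subst cinner_commute) simp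
    qed
    then have "u = q" using norm_le_norm_T[of "u - q"] by simp
    then show ?thesis using q by simp
  qed
  then show ?thesis by blast
qed

section \<open>The bounded symmetric inverse\<close>

definition G :: "'a \<Rightarrow> 'a" where "G = inv_into D T"

lemma G_in: "G y \<in> D" and T_G: "T (G y) = y"
  using surj_T unfolding G_def by (auto intro: inv_into_into f_inv_into_f)

lemma G_unique: "x \<in> D \<Longrightarrow> T x = y \<Longrightarrow> G y = x"
  using norm_le_norm_T[of "G y - x"] G_in T_G D_diff[OF G_in[of y], of x] T_diff[OF G_in[of y], of x] by simp

lemma G_add: "G (x + y) = G x + G y"
  by (rule G_unique) (auto simp: T_add T_G D_add G_in)

lemma G_scaleR: "G (r *\<^sub>R x) = r *\<^sub>R G x"
  by (rule G_unique) (auto simp: T_scaleR T_G D_scaleR G_in)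

lemma norm_G: "norm (G y) \<le> norm y"
  using norm_le_norm_T[OF G_in] by (simp add: T_G)

lemma bounded_linear_G: "bounded_linear G"
  by (rule bounded_linear_intro[where K=1]) (auto simp: G_add G_scaleR norm_G)

lemma cinner_G: "cinner (G x) y = cinner x (G y)"
  using symmetric[of "G y" "G x"] G_in by (simp add: T_G)

section \<open>Eigenspaces and completeness of the eigenvectors\<close>

abbreviation E where "E \<equiv> eigenspace D T"
abbreviation ev where "ev \<equiv> eigenvalues D T"

lemma csubspace_E: "csubspace (E l)"
  unfolding csubspace_def eigenspace_def
  by (auto simp: D_zero T_zero T_add D_add scaleR_add_right T_scaleC D_scaleC scaleC_scaleR_commute)

lemma closed_E: "closed (E l)"
proof (rule closed_sequential_limits[THEN iffD2], safe)
  fix f x assume f: "\<forall>n::nat. f n \<in> E l" "f \<longlonglongrightarrow> x"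
  have "x \<in> D \<and> T x = l *\<^sub>R x"
  proof (rule closed_graph[of f])
    have "T (f n) = l *\<^sub>R f n" for n using f by (simp add: eigenspace_def)
    then show "(\<lambda>n. T (f n)) \<longlonglongrightarrow> l *\<^sub>R x" using f(2) by (simp add: tendsto_scaleR)
  qed (use f in \<open>auto simp: eigenspace_def\<close>)
  then show "x \<in> E l" by (simp add: eigenspace_def)
qed

lemma ev_ex: "l \<in> ev \<Longrightarrow> \<exists>x\<in>E l. norm x = 1"
proof -
  assume "l \<in> ev"
  then obtain x where "x \<in> E l" "x \<noteq> 0"
    using csubspace_E[of l] by (auto simp: eigenvalues_def csubspace_def)
  then show ?thesis
    by (intro bexI[of _ "(1 / norm x) *\<^sub>R x"]) (auto intro: csubspace_scaleR[OF csubspace_E])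
qed

lemma ev_ge_1: "l \<in> ev \<Longrightarrow> 1 \<le> l"
proof -
  assume "l \<in> ev"
  then obtain x where x: "x \<in> D" "T x = l *\<^sub>R x" "norm x = 1"
    using ev_ex by (auto simp: eigenspace_def)
  then show "1 \<le> l" using lower_bound[of x] by (simp add: cinner_scaleR_right cinner_self)
qed

lemma E_orthogonal:
  assumes "x \<in> E l" "y \<in> E m" "l \<noteq> m"
  shows "cinner x y = 0"
proof -
  have "of_real l * cinner x y = of_real m * cinner x y"
    using assms symmetric[of y x] by (simp add: eigenspace_def cinner_scaleR_left cinner_scaleR_right)
  then show ?thesis using assms(3) by simp
qed

text \<open>Infinitely many eigenvalues below \<open>K\<close> would give an orthonormal sequence
  with bounded images under \<open>T\<close>; compactness would make a subsequence converge, yet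
  distinct members have squared distance 2.\<close>

lemma finite_ev_below: "finite {l \<in> ev. l \<le> K}"
proof (rule ccontr)
  assume "infinite {l \<in> ev. l \<le> K}"
  from infinite_countable_subset[OF this]
  obtain e :: "nat \<Rightarrow> real" where "inj e" "range e \<subseteq> {l \<in> ev. l \<le> K}" by blast
  then have e: "inj e" "\<And>n. e n \<in> ev" "\<And>n. e n \<le> K" by auto
  have "\<forall>n. \<exists>x. x \<in> E (e n) \<and> norm x = 1" using ev_ex e(2) by blast
  then obtain x where x: "\<And>n. x n \<in> E (e n)" "\<And>n. norm (x n) = 1" by metis
  have xD: "x n \<in> D" and Tx: "T (x n) = e n *\<^sub>R x n" for n
    using x(1)[of n] by (simp_all add: eigenspace_def)
  have TK: "norm (T (x n)) \<le> max 1 K" for n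
    unfolding Tx norm_scaleR x(2) using e(3)[of n] ev_ge_1[OF e(2)[of n]] by linarith
  have "\<exists>r. strict_mono r \<and> convergent (x \<circ> r)"
    by (rule compactness[of x "max 1 K"]) (simp_all add: xD TK x)
  then obtain r where r: "strict_mono r" "convergent (x \<circ> r)" by blast
  then have "Cauchy (x \<circ> r)" using convergent_Cauchy by blast
  then obtain k where k: "\<And>n m. n \<ge> k \<Longrightarrow> m \<ge> k \<Longrightarrow> dist ((x \<circ> r) n) ((x \<circ> r) m) < 1"
    unfolding Cauchy_def by (metis zero_less_one)
  have "norm (x (r k) - x (r (Suc k))) < 1" using k[of k "Suc k"] by (simp add: dist_norm)
  then have "(norm (x (r k) - x (r (Suc k))))\<^sup>2 < 1" by (simp add: power_less_one_iff)
  moreover have "r k \<noteq> r (Suc k)" using strict_monoD[OF r(1), of k "Suc k"] by simp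
  then have "e (r k) \<noteq> e (r (Suc k))" using e(1) by (auto dest: injD)
  then have "cinner (x (r k)) (x (r (Suc k))) = 0" by (rule E_orthogonal[OF x(1) x(1)])
  ultimately show False by (simp add: norm_diff_square x)
qed

text \<open>On the orthogonal complement \<open>M\<close> of all eigenvectors the compact operator \<open>G = T\<^sup>-\<^sup>1\<close> attains its
  norm \<open>m\<close> at some \<open>v\<close>, and then \<open>G v + m v\<close> is an eigenvector in \<open>M\<close>.\<close>
lemma eigenvectors_total:
  assumes u: "\<And>l w. l \<in> ev \<Longrightarrow> w \<in> E l \<Longrightarrow> cinner w u = 0"
  shows "u = 0"
proof (rule ccontr)
  assume "u \<noteq> 0"
  define M where "M = {v. \<forall>l\<in>ev. \<forall>w\<in>E l. cinner w v = 0}"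
  have uM: "u \<in> M" using u by (simp add: M_def)
  have M_add: "x + y \<in> M" if "x \<in> M" "y \<in> M" for x y using that by (simp add: M_def cinner_add_right)
  have M_scaleR: "c *\<^sub>R x \<in> M" if "x \<in> M" for x c using that by (simp add: M_def cinner_scaleR_right)
  have M_closed: "x \<in> M" if "f \<longlonglongrightarrow> x" "\<And>n::nat. f n \<in> M" for f x
  proof -
    have "cinner w x = 0" if "l \<in> ev" "w \<in> E l" for l w
    proof -
      have "(\<lambda>n. cinner w (f n)) \<longlonglongrightarrow> cinner w x" by (intro tendsto_cinner tendsto_const \<open>f \<longlonglongrightarrow> x\<close>)
      moreover have "cinner w (f n) = 0" for n using \<open>\<And>n. f n \<in> M\<close> that by (auto simp: M_def)
      ultimately show ?thesis by (simp add: LIMSEQ_const_iff)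
    qed
    then show ?thesis by (simp add: M_def)
  qed
  \<comment> \<open>An eigenvector of \<open>T\<close> is one of \<open>G\<close>, with reciprocal
    eigenvalue, and symmetry moves \<open>G\<close> onto it; so \<open>G\<close> preserves the
    orthogonal complement.\<close>
  have M_G: "G x \<in> M" if "x \<in> M" for x
  proof -
    have "cinner w (G x) = 0" if w: "l \<in> ev" "w \<in> E l" for l w
    proof -
      have "w \<in> D" "T w = l *\<^sub>R w" "l \<noteq> 0" using w ev_ge_1[of l] by (auto simp: eigenspace_def)
      then have "G w = (1 / l) *\<^sub>R w" by (intro G_unique) (auto simp: T_scaleR D_scaleR)
      then have "cinner w (G x) = of_real (1 / l) * cinner w x"
        by (simp only: cinner_G[symmetric] cinner_scaleR_left)
      then show ?thesis using \<open>x \<in> M\<close> w by (simp add: M_def)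
    qed
    then show ?thesis by (simp add: M_def)
  qed
  define B where "B = {v \<in> M. norm v \<le> 1}"
  define m where "m = (SUP v\<in>B. norm (G v))"
  have bdd: "bdd_above ((\<lambda>v. norm (G v)) ` B)"
  proof (rule bdd_aboveI2[of _ _ 1])
    show "norm (G v) \<le> 1" if "v \<in> B" for v using norm_G[of v] that by (simp add: B_def)
  qed
  have B0: "0 \<in> B" by (auto simp: B_def M_def)
  have le_m: "norm (G v) \<le> m * norm v" if "v \<in> M" for v
  proof (cases "v = 0")
    case False
    have "norm (G ((1 / norm v) *\<^sub>R v)) \<le> m"
      unfolding m_def by (rule cSUP_upper[OF _ bdd]) (use that False in \<open>auto simp: B_def M_scaleR\<close>)
    then show ?thesis using False by (simp add: G_scaleR divide_le_eq)
  qed (use bounded_linear.linear[OF bounded_linear_G] in \<open>simp add: linear_0\<close>)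
  have "G u \<noteq> 0" using T_G[of u] T_zero \<open>u \<noteq> 0\<close> by metis
  then have "0 < m * norm u" using le_m[OF uM] zero_less_norm_iff[of "G u"] by linarith
  then have m_pos: "m > 0" using norm_ge_zero[of u] by (simp add: zero_less_mult_iff)
  have "\<exists>v\<in>B. m - 1 / Suc n < norm (G v)" for n
  proof -
    have "m - 1 / Suc n < m" by simp
    then show ?thesis unfolding m_def using less_cSUP_iff[OF _ bdd] B0 by blast
  qed
  then obtain v where v: "\<And>n. v n \<in> B" "\<And>n. m - 1 / Suc n < norm (G (v n))" by metis
  have v': "v n \<in> M" "norm (v n) \<le> 1" for n using v(1)[of n] by (auto simp: B_def)
  have "\<exists>r. strict_mono r \<and> convergent ((\<lambda>n. G (v n)) \<circ> r)"
  proof (rule compactness[of _ 1])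
    show "norm (G (v n)) \<le> 1" for n using norm_G[of "v n"] v'(2)[of n] by linarith
  qed (simp_all add: T_G G_in v')
  then obtain r y where r: "strict_mono r" and y: "(\<lambda>n. G (v (r n))) \<longlonglongrightarrow> y"
    by (auto simp: convergent_def comp_def)
  have le_m': "norm (G (v n)) \<le> m" for n
    using le_m[OF v'(1)[of n]] mult_left_le[OF v'(2)[of n], of m] m_pos by linarith
  have lim_m: "(\<lambda>n. norm (G (v n))) \<longlonglongrightarrow> m"
  proof (rule tendsto_sandwich[of "\<lambda>n. m - 1 / Suc n" _ _ "\<lambda>_. m"])
    have "(\<lambda>n. m - 1 / Suc n) \<longlonglongrightarrow> m - 0" by (intro tendsto_intros LIMSEQ_Suc[OF lim_1_over_n])
    then show "(\<lambda>n. m - 1 / Suc n) \<longlonglongrightarrow> m" by simp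
    show "\<forall>\<^sub>F n in sequentially. m - 1 / Suc n \<le> norm (G (v n))"
      using v(2) less_imp_le by (intro always_eventually) blast
  qed (simp_all add: le_m')
  \<comment> \<open>Almost maximisers of the norm of \<open>G\<close> are almost eigenvectors of its
    square: by symmetry the cross term of the expanded square is \<open>m\<^sup>2\<close> times the
    squared norm of \<open>G (v n)\<close>.\<close>
  have key: "(norm (G (G (v n)) - m\<^sup>2 *\<^sub>R v n))\<^sup>2 \<le> m\<^sup>2 * (m\<^sup>2 - (norm (G (v n)))\<^sup>2)" for n
  proof -
    have "(norm (G (G (v n))))\<^sup>2 \<le> (m * norm (G (v n)))\<^sup>2"
      using le_m M_G v' by (intro power_mono) auto
    moreover have "(norm (v n))\<^sup>2 \<le> 1" using v' by (simp add: power_le_one)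
    then have "m^4 * (norm (v n))\<^sup>2 \<le> m^4" by (simp add: mult_left_le)
    moreover have "Re (cinner (G (G (v n))) (m\<^sup>2 *\<^sub>R v n)) = m\<^sup>2 * (norm (G (v n)))\<^sup>2"
      by (simp add: cinner_G[of "G (v n)"] cinner_scaleR_right cinner_self)
    moreover have "(norm (m\<^sup>2 *\<^sub>R v n))\<^sup>2 = m^4 * (norm (v n))\<^sup>2"
      by (simp add: power_mult_distrib)
    ultimately show ?thesis unfolding norm_diff_square by (simp add: algebra_simps power_mult_distrib)
  qed
  have "(\<lambda>n. m\<^sup>2 * (m\<^sup>2 - (norm (G (v n)))\<^sup>2)) \<longlonglongrightarrow> m\<^sup>2 * (m\<^sup>2 - m\<^sup>2)"
    by (intro tendsto_intros lim_m)
  then have "(\<lambda>n. m\<^sup>2 * (m\<^sup>2 - (norm (G (v n)))\<^sup>2)) \<longlonglongrightarrow> 0" by simp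
  then have "(\<lambda>n. (norm (G (G (v n)) - m\<^sup>2 *\<^sub>R v n))\<^sup>2) \<longlonglongrightarrow> 0"
    by (rule tendsto_sandwich[OF _ _ tendsto_const, rotated 2]) (use key in simp_all)
  then have "(\<lambda>n. sqrt ((norm (G (G (v n)) - m\<^sup>2 *\<^sub>R v n))\<^sup>2)) \<longlonglongrightarrow> sqrt 0" by (rule tendsto_real_sqrt)
  then have "(\<lambda>n. G (G (v n)) - m\<^sup>2 *\<^sub>R v n) \<longlonglongrightarrow> 0" by (simp add: tendsto_norm_zero_iff)
  \<comment> \<open>Compactness gives convergence of \<open>G (v (r n))\<close> only. Applying
    \<open>G\<close> once more and using that the difference vanishes recovers convergence of
    \<open>v (r n)\<close> itself, since \<open>m\<close> is positive.\<close>
  then have "(\<lambda>n. G (G (v (r n))) - m\<^sup>2 *\<^sub>R v (r n)) \<longlonglongrightarrow> 0"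
    using LIMSEQ_subseq_LIMSEQ[OF _ r, of "\<lambda>n. G (G (v n)) - m\<^sup>2 *\<^sub>R v n"] by (simp add: comp_def)
  from tendsto_diff[OF bounded_linear.tendsto[OF bounded_linear_G y] this]
  have "(\<lambda>n. m\<^sup>2 *\<^sub>R v (r n)) \<longlonglongrightarrow> G y" by simp
  from tendsto_scaleR[OF tendsto_const this, of "1 / m\<^sup>2"]
  have vlim: "(\<lambda>n. v (r n)) \<longlonglongrightarrow> (1 / m\<^sup>2) *\<^sub>R G y" using m_pos by simp
  define x where "x = (1 / m\<^sup>2) *\<^sub>R G y"
  have xM: "x \<in> M" unfolding x_def by (rule M_closed[OF vlim]) (rule v')
  have "(\<lambda>n. G (v (r n))) \<longlonglongrightarrow> G x" using bounded_linear.tendsto[OF bounded_linear_G vlim] by (simp add: x_def)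
  then have Gx: "G x = y" using y LIMSEQ_unique by blast
  then have GGx: "G (G x) = m\<^sup>2 *\<^sub>R x" using m_pos by (simp add: x_def)
  have "(\<lambda>n. norm (G (v (r n)))) \<longlonglongrightarrow> norm y" by (intro tendsto_intros y)
  moreover have "(\<lambda>n. norm (G (v (r n)))) \<longlonglongrightarrow> m"
    using LIMSEQ_subseq_LIMSEQ[OF lim_m r] by (simp add: comp_def)
  ultimately have "norm y = m" using LIMSEQ_unique by blast
  then have x0: "x \<noteq> 0" using Gx m_pos norm_G[of x] by auto
  \<comment> \<open>From the factorisation of \<open>G\<^sup>2 - m\<^sup>2\<close> as
    \<open>(G - m) (G + m)\<close>; positivity of \<open>G\<close> excludes that
    \<open>(G + m) x\<close> vanishes.\<close>
  define w where "w = G x + m *\<^sub>R x"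
  have wM: "w \<in> M" unfolding w_def by (intro M_add M_scaleR M_G xM)
  have Gw: "G w = m *\<^sub>R w" by (simp add: w_def G_add G_scaleR GGx scaleR_add_right power2_eq_square)
  have "0 \<le> Re (cinner (G x) x)"
    using lower_bound[OF G_in, of x] order_trans[OF zero_le_power2] unfolding T_G by blast
  moreover have "0 < m * (norm x)\<^sup>2" using m_pos x0 by simp
  ultimately have "Re (cinner w x) > 0"
    by (simp add: w_def cinner_add_left cinner_scaleR_left cinner_self)
  then have "w \<noteq> 0" by auto
  have w_eq: "w = (1 / m) *\<^sub>R G w" using Gw m_pos by simp
  then have "w \<in> D" using D_scaleR[OF G_in] by metis
  moreover have "T w = (1 / m) *\<^sub>R w" using w_eq T_scaleR[OF G_in] T_G by metis
  ultimately have "w \<in> E (1 / m)" by (simp add: eigenspace_def)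
  then have "1 / m \<in> ev" using \<open>w \<noteq> 0\<close> by (auto simp: eigenvalues_def)
  then have "cinner w w = 0" using wM \<open>w \<in> E (1 / m)\<close> by (auto simp: M_def)
  then show False using \<open>w \<noteq> 0\<close> by simp
qed

sublocale spectral_resolution ev "\<lambda>l. orth_proj (E l)"
proof
  fix l m :: real and u v :: 'a
  note P = csubspace_E closed_E
  show "finite {l \<in> ev. l \<le> m}" by (rule finite_ev_below)
  show "clinear_on UNIV (orth_proj (E l))" by (rule clinear_on_orth_proj[OF P])
  show "norm (orth_proj (E l) u) \<le> norm u" by (rule norm_orth_proj[OF P])
  show "cinner (orth_proj (E l) u) v = cinner u (orth_proj (E l) v)" by (rule cinner_orth_proj[OF P])
  show "orth_proj (E l) (orth_proj (E l) u) = orth_proj (E l) u"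
    by (rule orth_proj_id[OF csubspace_E orth_proj_in[OF P]])
  show "orth_proj (E l) (orth_proj (E m) u) = 0" if "l \<noteq> m"
    by (rule orth_proj_eq_zero[OF csubspace_E]) (rule E_orthogonal[OF _ orth_proj_in[OF P] that])
  show "u = 0" if "\<And>l. l \<in> ev \<Longrightarrow> orth_proj (E l) u = 0"
    using orth_proj_orthogonal[OF P, of _ _ u] that by (intro eigenvectors_total) force
qed (auto intro: ev_ge_1)

end

text \<open>The added identity turns positivity into the lower bound 1. Compactness at one resolvent
  point suffices, since bounds on \<open>f n\<close> and its image under Lambda bound the preimages
  under that resolvent.\<close>

lemma strictly_positive_compact_Lambda:
  fixes D :: "'a::chilbert_space set"
  assumes sa: "self_adjoint D H0" and pos: "positive_op D H0" and comp: "has_compact_resolvent D H0"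
  shows "strictly_positive_compact D (\<lambda>x. x + H0 x)"
proof
  have lin: "clinear_on D H0" and adj: "adjoint_graph D H0 = op_graph D H0"
    using sa by (auto simp: self_adjoint_def)
  show "clinear_on D (\<lambda>x. x + H0 x)"
    using lin by (auto simp: clinear_on_def scaleC_add_right)
  show "y \<in> D \<and> y + H0 y = z" if "\<And>x. x \<in> D \<Longrightarrow> cinner y (x + H0 x) = cinner z x" for y z
  proof -
    have "cinner y (H0 x) = cinner (z - y) x" if "x \<in> D" for x
      using \<open>\<And>x. x \<in> D \<Longrightarrow> cinner y (x + H0 x) = cinner z x\<close>[OF that]
      by (simp add: cinner_add_right cinner_diff_left algebra_simps)
    then have "(y, z - y) \<in> adjoint_graph D H0" by (simp add: adjoint_graph_def)
    then have "y \<in> D" "z - y = H0 y" unfolding adj by (auto simp: op_graph_def)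
    then show ?thesis by (simp flip: \<open>z - y = H0 y\<close>)
  qed
  have symm: "cinner (H0 y) x = cinner y (H0 x)" if "x \<in> D" "y \<in> D" for x y
  proof -
    have "(y, H0 y) \<in> adjoint_graph D H0" unfolding adj using that by (simp add: op_graph_def)
    then show ?thesis using that by (simp add: adjoint_graph_def)
  qed
  then show "cinner (y + H0 y) x = cinner y (x + H0 x)" if "x \<in> D" "y \<in> D" for x y
    using that by (simp add: cinner_add_left cinner_add_right)
  show "(norm x)\<^sup>2 \<le> Re (cinner x (x + H0 x))" if "x \<in> D" for x
    using pos that by (simp add: positive_op_def cinner_add_right cinner_self)
  fix f :: "nat \<Rightarrow> 'a" and B
  assume f: "\<And>n. f n \<in> D" "\<And>n. norm (f n) \<le> B" "\<And>n. norm (f n + H0 (f n)) \<le> B"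
  obtain z where z: "bij_betw (\<lambda>x. H0 x - z *\<^sub>C x) D UNIV" "compact_op (resolvent D H0 z)"
    using comp by (auto simp: has_compact_resolvent_def resolvent_set_def)
  \<comment> \<open>Chosen so that the compact resolvent maps \<open>g n\<close> back to
    \<open>f n\<close>.\<close>
  define g where "g n = H0 (f n) - z *\<^sub>C f n" for n
  have "norm (g n) \<le> B + B + cmod z * B" for n
  proof -
    have "norm (g n) \<le> norm (H0 (f n)) + norm (z *\<^sub>C f n)" unfolding g_def by (rule norm_triangle_ineq4)
    moreover have "norm (H0 (f n)) \<le> norm (f n + H0 (f n)) + norm (f n)"
      using norm_triangle_ineq4[of "f n + H0 (f n)" "f n"] by simp
    moreover have "norm (z *\<^sub>C f n) \<le> cmod z * B" using f(2)[of n] by (simp add: mult_left_mono)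
    ultimately show ?thesis using f(2)[of n] f(3)[of n] by linarith
  qed
  then have "bounded (range g)" by (auto intro: boundedI)
  then have "compact (closure (resolvent D H0 z ` range g))"
    using z(2) by (simp add: compact_op_def)
  moreover have "resolvent D H0 z (g n) = f n" for n
    unfolding resolvent_def g_def using z(1) f(1)
    by (intro inv_into_f_f[of "\<lambda>x. H0 x - z *\<^sub>C x" D]) (auto simp: bij_betw_def)
  then have "f n \<in> closure (resolvent D H0 z ` range g)" for n
    by (metis closure_subset image_eqI rangeI subsetD)
  ultimately obtain l r where "strict_mono (r::nat\<Rightarrow>nat)" "(f \<circ> r) \<longlonglongrightarrow> l"
    unfolding compact_def by metis
  then show "\<exists>r. strict_mono r \<and> convergent (f \<circ> r)" by (auto simp: convergent_def)
qed

section \<open>Linear evolution equations\<close>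

lemma has_vector_derivative_interior:
  assumes "(f has_vector_derivative f') (at x within {a..b})" "a < x" "x < (b::real)"
  shows "(f has_vector_derivative f') (at x)"
  using assms at_within_Icc_at[of a x b] by simp

text \<open>Iterating this bound produces the factorials of an exponential series. Both orders of
  \<open>s\<close> and \<open>t\<close> are treated because the initial time may lie anywhere in the
  interval.\<close>

lemma norm_bound_power_derivative:
  fixes f :: "real \<Rightarrow> 'a::real_normed_vector"
  assumes f: "\<And>t. t \<in> {a..b} \<Longrightarrow> (f has_vector_derivative f' t) (at t within {a..b})"
    and bnd: "\<And>t. t \<in> {a..b} \<Longrightarrow> norm (f' t) \<le> C * \<bar>t - s\<bar> ^ n"
    and st: "s \<in> {a..b}" "t \<in> {a..b}"
  shows "norm (f t - f s) \<le> C * \<bar>t - s\<bar> ^ Suc n / Suc n"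
proof -
  have cont: "continuous_on {a..b} f"
    using f by (meson continuous_on_eq_continuous_within has_vector_derivative_continuous)
  consider "s < t" | "t < s" | "s = t" by linarith
  then show ?thesis
  proof cases
    case 1
    have "norm (f t - f s) \<le> C * (t - s) ^ Suc n / Suc n - C * (s - s) ^ Suc n / Suc n"
    proof (rule differentiable_bound_general[OF 1])
      fix x assume x: "s < x" "x < t"
      show "(f has_vector_derivative f' x) (at x)"
        by (rule has_vector_derivative_interior[OF f]) (use st x in auto)
      show "((\<lambda>x. C * (x - s) ^ Suc n / Suc n) has_vector_derivative C * (x - s) ^ n) (at x)"
        unfolding has_real_derivative_iff_has_vector_derivative[symmetric]
        by (auto intro!: derivative_eq_intros simp del: of_nat_Suc power_Suc)
      show "norm (f' x) \<le> C * (x - s) ^ n" using bnd[of x] x st by simp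
    qed (use st in \<open>auto intro!: continuous_intros intro: continuous_on_subset[OF cont]\<close>)
    then show ?thesis using 1 by simp
  next
    case 2
    have "norm (f s - f t) \<le> - (C * (s - s) ^ Suc n / Suc n) - - (C * (s - t) ^ Suc n / Suc n)"
    proof (rule differentiable_bound_general[OF 2])
      fix x assume x: "t < x" "x < s"
      show "(f has_vector_derivative f' x) (at x)"
        by (rule has_vector_derivative_interior[OF f]) (use st x in auto)
      show "((\<lambda>x. - (C * (s - x) ^ Suc n / Suc n)) has_vector_derivative C * (s - x) ^ n) (at x)"
        unfolding has_real_derivative_iff_has_vector_derivative[symmetric]
        by (auto intro!: derivative_eq_intros simp del: of_nat_Suc power_Suc)
      show "norm (f' x) \<le> C * (s - x) ^ n" using bnd[of x] x st by simp
    qed (use st in \<open>auto intro!: continuous_intros intro: continuous_on_subset[OF cont]\<close>)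
    then show ?thesis using 2 by (simp add: norm_minus_commute)
  qed simp
qed

lemma norm_bound_derivative:
  fixes f :: "real \<Rightarrow> 'a::real_normed_vector"
  assumes "\<And>t. t \<in> {a..b} \<Longrightarrow> (f has_vector_derivative f' t) (at t within {a..b})"
    and "\<And>t. t \<in> {a..b} \<Longrightarrow> norm (f' t) \<le> C"
    and "s \<in> {a..b}" "t \<in> {a..b}"
  shows "norm (f t - f s) \<le> C * \<bar>t - s\<bar>"
  using norm_bound_power_derivative[of a b f f' C s 0 t] assms by simp

lemma constant_of_zero_derivative:
  fixes f :: "real \<Rightarrow> 'a::real_normed_vector"
  assumes "\<And>t. t \<in> {a..b} \<Longrightarrow> (f has_vector_derivative 0) (at t within {a..b})"
    and "s \<in> {a..b}" "t \<in> {a..b}"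
  shows "f t = f s"
  using norm_bound_derivative[OF assms(1) _ assms(2,3), of 0] by simp

text \<open>A uniform bound lets strong continuity of the operators suffice: the moving vector is
  split into a fixed one and a small error.\<close>

lemma continuous_on_operator_family:
  fixes A :: "real \<Rightarrow> 'a::real_normed_vector \<Rightarrow> 'b::real_normed_vector"
  assumes bl: "\<And>t. t \<in> X \<Longrightarrow> bounded_linear (A t)"
    and bnd: "\<And>t v. t \<in> X \<Longrightarrow> norm (A t v) \<le> L * norm v"
    and strong: "\<And>v. continuous_on X (\<lambda>t. A t v)"
    and y: "continuous_on X y"
  shows "continuous_on X (\<lambda>t. A t (y t))"
  unfolding continuous_on_def
proof
  fix t assume t: "t \<in> X"
  have "((\<lambda>s. A s (y s - y t)) \<longlongrightarrow> 0) (at t within X)"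
  proof (rule Lim_null_comparison)
    show "\<forall>\<^sub>F s in at t within X. norm (A s (y s - y t)) \<le> L * norm (y s - y t)"
      using bnd by (auto simp: eventually_at_filter)
    have "((\<lambda>s. L * norm (y s - y t)) \<longlongrightarrow> L * norm (y t - y t)) (at t within X)"
      using y t by (intro tendsto_intros) (auto simp: continuous_on_def)
    then show "((\<lambda>s. L * norm (y s - y t)) \<longlongrightarrow> 0) (at t within X)" by simp
  qed
  moreover have "((\<lambda>s. A s (y t)) \<longlongrightarrow> A t (y t)) (at t within X)"
    using strong[of "y t"] t by (simp add: continuous_on_def)
  ultimately have "((\<lambda>s. A s (y s - y t) + A s (y t)) \<longlongrightarrow> 0 + A t (y t)) (at t within X)"
    by (rule tendsto_add)
  moreover have "\<forall>\<^sub>F s in at t within X. A s (y s - y t) + A s (y t) = A s (y s)"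
    unfolding eventually_at_filter
    by (auto simp: linear_diff[OF bounded_linear.linear[OF bl]])
  ultimately show "((\<lambda>s. A s (y s)) \<longlongrightarrow> A t (y t)) (at t within X)"
    by (simp add: Lim_transform_eventually)
qed

text \<open>The solution is the Dyson series.\<close>
theorem linear_ode_solution_exists:
  fixes A :: "real \<Rightarrow> 'a::banach \<Rightarrow> 'a"
  assumes s: "s \<in> {a..b}"
    and bl: "\<And>t. t \<in> {a..b} \<Longrightarrow> bounded_linear (A t)"
    and bnd: "\<And>t v. t \<in> {a..b} \<Longrightarrow> norm (A t v) \<le> L * norm v"
    and strong: "\<And>v. continuous_on {a..b} (\<lambda>t. A t v)"
  shows "\<exists>x. x s = v \<and> (\<forall>t\<in>{a..b}. (x has_vector_derivative A t (x t)) (at t within {a..b}))"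
proof -
  \<comment> \<open>The primitive of \<open>f\<close> vanishing at \<open>s\<close>; as a difference
    of two integrals from \<open>a\<close> it is correct on both sides of \<open>s\<close>.\<close>
  define J where "J f t = integral {a..t} f - integral {a..s} f" for f :: "real \<Rightarrow> 'a" and t
  define y where "y = rec_nat (\<lambda>_. v) (\<lambda>_ z. J (\<lambda>\<tau>. A \<tau> (z \<tau>)))"
  have y0: "y 0 t = v" and ySuc: "y (Suc n) = J (\<lambda>\<tau>. A \<tau> (y n \<tau>))" for n t by (simp_all add: y_def)
  have J: "(J f has_vector_derivative f t) (at t within {a..b})" if "continuous_on {a..b} f" "t \<in> {a..b}" for f t
    unfolding J_def[abs_def] using integral_has_vector_derivative[OF that]
    by (auto intro: derivative_eq_intros)
  have ycont: "continuous_on {a..b} (y n)" for n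
  proof (induction n)
    case (Suc n)
    have "continuous_on {a..b} (\<lambda>\<tau>. A \<tau> (y n \<tau>))"
      by (rule continuous_on_operator_family[OF bl bnd strong Suc])
    from J[OF this] show ?case
      unfolding ySuc continuous_on_eq_continuous_within by (blast intro: has_vector_derivative_continuous)
  qed (simp add: y_def)
  have Ay: "continuous_on {a..b} (\<lambda>\<tau>. A \<tau> (y n \<tau>))" for n
    by (rule continuous_on_operator_family[OF bl bnd strong ycont])
  have dy: "(y (Suc n) has_vector_derivative A t (y n t)) (at t within {a..b})" if "t \<in> {a..b}" for n t
    unfolding ySuc using J[OF Ay that] .
  \<comment> \<open>On the zero space a negative \<open>L\<close> satisfies the hypotheses, while
    the powers below need a nonnegative constant.\<close>
  define L' where "L' = max 0 L"
  have bnd': "norm (A t v) \<le> L' * norm v" if "t \<in> {a..b}" for t v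
    using bnd[OF that, of v] mult_right_mono[of L L' "norm v"] by (simp add: L'_def)
  have ybound: "norm (y n t) \<le> norm v * L' ^ n / fact n * \<bar>t - s\<bar> ^ n" if "t \<in> {a..b}" for n t
    using that
  proof (induction n arbitrary: t)
    case (Suc n)
    have "norm (y (Suc n) t - y (Suc n) s) \<le> (norm v * L' ^ Suc n / fact n) * \<bar>t - s\<bar> ^ Suc n / Suc n"
    proof (rule norm_bound_power_derivative[OF dy _ s Suc.prems])
      fix \<tau> assume \<tau>: "\<tau> \<in> {a..b}"
      have "norm (A \<tau> (y n \<tau>)) \<le> L' * (norm v * L' ^ n / fact n * \<bar>\<tau> - s\<bar> ^ n)"
        using bnd'[OF \<tau>] Suc.IH[OF \<tau>] by (rule order_trans[OF _ mult_left_mono]) (simp add: L'_def)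
      then show "norm (A \<tau> (y n \<tau>)) \<le> (norm v * L' ^ Suc n / fact n) * \<bar>\<tau> - s\<bar> ^ n"
        by (simp add: mult_ac)
    qed
    moreover have "y (Suc n) s = 0" by (simp add: ySuc J_def)
    ultimately show ?case by (simp add: mult_ac)
  qed (simp add: y0)
  define X where "X t = (\<Sum>n. y n t)" for t
  have unif: "uniform_limit {a..b} (\<lambda>n t. \<Sum>i<n. y i t) X sequentially"
    unfolding X_def
  proof (rule Weierstrass_m_test)
    fix n t assume t: "t \<in> {a..b}"
    have "norm (y n t) \<le> norm v * L' ^ n / fact n * \<bar>t - s\<bar> ^ n" by (rule ybound[OF t])
    also have "\<dots> \<le> norm v * L' ^ n / fact n * (b - a) ^ n"
      using t s by (intro mult_left_mono power_mono) (auto simp: L'_def)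
    finally show "norm (y n t) \<le> norm v * (inverse (fact n) * (L' * (b - a)) ^ n)"
      by (simp add: power_mult_distrib divide_inverse mult_ac)
  next
    show "summable (\<lambda>n. norm v * (inverse (fact n) * (L' * (b - a)) ^ n))"
      by (intro summable_mult summable_exp)
  qed
  have lim: "(\<lambda>n. \<Sum>i<n. y i t) \<longlonglongrightarrow> X t" if "t \<in> {a..b}" for t
    using tendsto_uniform_limitI[OF unif that] .
  \<comment> \<open>The index is shifted by one: the derivative of the partial sum with
    \<open>Suc n\<close> terms is the generator applied to the one with \<open>n\<close>
    terms.\<close>
  have "\<exists>g. \<forall>t\<in>{a..b}. (\<lambda>n. \<Sum>i<Suc n. y i t) \<longlonglongrightarrow> g t \<and>
      (g has_derivative (\<lambda>h. h *\<^sub>R A t (X t))) (at t within {a..b})"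
  proof (rule has_derivative_sequence[where f="\<lambda>n t. \<Sum>i<Suc n. y i t"
        and f'="\<lambda>n t h. h *\<^sub>R A t (\<Sum>i<n. y i t)", OF _ _ _ s LIMSEQ_Suc[OF lim[OF s]]])
    fix n t assume t: "t \<in> {a..b}"
    have "((\<lambda>t. v + (\<Sum>i<n. y (Suc i) t)) has_vector_derivative 0 + (\<Sum>i<n. A t (y i t))) (at t within {a..b})"
      by (intro has_vector_derivative_add has_vector_derivative_const has_vector_derivative_sum dy t)
    moreover have "(\<lambda>t. v + (\<Sum>i<n. y (Suc i) t)) = (\<lambda>t. \<Sum>i<Suc n. y i t)"
      by (rule ext) (simp only: sum.lessThan_Suc_shift y0)
    moreover have "(\<Sum>i<n. A t (y i t)) = A t (\<Sum>i<n. y i t)"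
      by (simp add: linear_sum[OF bounded_linear.linear[OF bl[OF t]]])
    ultimately have "((\<lambda>t. \<Sum>i<Suc n. y i t) has_vector_derivative A t (\<Sum>i<n. y i t)) (at t within {a..b})"
      by (simp only: add_0_left)
    then show "((\<lambda>t. \<Sum>i<Suc n. y i t) has_derivative (\<lambda>h. h *\<^sub>R A t (\<Sum>i<n. y i t))) (at t within {a..b})"
      by (simp only: has_vector_derivative_def)
  next
    fix e :: real assume e: "e > 0"
    have "L' + 1 > 0" by (simp add: L'_def add_nonneg_pos)
    then have "\<forall>\<^sub>F n in sequentially. \<forall>t\<in>{a..b}. dist (\<Sum>i<n. y i t) (X t) < e / (L' + 1)"
      using unif e unfolding uniform_limit_iff by (meson divide_pos_pos)
    then show "\<forall>\<^sub>F n in sequentially. \<forall>t\<in>{a..b}. \<forall>h. norm (h *\<^sub>R A t (\<Sum>i<n. y i t) - h *\<^sub>R A t (X t)) \<le> e * norm h"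
    proof (rule eventually_mono, intro ballI allI)
      fix n t h assume n: "\<forall>t\<in>{a..b}. dist (\<Sum>i<n. y i t) (X t) < e / (L' + 1)" and t: "t \<in> {a..b}"
      have "norm (A t (\<Sum>i<n. y i t) - A t (X t)) = norm (A t ((\<Sum>i<n. y i t) - X t))"
        by (simp add: linear_diff[OF bounded_linear.linear[OF bl[OF t]]])
      also have "\<dots> \<le> L' * norm ((\<Sum>i<n. y i t) - X t)" by (rule bnd'[OF t])
      also have "\<dots> \<le> (L' + 1) * (e / (L' + 1))"
        using n t by (intro mult_mono) (auto simp: dist_norm L'_def intro: less_imp_le)
      also have "\<dots> = e" using \<open>L' + 1 > 0\<close> by simp
      finally have "norm (A t (\<Sum>i<n. y i t) - A t (X t)) \<le> e" .
      then show "norm (h *\<^sub>R A t (\<Sum>i<n. y i t) - h *\<^sub>R A t (X t)) \<le> e * norm h"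
        by (simp add: mult_mono mult.commute[of e] mult_left_mono flip: scaleR_diff_right)
    qed
  qed simp
  then obtain g where g: "\<And>t. t \<in> {a..b} \<Longrightarrow> (\<lambda>n. \<Sum>i<Suc n. y i t) \<longlonglongrightarrow> g t"
      "\<And>t. t \<in> {a..b} \<Longrightarrow> (g has_vector_derivative A t (X t)) (at t within {a..b})"
    unfolding has_vector_derivative_def by blast
  have gX: "g t = X t" if "t \<in> {a..b}" for t
    using LIMSEQ_unique[OF g(1)[OF that] LIMSEQ_Suc[OF lim[OF that]]] .
  have "y (Suc n) s = 0" for n by (simp add: ySuc J_def)
  then have "(\<Sum>i<Suc n. y i s) = v" for n by (simp only: sum.lessThan_Suc_shift y0) simp
  then have "g s = v" using g(1)[OF s] LIMSEQ_unique by (metis (no_types, lifting) LIMSEQ_const_iff ext)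
  then show ?thesis using g(2) gX by auto
qed

section \<open>Truncated evolutions and the energy estimate\<close>

text \<open>The derivative of \<open>ln (f t)\<close> exists everywhere and is bounded by
  \<open>c\<close> off a null set, so its increments are bounded by the integral of
  \<open>c\<close>. The bound on the increment is symmetric, hence valid for either order of
  \<open>s\<close> and \<open>t\<close>.\<close>

lemma Gronwall_log_AE:
  fixes f f' c :: "real \<Rightarrow> real"
  assumes f: "\<And>t. t \<in> {a..b} \<Longrightarrow> (f has_vector_derivative f' t) (at t within {a..b})"
    and pos: "\<And>t. t \<in> {a..b} \<Longrightarrow> f t > 0"
    and c: "\<And>t. t \<in> {a..b} \<Longrightarrow> c t \<ge> 0" "c integrable_on {a..b}"
    and N: "negligible N" "\<And>t. t \<in> {a..b} - N \<Longrightarrow> \<bar>f' t\<bar> \<le> c t * f t"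
    and st: "s \<in> {a..b}" "t \<in> {a..b}"
  shows "f t \<le> exp (integral {a..b} c) * f s"
proof -
  have *: "\<bar>ln (f t) - ln (f s)\<bar> \<le> integral {a..b} c" if st: "s \<in> {a..b}" "t \<in> {a..b}" "s \<le> t" for s t
  proof -
    \<comment> \<open>Setting the integrand to 0 on the null set keeps its integral and makes the
      bound by \<open>c\<close> hold at every point.\<close>
    define g where "g \<tau> = (if \<tau> \<in> N then 0 else f' \<tau> / f \<tau>)" for \<tau>
    have sub: "{s..t} \<subseteq> {a..b}" using st by auto
    have "((\<lambda>\<tau>. f' \<tau> / f \<tau>) has_integral ln (f t) - ln (f s)) {s..t}"
    proof (rule fundamental_theorem_of_calculus[OF st(3)])
      fix \<tau> assume \<tau>: "\<tau> \<in> {s..t}"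
      then have "(f has_field_derivative f' \<tau>) (at \<tau> within {s..t})"
        using has_vector_derivative_within_subset[OF f sub, of \<tau>] sub
        by (auto simp: has_real_derivative_iff_has_vector_derivative)
      then have "((\<lambda>\<tau>. ln (f \<tau>)) has_field_derivative 1 / f \<tau> * f' \<tau>) (at \<tau> within {s..t})"
        using pos[of \<tau>] \<tau> sub by (intro DERIV_ln_divide[THEN DERIV_chain2]) auto
      then show "((\<lambda>\<tau>. ln (f \<tau>)) has_vector_derivative f' \<tau> / f \<tau>) (at \<tau> within {s..t})"
        by (simp add: has_real_derivative_iff_has_vector_derivative)
    qed
    then have g: "(g has_integral ln (f t) - ln (f s)) {s..t}"
      by (rule has_integral_spike[OF N(1), rotated]) (simp add: g_def)
    have ci: "c integrable_on {s..t}" using integrable_on_subinterval[OF c(2) sub] .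
    have "norm (integral {s..t} g) \<le> integral {s..t} c"
    proof (rule Henstock_Kurzweil_Integration.integral_norm_bound_integral)
      fix \<tau> assume \<tau>: "\<tau> \<in> {s..t}"
      then have "\<tau> \<in> {a..b}" using sub by auto
      then show "norm (g \<tau>) \<le> c \<tau>"
        using N(2)[of \<tau>] pos[of \<tau>] c(1)[of \<tau>] by (auto simp: g_def divide_le_eq)
    qed (use g ci in auto)
    also have "\<dots> \<le> integral {a..b} c" by (rule integral_subset_le[OF sub ci c(2)]) (use c(1) in auto)
    finally show ?thesis using integral_unique[OF g] by simp
  qed
  have "\<bar>ln (f t) - ln (f s)\<bar> \<le> integral {a..b} c"
    using *[of s t] *[of t s] st abs_minus_commute by (cases "s \<le> t") auto
  then have "ln (f t) \<le> integral {a..b} c + ln (f s)" by linarith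
  then have "exp (ln (f t)) \<le> exp (integral {a..b} c + ln (f s))" by simp
  then show ?thesis using pos st by (simp add: exp_add)
qed

text \<open>Norm continuity enters through its consequences: bounds uniform in time at every level,
  and strong continuity. Membership in \<open>dom r\<close> for all real \<open>r\<close> describes
  the smooth vectors.\<close>

locale truncated_evolution = spectral_resolution S p
  for S :: "real set" and p :: "real \<Rightarrow> 'a::chilbert_space \<Rightarrow> 'a" +
  fixes a b \<mu> :: real and H :: "real \<Rightarrow> 'a \<Rightarrow> 'a"
  assumes ab: "a \<le> b" and mu: "0 \<le> \<mu>"
    and dense: "\<exists>Q::'a set. countable Q \<and> closure Q = UNIV"
    and H_add: "\<And>t u v. t \<in> {a..b} \<Longrightarrow> u \<in> dom \<mu> \<Longrightarrow> v \<in> dom \<mu> \<Longrightarrow> H t (u + v) = H t u + H t v"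
    and H_scaleC: "\<And>t u z. t \<in> {a..b} \<Longrightarrow> u \<in> dom \<mu> \<Longrightarrow> H t (z *\<^sub>C u) = z *\<^sub>C H t u"
    and H_bound: "\<And>r. 0 \<le> r \<Longrightarrow> \<exists>C\<ge>0. \<forall>t\<in>{a..b}. \<forall>u\<in>dom (r + \<mu>).
          H t u \<in> dom r \<and> norm (pw r (H t u)) \<le> C * norm (pw (r + \<mu>) u)"
    and H_cont: "\<And>u. u \<in> dom \<mu> \<Longrightarrow> continuous_on {a..b} (\<lambda>t. H t u)"
    and H_sym: "\<And>t v w. t \<in> {a..b} \<Longrightarrow> (\<And>r. v \<in> dom r) \<Longrightarrow> (\<And>r. w \<in> dom r)
          \<Longrightarrow> cinner (H t v) w = cinner v (H t w)"
begin

abbreviation J where "J \<equiv> {a..b}"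

text \<open>The inner cutoff makes this a bounded operator on the whole space, so the linear theory
  applies without passing to a subspace.\<close>

definition gen :: "real \<Rightarrow> real \<Rightarrow> 'a \<Rightarrow> 'a" where
  "gen K t v = - (\<i> *\<^sub>C tp K (H t (tp K v)))"

definition solves :: "real \<Rightarrow> (real \<Rightarrow> 'a) \<Rightarrow> bool" where
  "solves K x \<longleftrightarrow> (\<forall>t\<in>J. tp K (x t) = x t \<and> (x has_vector_derivative gen K t (x t)) (at t within J))"

text \<open>Starting from \<open>tp K v\<close> makes the truncated flow defined for every
  \<open>v\<close>; it is the propagator composed with the spectral projection.\<close>

definition sol :: "real \<Rightarrow> real \<Rightarrow> 'a \<Rightarrow> real \<Rightarrow> 'a" where
  "sol K s v = (SOME x. solves K x \<and> x s = tp K v)"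

definition commutator_bound :: "real \<Rightarrow> (real \<Rightarrow> real) \<Rightarrow> bool" where
  "commutator_bound r c \<longleftrightarrow> (\<forall>t\<in>J. 0 \<le> c t) \<and> set_integrable lebesgue J c \<and>
    (\<forall>v. (\<forall>q. v \<in> dom q) \<longrightarrow> (AE t in lebesgue. t \<in> J \<longrightarrow>
      cmod (\<i> * (cinner (H t v) (pw (2 * r) v) - cinner (pw (2 * r) v) (H t v))) \<le> c t * (norm (pw r v))\<^sup>2))"

section \<open>Bounded truncated generators\<close>

lemma H_diff: "t \<in> J \<Longrightarrow> u \<in> dom \<mu> \<Longrightarrow> v \<in> dom \<mu> \<Longrightarrow> H t (u - v) = H t u - H t v"
  using H_add[of t "u - v" v] dom_diff[of u \<mu> v] by simp

lemma norm_H_tp_bound: "\<exists>L\<ge>0. \<forall>t\<in>J. \<forall>v. norm (H t (tp K v)) \<le> L * norm v"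
proof -
  obtain C where C: "C \<ge> 0" "\<And>t u. t \<in> J \<Longrightarrow> u \<in> dom \<mu> \<Longrightarrow> norm (H t u) \<le> C * norm (pw \<mu> u)"
    using H_bound[of 0] by (auto simp: pw_0)
  have "norm (H t (tp K v)) \<le> (C * K powr \<mu>) * norm v" if "t \<in> J" for t v
  proof -
    have "norm (H t (tp K v)) \<le> C * norm (pw \<mu> (tp K v))" by (rule C(2)[OF that tp_in_dom])
    also have "\<dots> \<le> C * (K powr \<mu> * norm v)" by (intro mult_left_mono norm_pw_tp_le_powr mu C)
    finally show ?thesis by (simp add: mult.assoc)
  qed
  then show ?thesis using C(1) by (intro exI[of _ "C * K powr \<mu>"]) auto
qed

lemma bounded_linear_H_tp: "t \<in> J \<Longrightarrow> bounded_linear (\<lambda>v. H t (tp K v))"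
proof -
  assume t: "t \<in> J"
  obtain L where "\<And>v. norm (H t (tp K v)) \<le> L * norm v" using norm_H_tp_bound t by blast
  then show ?thesis
    by (intro bounded_linear_intro[where K=L])
      (simp_all add: tp_add tp_scaleC H_add[OF t tp_in_dom tp_in_dom] H_scaleC[OF t tp_in_dom] mult.commute
        flip: scaleC_of_real)
qed

lemma bounded_linear_gen: "t \<in> J \<Longrightarrow> bounded_linear (gen K t)"
  unfolding gen_def[abs_def]
  by (intro bounded_linear_minus bounded_linear_compose[OF bounded_linear_scaleC]
      bounded_linear_compose[OF bounded_linear_tp] bounded_linear_H_tp)

lemma norm_gen_bound: "\<exists>L\<ge>0. \<forall>t\<in>J. \<forall>v. norm (gen K t v) \<le> L * norm v"
  using norm_H_tp_bound[of K] unfolding gen_def by (auto intro: order_trans[OF norm_tp])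

lemma continuous_on_gen: "continuous_on J (\<lambda>t. gen K t v)"
  unfolding gen_def
  by (intro continuous_on_minus bounded_linear.continuous_on[OF bounded_linear_scaleC]
      bounded_linear.continuous_on[OF bounded_linear_tp] H_cont tp_in_dom)

lemma tp_gen: "tp K (gen K t v) = gen K t v"
proof -
  have "tp K (- w) = - tp K w" for w using tp_scaleR[of K "-1" w] by simp
  then show ?thesis by (simp add: gen_def tp_scaleC)
qed

lemma gen_diff: "t \<in> J \<Longrightarrow> gen K t (u - v) = gen K t u - gen K t v"
  and gen_add: "t \<in> J \<Longrightarrow> gen K t (u + v) = gen K t u + gen K t v"
  using bounded_linear.linear[OF bounded_linear_gen] by (auto simp: linear_diff linear_add)

lemma gen_scaleC: "t \<in> J \<Longrightarrow> gen K t (z *\<^sub>C v) = z *\<^sub>C gen K t v"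
  by (simp add: gen_def tp_scaleC H_scaleC tp_in_dom scaleC_scaleC mult.commute)

text \<open>Truncated vectors are smooth, so \<open>H t\<close> is symmetric on them, and the factor
  \<open>\<i>\<close> turns symmetry into skew-symmetry. Conservation of inner products
  follows.\<close>

lemma gen_skew:
  assumes "t \<in> J"
  shows "cinner u (gen K t v) + cinner (gen K t u) v = 0"
proof -
  have "cinner u (tp K (H t (tp K v))) = cinner (tp K u) (H t (tp K v))" by (rule cinner_tp[symmetric])
  also have "\<dots> = cinner (H t (tp K u)) (tp K v)" by (rule H_sym[OF assms tp_in_dom tp_in_dom, symmetric])
  also have "\<dots> = cinner (tp K (H t (tp K u))) v" by (rule cinner_tp[symmetric])
  finally show ?thesis by (simp add: gen_def cinner_scaleC_left cinner_scaleC_right)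
qed

section \<open>Truncated solutions: conservation, uniqueness and flow property\<close>

lemma solvesD:
  assumes "solves K x" "t \<in> J"
  shows "tp K (x t) = x t" "(x has_vector_derivative gen K t (x t)) (at t within J)"
  using assms by (auto simp: solves_def)

lemma solves_add: "solves K x \<Longrightarrow> solves K y \<Longrightarrow> solves K (\<lambda>t. x t + y t)"
  and solves_diff: "solves K x \<Longrightarrow> solves K y \<Longrightarrow> solves K (\<lambda>t. x t - y t)"
  unfolding solves_def
  by (simp_all add: tp_add tp_diff gen_add gen_diff has_vector_derivative_add has_vector_derivative_diff)

lemma solves_scaleC: "solves K x \<Longrightarrow> solves K (\<lambda>t. z *\<^sub>C x t)"
  unfolding solves_def
  by (simp add: tp_scaleC gen_scaleC bounded_linear.has_vector_derivative[OF bounded_linear_scaleC])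

lemma solves_exists:
  assumes "s \<in> J"
  shows "\<exists>x. solves K x \<and> x s = tp K v"
proof -
  obtain L where "\<forall>t\<in>J. \<forall>v. norm (gen K t v) \<le> L * norm v" using norm_gen_bound by blast
  then obtain x where x: "x s = tp K v" "\<And>t. t \<in> J \<Longrightarrow> (x has_vector_derivative gen K t (x t)) (at t within J)"
    using linear_ode_solution_exists[OF assms bounded_linear_gen _ continuous_on_gen, of K L "tp K v"] by blast
  \<comment> \<open>The generator takes values in the range of the cutoff, so the component of the
    solution outside that range stays constant, namely zero.\<close>
  have "x t - tp K (x t) = x s - tp K (x s)" if "t \<in> J" for t
  proof (rule constant_of_zero_derivative[OF _ assms that])
    fix \<tau> assume "\<tau> \<in> J"
    from has_vector_derivative_diff[OF x(2)[OF this] bounded_linear.has_vector_derivative[OF bounded_linear_tp[of K] x(2)[OF this]]]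
    show "((\<lambda>t. x t - tp K (x t)) has_vector_derivative 0) (at \<tau> within J)" by (simp add: tp_gen)
  qed
  then have "solves K x" using x by (simp add: solves_def)
  then show ?thesis using x(1) by blast
qed

lemma cinner_solves:
  assumes "solves K x" "solves K y" "s \<in> J" "t \<in> J"
  shows "cinner (x t) (y t) = cinner (x s) (y s)"
proof (rule constant_of_zero_derivative[OF _ assms(3,4)])
  fix \<tau> assume \<tau>: "\<tau> \<in> J"
  from bounded_bilinear.has_vector_derivative[OF bounded_bilinear_cinner solvesD(2)[OF assms(1) \<tau>] solvesD(2)[OF assms(2) \<tau>]]
  show "((\<lambda>t. cinner (x t) (y t)) has_vector_derivative 0) (at \<tau> within J)" by (simp add: gen_skew[OF \<tau>])
qed

lemma norm_solves: "solves K x \<Longrightarrow> s \<in> J \<Longrightarrow> t \<in> J \<Longrightarrow> norm (x t) = norm (x s)"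
  using cinner_solves[of K x x s t] by (simp add: cinner_self del: of_real_power)

lemma solves_unique:
  assumes "solves K x" "solves K y" "s \<in> J" "x s = y s" "t \<in> J"
  shows "x t = y t"
  using norm_solves[OF solves_diff[OF assms(1,2)] assms(3,5)] assms(4) by simp

lemma sol_solves: "s \<in> J \<Longrightarrow> solves K (sol K s v)" and sol_initial: "s \<in> J \<Longrightarrow> sol K s v s = tp K v"
  using someI_ex[OF solves_exists[of s K v]] by (auto simp: sol_def)

lemma sol_unique: "solves K x \<Longrightarrow> s \<in> J \<Longrightarrow> x s = tp K v \<Longrightarrow> t \<in> J \<Longrightarrow> sol K s v t = x t"
  by (rule solves_unique[OF sol_solves]) (auto simp: sol_initial)

lemma sol_add: "s \<in> J \<Longrightarrow> t \<in> J \<Longrightarrow> sol K s (u + v) t = sol K s u t + sol K s v t"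
  and sol_diff: "s \<in> J \<Longrightarrow> t \<in> J \<Longrightarrow> sol K s (u - v) t = sol K s u t - sol K s v t"
  and sol_scaleC: "s \<in> J \<Longrightarrow> t \<in> J \<Longrightarrow> sol K s (z *\<^sub>C u) t = z *\<^sub>C sol K s u t"
  by (rule sol_unique, auto intro!: solves_add solves_diff solves_scaleC sol_solves simp: sol_initial tp_add tp_diff tp_scaleC)+

lemma tp_sol: "s \<in> J \<Longrightarrow> t \<in> J \<Longrightarrow> tp K (sol K s v t) = sol K s v t"
  using sol_solves by (rule solvesD)

lemma cinner_sol: "s \<in> J \<Longrightarrow> t \<in> J \<Longrightarrow> cinner (sol K s u t) (sol K s v t) = cinner (tp K u) (tp K v)"
  using cinner_solves[where x="sol K s u" and y="sol K s v" and K=K and s=s and t=t]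
  by (simp add: sol_initial sol_solves)

lemma norm_sol_eq: "s \<in> J \<Longrightarrow> t \<in> J \<Longrightarrow> norm (sol K s v t) = norm (tp K v)"
  using norm_solves[OF sol_solves, of s s t K v] by (simp add: sol_initial)

lemma norm_sol: "s \<in> J \<Longrightarrow> t \<in> J \<Longrightarrow> norm (sol K s v t) \<le> norm v"
  by (simp add: norm_sol_eq norm_tp)

lemma sol_cocycle: "s \<in> J \<Longrightarrow> r \<in> J \<Longrightarrow> t \<in> J \<Longrightarrow> sol K r (sol K s v r) t = sol K s v t"
  by (rule sol_unique) (auto intro: sol_solves simp: tp_sol)

lemma continuous_on_sol: "continuous_on (J \<times> J) (\<lambda>(t, s). sol K s v t)"
proof -
  obtain L where L: "L \<ge> 0" "\<And>t v. t \<in> J \<Longrightarrow> norm (gen K t v) \<le> L * norm v" using norm_gen_bound by blast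
  have 1: "norm (sol K s v t - sol K s v t') \<le> L * norm v * \<bar>t - t'\<bar>" if "s \<in> J" "t \<in> J" "t' \<in> J" for s t t'
  proof (rule norm_bound_derivative[OF solvesD(2)[OF sol_solves] _ that(3,2)])
    fix \<tau> assume "\<tau> \<in> J"
    then show "norm (gen K \<tau> (sol K s v \<tau>)) \<le> L * norm v"
      using L(2)[of \<tau> "sol K s v \<tau>"] mult_left_mono[OF norm_sol[OF that(1), of \<tau> K v] L(1)] by linarith
  qed (use that in auto)
  \<comment> \<open>The distance of two solutions is constant in time; evaluated at time
    \<open>s\<close> it is a time increment of a single solution.\<close>
  have 2: "norm (sol K s v t - sol K s' v t) \<le> L * norm v * \<bar>s - s'\<bar>" if "s \<in> J" "t \<in> J" "s' \<in> J" for s s' t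
  proof -
    have "norm (sol K s v t - sol K s' v t) = norm (sol K s v s - sol K s' v s)"
      using norm_solves[OF solves_diff[OF sol_solves sol_solves], of s s' s t K v v] that by simp
    also have "\<dots> = norm (sol K s' v s - sol K s' v s')" using that by (simp add: sol_initial norm_minus_commute)
    also have "\<dots> \<le> L * norm v * \<bar>s - s'\<bar>" using that by (intro 1)
    finally show ?thesis .
  qed
  have bd: "norm (sol K s v t - sol K s' v t') \<le> L * norm v * \<bar>t - t'\<bar> + L * norm v * \<bar>s - s'\<bar>"
    if "s \<in> J" "t \<in> J" "s' \<in> J" "t' \<in> J" for s t s' t'
    using norm_triangle_ineq[of "sol K s v t - sol K s v t'" "sol K s v t' - sol K s' v t'"] 1[of s t t'] 2[of s t' s'] that
    by simp
  show ?thesis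
    unfolding continuous_on_def
  proof safe
    fix t s assume ts: "t \<in> J" "s \<in> J"
    have "((\<lambda>x. L * norm v * \<bar>fst x - t\<bar> + L * norm v * \<bar>snd x - s\<bar>) \<longlongrightarrow>
      L * norm v * \<bar>fst (t, s) - t\<bar> + L * norm v * \<bar>snd (t, s) - s\<bar>) (at (t, s) within J \<times> J)"
      by (intro tendsto_intros)
    then have lim: "((\<lambda>x. L * norm v * \<bar>fst x - t\<bar> + L * norm v * \<bar>snd x - s\<bar>) \<longlongrightarrow> 0) (at (t, s) within J \<times> J)"
      by simp
    have "\<forall>\<^sub>F x in at (t, s) within J \<times> J. norm ((case x of (t, s) \<Rightarrow> sol K s v t) - sol K s v t)
        \<le> L * norm v * \<bar>fst x - t\<bar> + L * norm v * \<bar>snd x - s\<bar>"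
      unfolding eventually_at_filter by (rule always_eventually) (use bd ts in auto)
    from Lim_null_comparison[OF this lim]
    show "((\<lambda>x. case x of (t, s) \<Rightarrow> sol K s v t) \<longlongrightarrow> sol K s v t) (at (t, s) within J \<times> J)"
      by (simp add: LIM_zero_iff)
  qed
qed

text \<open>The exceptional null set in the commutator bound depends on the vector; a countable dense set of
  vectors makes it uniform on the range of a truncation.\<close>
lemma commutator_bound_uniform:
  assumes "commutator_bound r c"
  shows "\<exists>N. negligible N \<and> (\<forall>t\<in>J - N. \<forall>v. 2 * \<bar>Im (cinner (pw (2 * r) (tp K v)) (H t (tp K v)))\<bar>
      \<le> c t * (norm (pw r (tp K v)))\<^sup>2)"
proof -
  obtain Q :: "'a set" where Q: "countable Q" "closure Q = UNIV" using dense by blast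
  define P where "P t v \<longleftrightarrow> 2 * \<bar>Im (cinner (pw (2 * r) (tp K v)) (H t (tp K v)))\<bar>
      \<le> c t * (norm (pw r (tp K v)))\<^sup>2" for t v
  have "\<i> * (cnj z - z) = of_real (2 * Im z)" for z by (simp add: complex_eq_iff)
  then have "2 * \<bar>Im z\<bar> = cmod (\<i> * (cnj z - z))" for z by (simp add: abs_mult del: of_real_mult)
  then have "cmod (\<i> * (cinner y x - cinner x y)) = 2 * \<bar>Im (cinner x y)\<bar>" for x y :: 'a
    by (subst cinner_commute) simp
  then have "AE t in lebesgue. t \<in> J \<longrightarrow> P t v" for v
    using assms tp_in_dom unfolding P_def commutator_bound_def by simp
  then have "AE t in lebesgue. \<forall>v\<in>Q. t \<in> J \<longrightarrow> P t v" by (intro AE_ball_countable' Q(1))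
  then obtain N where N: "N \<in> null_sets lebesgue" "\<And>t. t \<notin> N \<Longrightarrow> \<forall>v\<in>Q. t \<in> J \<longrightarrow> P t v"
    unfolding eventually_ae_filter by auto
  have "P t v" if t: "t \<in> J - N" for t v
  proof -
    \<comment> \<open>At fixed \<open>t\<close> the cutoff makes both sides of the inequality
      continuous in \<open>v\<close>.\<close>
    have "closed {v. P t v}" unfolding P_def
      by (intro closed_Collect_le continuous_intros bounded_bilinear.continuous_on[OF bounded_bilinear_cinner]
          linear_continuous_on bounded_linear_pw_tp bounded_linear_H_tp) (use t in auto)
    moreover have "Q \<subseteq> {v. P t v}" using N(2)[of t] t by auto
    ultimately have "closure Q \<subseteq> {v. P t v}" by (rule closure_minimal[rotated])
    then show ?thesis using Q(2) by auto
  qed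
  then show ?thesis using N(1) unfolding P_def negligible_iff_null_sets by blast
qed

text \<open>The power \<open>2 * r\<close> commutes with the cutoff, so the derivative of the energy
  is the commutator with the full \<open>H t\<close> at a truncated vector. Hence one
  \<open>E\<close> serves all cutoffs.\<close>

lemma energy_estimate:
  assumes cb: "commutator_bound r c" and r: "r \<ge> 0"
  shows "\<exists>E>0. \<forall>K v. \<forall>s\<in>J. \<forall>t\<in>J. norm (pw r (sol K s v t)) \<le> E * norm (pw r (tp K v))"
proof -
  \<comment> \<open>The exponent is halved because Gronwall is applied to the square of the
    norm.\<close>
  define E where "E = exp (integral J c / 2)"
  have "norm (pw r (sol K s v t)) \<le> E * norm (pw r (tp K v))" if st: "s \<in> J" "t \<in> J" for K v s t
  proof (cases "tp K v = 0")
    case True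
    then have "sol K s v t = 0" using norm_sol_eq[OF st, of K v] by simp
    then show ?thesis using pw_zero by (simp add: E_def)
  next
    case False
    define x where "x = sol K s v"
    have x: "solves K x" unfolding x_def by (rule sol_solves[OF st(1)])
    note xd = solvesD[OF x]
    define f where "f t = (norm (pw r (tp K (x t))))\<^sup>2" for t
    define f' where "f' t = Re (cinner (pw (2*r) (tp K (x t))) (gen K t (x t)) + cinner (pw (2*r) (tp K (gen K t (x t)))) (x t))" for t
    obtain N where N: "negligible N" "\<And>t v. t \<in> J - N \<Longrightarrow>
        2 * \<bar>Im (cinner (pw (2 * r) (tp K v)) (H t (tp K v)))\<bar> \<le> c t * (norm (pw r (tp K v)))\<^sup>2"
      using commutator_bound_uniform[OF cb] by metis
    have "f t \<le> exp (integral J c) * f s"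
    proof (rule Gronwall_log_AE[OF _ _ _ _ N(1) _ st])
      fix \<tau> assume \<tau>: "\<tau> \<in> J"
      have "((\<lambda>t. Re (cinner (pw (2*r) (tp K (x t))) (x t))) has_vector_derivative f' \<tau>) (at \<tau> within J)"
        unfolding f'_def
        by (intro bounded_linear.has_vector_derivative[OF bounded_linear_Re]
            bounded_bilinear.has_vector_derivative[OF bounded_bilinear_cinner]
            bounded_linear.has_vector_derivative[OF bounded_linear_pw_tp] xd(2) \<tau>)
      moreover have "f = (\<lambda>t. Re (cinner (pw (2*r) (tp K (x t))) (x t)))"
        by (rule ext) (simp add: f_def norm_pw_tp_square)
      ultimately show "(f has_vector_derivative f' \<tau>) (at \<tau> within J)" by simp
      \<comment> \<open>Norm conservation keeps the energy away from zero, as the logarithm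
        requires; this is why vanishing initial data were split off.\<close>
      have "norm (x \<tau>) = norm (tp K v)" unfolding x_def by (rule norm_sol_eq[OF st(1) \<tau>])
      then have "0 < norm (tp K (x \<tau>))" using False xd(1)[OF \<tau>] by simp
      also have "\<dots> \<le> norm (pw r (tp K (x \<tau>)))" by (rule norm_le_norm_pw[OF r tp_in_dom])
      finally show "f \<tau> > 0" by (simp add: f_def)
    next
      fix \<tau> assume \<tau>: "\<tau> \<in> J - N"
      define y where "y = pw (2*r) (tp K (x \<tau>))"
      \<comment> \<open>Since \<open>y\<close> lies in the range of the cutoff, the outer cutoff in
        \<open>gen\<close> can be moved onto \<open>y\<close>, where it disappears.\<close>
      have "tp K y = y" using pw_tp[OF tp_in_dom, of "2*r" K K "x \<tau>"] by (simp add: y_def)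
      then have "cinner y (tp K w) = cinner y w" for w using cinner_tp[of K y w] by simp
      then have "cinner y (gen K \<tau> (x \<tau>)) = - \<i> * cinner y (H \<tau> (tp K (x \<tau>)))"
        by (simp add: gen_def cinner_scaleC_right)
      moreover have "cinner (pw (2*r) (tp K (gen K \<tau> (x \<tau>)))) (x \<tau>) = cnj (cinner y (gen K \<tau> (x \<tau>)))"
        using cinner_pw_tp[of "2*r" K "gen K \<tau> (x \<tau>)" "x \<tau>"] cinner_commute[of "gen K \<tau> (x \<tau>)" y]
        by (simp add: y_def)
      ultimately have "f' \<tau> = 2 * Im (cinner y (H \<tau> (tp K (x \<tau>))))" by (simp add: f'_def y_def)
      then show "\<bar>f' \<tau>\<bar> \<le> c \<tau> * f \<tau>" using N(2)[OF \<tau>, of "x \<tau>"] by (simp add: f_def y_def abs_mult)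
    qed (use cb in \<open>auto simp: commutator_bound_def set_lebesgue_integral_eq_integral\<close>)
    moreover have "exp (integral J c) = E\<^sup>2" by (simp add: E_def power2_eq_square flip: exp_add)
    moreover have "tp K (x t) = x t" "tp K (x s) = tp K v" using st xd(1) by (simp_all add: x_def sol_initial)
    ultimately have "(norm (pw r (x t)))\<^sup>2 \<le> (E * norm (pw r (tp K v)))\<^sup>2"
      by (simp add: f_def power_mult_distrib)
    then show ?thesis unfolding x_def by (rule power2_le_imp_le) (simp add: E_def)
  qed
  then show ?thesis by (intro exI[of _ E]) (simp add: E_def)
qed

end

section \<open>Removing the truncation\<close>

lemma unitary_op_bounded_linear:
  assumes "unitary_op V"
  shows "bounded_linear V" "norm (V x) = norm x"
proof -
  have lin: "V (x + y) = V x + V y" "V (z *\<^sub>C x) = z *\<^sub>C V x" and inner: "cinner (V x) (V y) = cinner x y" for x y z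
    using assms by (auto simp: unitary_op_def clinear_on_def)
  have n: "norm (V x) = norm x" for x
    using inner[of x x] by (simp add: cinner_self del: of_real_power)
  then show "norm (V x) = norm x" .
  show "bounded_linear V"
    by (rule bounded_linear_intro[where K=1]) (simp_all add: lin n flip: scaleC_of_real)
qed

context truncated_evolution begin

section \<open>Comparison of two truncations\<close>

lemma norm_tp_diff_le:
  assumes "q \<ge> 0" "K > 0" "K \<le> M" "w \<in> dom q"
  shows "norm (tp M w - tp K w) \<le> K powr (- q) * norm (pw q w)"
proof -
  have "tp M w - tp K w = tp M (w - tp K w)" using assms(3) by (simp add: tp_diff tp_tp)
  then have "norm (tp M w - tp K w) \<le> norm (w - tp K w)" by (simp add: norm_tp)
  also have "\<dots> \<le> K powr (- q) * norm (pw q w)" by (rule norm_minus_tp_le[OF assms(1,2,4)])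
  finally show ?thesis .
qed

text \<open>The derivative of \<open>norm (d t)\<close> is avoided by testing \<open>d\<close> against the solution of
  the homogeneous equation that passes through \<open>d t\<close> at time \<open>t\<close>.\<close>
lemma Duhamel_estimate:
  assumes d: "\<And>t. t \<in> J \<Longrightarrow> tp M (d t) = d t"
    and d': "\<And>t. t \<in> J \<Longrightarrow> (d has_vector_derivative gen M t (d t) + g t) (at t within J)"
    and g: "\<And>t. t \<in> J \<Longrightarrow> norm (g t) \<le> B"
    and st: "s \<in> J" "t \<in> J"
  shows "norm (d t) \<le> norm (d s) + B * \<bar>t - s\<bar>"
proof -
  define \<phi> where "\<phi> = sol M t (d t)"
  have \<phi>: "solves M \<phi>" "\<phi> t = d t" using st d by (simp_all add: \<phi>_def sol_solves sol_initial)
  have n\<phi>: "norm (\<phi> \<tau>) = norm (d t)" if "\<tau> \<in> J" for \<tau> using norm_solves[OF \<phi>(1) st(2) that] \<phi>(2) by simp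
  have "norm (cinner (\<phi> t) (d t) - cinner (\<phi> s) (d s)) \<le> (norm (d t) * B) * \<bar>t - s\<bar>"
  proof (rule norm_bound_derivative[OF _ _ st])
    fix \<tau> assume \<tau>: "\<tau> \<in> J"
    have "cinner (\<phi> \<tau>) (gen M \<tau> (d \<tau>) + g \<tau>) + cinner (gen M \<tau> (\<phi> \<tau>)) (d \<tau>) = cinner (\<phi> \<tau>) (g \<tau>)"
      using gen_skew[OF \<tau>, of "\<phi> \<tau>" M "d \<tau>"] by (simp add: cinner_add_right algebra_simps)
    then show "((\<lambda>t. cinner (\<phi> t) (d t)) has_vector_derivative cinner (\<phi> \<tau>) (g \<tau>)) (at \<tau> within J)"
      using bounded_bilinear.has_vector_derivative[OF bounded_bilinear_cinner solvesD(2)[OF \<phi>(1) \<tau>] d'[OF \<tau>]] by simp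
    have "norm (cinner (\<phi> \<tau>) (g \<tau>)) \<le> norm (\<phi> \<tau>) * norm (g \<tau>)" by (rule Cauchy_Schwarz_cinner)
    also have "\<dots> \<le> norm (d t) * B" unfolding n\<phi>[OF \<tau>] by (intro mult_left_mono g \<tau>) simp
    finally show "norm (cinner (\<phi> \<tau>) (g \<tau>)) \<le> norm (d t) * B" .
  qed
  moreover have "norm (cinner (\<phi> s) (d s)) \<le> norm (d t) * norm (d s)"
    using Cauchy_Schwarz_cinner[of "\<phi> s" "d s"] n\<phi>[OF st(1)] by simp
  moreover have "norm (cinner (\<phi> t) (d t)) = norm (d t) * norm (d t)"
    by (simp add: \<phi>(2) cinner_self norm_power power2_eq_square norm_mult)
  ultimately have "norm (d t) * norm (d t) \<le> norm (d t) * (norm (d s) + B * \<bar>t - s\<bar>)"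
    using norm_triangle_ineq2[of "cinner (\<phi> t) (d t)" "cinner (\<phi> s) (d s)"] by (simp add: algebra_simps)
  moreover have "B \<ge> 0" using g[OF st(1)] norm_ge_zero order_trans by blast
  ultimately show ?thesis by (cases "d t = 0") auto
qed

lemma truncation_rate:
  assumes \<sigma>: "\<sigma> \<ge> 0" and cb: "commutator_bound (\<mu> + \<sigma>) c"
  shows "\<exists>C>0. \<forall>u\<in>dom (\<mu> + \<sigma>). \<forall>K\<ge>1. \<forall>M\<ge>K. \<forall>t\<in>J. \<forall>s\<in>J.
    norm (sol M s u t - sol K s u t) \<le> C * K powr (- \<sigma>) * norm (pw (\<mu> + \<sigma>) u)"
proof -
  obtain E where E: "E > 0" "\<And>K v s t. s \<in> J \<Longrightarrow> t \<in> J \<Longrightarrow> norm (pw (\<mu> + \<sigma>) (sol K s v t)) \<le> E * norm (pw (\<mu> + \<sigma>) (tp K v))"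
    using energy_estimate[OF cb] mu \<sigma> by (metis add_nonneg_nonneg)
  obtain A where A: "A \<ge> 0" "\<And>t u. t \<in> J \<Longrightarrow> u \<in> dom (\<mu> + \<sigma>) \<Longrightarrow> H t u \<in> dom \<sigma>"
      "\<And>t u. t \<in> J \<Longrightarrow> u \<in> dom (\<mu> + \<sigma>) \<Longrightarrow> norm (pw \<sigma> (H t u)) \<le> A * norm (pw (\<mu> + \<sigma>) u)"
    using H_bound[OF \<sigma>] by (metis add.commute)
  \<comment> \<open>The summand 1 pays for the difference of the truncated initial data, the other
    for the source accumulated over the interval.\<close>
  define C where "C = 1 + A * E * (b - a)"
  have "norm (sol M s u t - sol K s u t) \<le> C * K powr (- \<sigma>) * norm (pw (\<mu> + \<sigma>) u)"
    if u: "u \<in> dom (\<mu> + \<sigma>)" and K: "K \<ge> 1" "K \<le> M" and st: "t \<in> J" "s \<in> J" for u K M t s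
  proof -
    define n where "n = norm (pw (\<mu> + \<sigma>) u)"
    define B where "B = K powr (- \<sigma>) * (A * (E * n))"
    define x where "x = sol K s u"
    define y where "y = sol M s u"
    have x: "solves K x" and y: "solves M y" using st by (simp_all add: x_def y_def sol_solves)
    define d where "d t = y t - x t" for t
    have tpMx: "tp M (x \<tau>) = x \<tau>" if "\<tau> \<in> J" for \<tau>
      using tp_tp[of M K "x \<tau>"] solvesD(1)[OF x that] K by simp
    have "norm (d t) \<le> norm (d s) + B * \<bar>t - s\<bar>"
    proof (rule Duhamel_estimate[where M=M and g="\<lambda>t. gen M t (x t) - gen K t (x t)"])
      fix \<tau> assume \<tau>: "\<tau> \<in> J"
      show "tp M (d \<tau>) = d \<tau>" by (simp add: d_def tp_diff tpMx[OF \<tau>] solvesD(1)[OF y \<tau>])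
      have eq: "gen M \<tau> (d \<tau>) + (gen M \<tau> (x \<tau>) - gen K \<tau> (x \<tau>)) = gen M \<tau> (y \<tau>) - gen K \<tau> (x \<tau>)"
        by (simp add: d_def gen_diff[OF \<tau>])
      show "(d has_vector_derivative gen M \<tau> (d \<tau>) + (gen M \<tau> (x \<tau>) - gen K \<tau> (x \<tau>))) (at \<tau> within J)"
        unfolding eq using has_vector_derivative_diff[OF solvesD(2)[OF y \<tau>] solvesD(2)[OF x \<tau>]]
        by (simp add: d_def[abs_def])
      have xd: "x \<tau> \<in> dom (\<mu> + \<sigma>)" using tp_in_dom[of K "x \<tau>"] solvesD(1)[OF x \<tau>] by simp
      define w where "w = H \<tau> (x \<tau>)"
      \<comment> \<open>Both inner cutoffs leave \<open>x \<tau>\<close> fixed, so the source is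
        just the spectral slice of \<open>H \<tau> (x \<tau>)\<close> between \<open>K\<close> and
        \<open>M\<close>.\<close>
      have "gen M \<tau> (x \<tau>) - gen K \<tau> (x \<tau>) = - (\<i> *\<^sub>C (tp M w - tp K w))"
        by (simp add: gen_def tpMx[OF \<tau>] solvesD(1)[OF x \<tau>] w_def scaleC_diff_right)
      then have "norm (gen M \<tau> (x \<tau>) - gen K \<tau> (x \<tau>)) = norm (tp M w - tp K w)" by simp
      also have "\<dots> \<le> K powr (- \<sigma>) * norm (pw \<sigma> w)"
        unfolding w_def by (rule norm_tp_diff_le) (use \<sigma> K A(2)[OF \<tau> xd] in auto)
      also have "\<dots> \<le> B" unfolding B_def
      proof (rule mult_left_mono)
        have "norm (pw \<sigma> w) \<le> A * norm (pw (\<mu> + \<sigma>) (x \<tau>))" unfolding w_def by (rule A(3)[OF \<tau> xd])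
        also have "norm (pw (\<mu> + \<sigma>) (x \<tau>)) \<le> E * norm (pw (\<mu> + \<sigma>) (tp K u))"
          unfolding x_def by (rule E(2)[OF st(2) \<tau>])
        also have "norm (pw (\<mu> + \<sigma>) (tp K u)) \<le> n" unfolding n_def by (rule norm_pw_tp_le[OF u])
        finally show "norm (pw \<sigma> w) \<le> A * (E * n)" using A(1) E(1) by (simp add: mult_left_mono)
      qed simp
      finally show "norm (gen M \<tau> (x \<tau>) - gen K \<tau> (x \<tau>)) \<le> B" .
    qed (use st in auto)
    also have "norm (d s) \<le> K powr (- \<sigma>) * n"
    proof -
      have "norm (d s) = norm (tp M u - tp K u)" using st by (simp add: d_def x_def y_def sol_initial)
      \<comment> \<open>The initial data satisfy the stronger decay bound with exponent
        \<open>\<mu> + \<sigma>\<close>; it is weakened to the rate of the source, using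
        \<open>K \<ge> 1\<close>.\<close>
      also have "\<dots> \<le> K powr (- (\<mu> + \<sigma>)) * n"
        unfolding n_def by (rule norm_tp_diff_le) (use u K mu \<sigma> in auto)
      also have "\<dots> \<le> K powr (- \<sigma>) * n"
        by (intro mult_right_mono powr_mono) (use K mu in \<open>auto simp: n_def\<close>)
      finally show ?thesis .
    qed
    also have "B * \<bar>t - s\<bar> \<le> B * (b - a)"
      using st A(1) E(1) by (intro mult_left_mono) (auto simp: B_def n_def)
    finally show ?thesis by (simp add: C_def B_def d_def x_def y_def n_def algebra_simps)
  qed
  moreover have "C > 0" using A(1) E(1) ab by (simp add: C_def add_pos_nonneg)
  ultimately show ?thesis by blast
qed

end

locale convergent_evolution = truncated_evolution S p a b \<mu> H
  for S :: "real set" and p :: "real \<Rightarrow> 'a::chilbert_space \<Rightarrow> 'a" and a b \<mu> H +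
  fixes \<sigma> :: real and c :: "real \<Rightarrow> real"
  assumes sigma: "\<sigma> > 0" and bound: "commutator_bound (\<mu> + \<sigma>) c"
begin

section \<open>Uniform convergence and the limit propagator\<close>

lemma uniformly_Cauchy_dom:
  assumes u: "u \<in> dom (\<mu> + \<sigma>)" and e: "e > 0"
  shows "\<exists>K0\<ge>1. \<forall>M\<ge>K0. \<forall>K\<ge>K0. \<forall>t\<in>J. \<forall>s\<in>J. norm (sol M s u t - sol K s u t) < e"
proof -
  obtain C where C: "\<And>K M t s. K \<ge> 1 \<Longrightarrow> M \<ge> K \<Longrightarrow> t \<in> J \<Longrightarrow> s \<in> J \<Longrightarrow>
      norm (sol M s u t - sol K s u t) \<le> C * K powr (- \<sigma>) * norm (pw (\<mu> + \<sigma>) u)"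
    using truncation_rate[OF _ bound] sigma u by (metis less_imp_le)
  have "((\<lambda>K. C * K powr (- \<sigma>) * norm (pw (\<mu> + \<sigma>) u)) \<longlongrightarrow> C * 0 * norm (pw (\<mu> + \<sigma>) u)) at_top"
    using sigma by (intro tendsto_intros tendsto_neg_powr filterlim_ident) auto
  then have "\<forall>\<^sub>F K in at_top. C * K powr (- \<sigma>) * norm (pw (\<mu> + \<sigma>) u) < e"
    using e by (intro order_tendstoD) auto
  then obtain K1 where K1: "\<And>K. K \<ge> K1 \<Longrightarrow> C * K powr (- \<sigma>) * norm (pw (\<mu> + \<sigma>) u) < e"
    by (auto simp: eventually_at_top_linorder)
  have ordered: "norm (sol M s u t - sol K s u t) < e" if "K \<ge> max 1 K1" "M \<ge> K" "t \<in> J" "s \<in> J" for M K t s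
    using C[of K M t s] K1[of K] that by fastforce
  have "norm (sol M s u t - sol K s u t) < e" if "K \<ge> max 1 K1" "M \<ge> max 1 K1" "t \<in> J" "s \<in> J" for M K t s
    using ordered[of K M t s] ordered[of M K t s] that by (cases "K \<le> M") (auto simp: norm_minus_commute)
  then show ?thesis by (intro exI[of _ "max 1 K1"]) auto
qed

lemma uniformly_Cauchy:
  assumes e: "e > 0"
  shows "\<exists>K0\<ge>1. \<forall>M\<ge>K0. \<forall>K\<ge>K0. \<forall>t\<in>J. \<forall>s\<in>J. norm (sol M s u t - sol K s u t) < e"
proof -
  have "\<forall>\<^sub>F L in at_top. dist (tp L u) u < e / 3" using tendsto_tp e by (intro tendstoD) auto
  then obtain L where L: "norm (u - tp L u) < e / 3"
    by (auto simp: eventually_at_top_linorder dist_norm norm_minus_commute)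
  \<comment> \<open>A truncated vector belongs to every level, so the rate applies to it;
    contractivity bounds the error of the replacement for all cutoffs at once.\<close>
  define v where "v = tp L u"
  obtain K0 where K0: "K0 \<ge> 1" "\<And>M K t s. M \<ge> K0 \<Longrightarrow> K \<ge> K0 \<Longrightarrow> t \<in> J \<Longrightarrow> s \<in> J \<Longrightarrow> norm (sol M s v t - sol K s v t) < e / 3"
    using uniformly_Cauchy_dom[OF tp_in_dom, of "e / 3" L u] e unfolding v_def by auto
  have "norm (sol M s u t - sol K s u t) < e" if "M \<ge> K0" "K \<ge> K0" "t \<in> J" "s \<in> J" for M K t s
  proof -
    have *: "norm (sol L' s u t - sol L' s v t) < e / 3" for L'
      using norm_sol[OF that(4,3), of L' "u - v"] L by (simp add: sol_diff[OF that(4,3)] v_def)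
    show ?thesis
      using *[of M] *[of K] K0(2)[OF that]
        norm_triangle_ineq[of "sol M s u t - sol M s v t" "sol M s v t - sol K s u t"]
        norm_triangle_ineq[of "sol M s v t - sol K s v t" "sol K s v t - sol K s u t"]
      by (simp add: norm_minus_commute)
  qed
  then show ?thesis using K0(1) by blast
qed

text \<open>Integer cutoffs suffice to define the value; the uniform Cauchy property then gives
  convergence along all real cutoffs.\<close>

definition U :: "real \<Rightarrow> real \<Rightarrow> 'a \<Rightarrow> 'a" where
  "U t s u = lim (\<lambda>n. sol (real n) s u t)"

lemma sol_LIMSEQ_U:
  assumes "t \<in> J" "s \<in> J"
  shows "(\<lambda>n. sol (real n) s u t) \<longlonglongrightarrow> U t s u"
proof -
  have "Cauchy (\<lambda>n. sol (real n) s u t)"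
  proof (rule metric_CauchyI)
    fix e :: real assume "e > 0"
    then obtain K0 where K0: "\<forall>M\<ge>K0. \<forall>K\<ge>K0. \<forall>t\<in>J. \<forall>s\<in>J. norm (sol M s u t - sol K s u t) < e"
      using uniformly_Cauchy by blast
    obtain k :: nat where "K0 \<le> real k" using real_arch_simple by blast
    then have "\<forall>m\<ge>k. \<forall>n\<ge>k. dist (sol (real m) s u t) (sol (real n) s u t) < e"
      using K0 assms by (simp add: dist_norm)
    then show "\<exists>k. \<forall>m\<ge>k. \<forall>n\<ge>k. dist (sol (real m) s u t) (sol (real n) s u t) < e" by blast
  qed
  then show ?thesis unfolding U_def by (simp add: Cauchy_convergent convergent_LIMSEQ_iff[symmetric])
qed

lemma U_uniform:
  assumes "e > 0"
  shows "\<exists>K0\<ge>1. \<forall>K\<ge>K0. \<forall>t\<in>J. \<forall>s\<in>J. norm (sol K s u t - U t s u) < e"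
proof -
  obtain K0 where K0: "K0 \<ge> 1" "\<And>M K t s. M \<ge> K0 \<Longrightarrow> K \<ge> K0 \<Longrightarrow> t \<in> J \<Longrightarrow> s \<in> J \<Longrightarrow> norm (sol M s u t - sol K s u t) < e / 2"
    using uniformly_Cauchy[of "e / 2" u] assms by auto
  have "norm (sol K s u t - U t s u) < e" if "K \<ge> K0" "t \<in> J" "s \<in> J" for K t s
  proof -
    have "(\<lambda>n. norm (sol K s u t - sol (real n) s u t)) \<longlonglongrightarrow> norm (sol K s u t - U t s u)"
      by (intro tendsto_intros sol_LIMSEQ_U that)
    moreover have "\<forall>\<^sub>F n in sequentially. norm (sol K s u t - sol (real n) s u t) \<le> e / 2"
    proof -
      obtain k :: nat where "K0 \<le> real k" using real_arch_simple by blast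
      then show ?thesis using K0(2) that unfolding eventually_sequentially
        by (intro exI[of _ k]) (auto intro: less_imp_le)
    qed
    ultimately have "norm (sol K s u t - U t s u) \<le> e / 2" by (rule tendsto_upperbound) simp
    then show ?thesis using assms by simp
  qed
  then show ?thesis using K0(1) by blast
qed

lemma uniform_limit_U: "uniform_limit (J \<times> J) (\<lambda>K (t, s). sol K s u t) (\<lambda>(t, s). U t s u) at_top"
  unfolding uniform_limit_iff eventually_at_top_linorder
  using U_uniform[of _ u] by (fastforce simp: dist_norm)

lemma tendsto_U:
  assumes "t \<in> J" "s \<in> J"
  shows "((\<lambda>K. sol K s u t) \<longlongrightarrow> U t s u) at_top"
  using tendsto_uniform_limitI[OF uniform_limit_U, of "(t, s)" u] assms by simp

lemma U_unique: "((\<lambda>K. sol K s u t) \<longlongrightarrow> w) at_top \<Longrightarrow> t \<in> J \<Longrightarrow> s \<in> J \<Longrightarrow> U t s u = w"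
  using tendsto_unique[OF trivial_limit_at_top_linorder tendsto_U] by blast

lemma U_refl: "s \<in> J \<Longrightarrow> U s s u = u"
  by (rule U_unique) (simp_all add: sol_initial tendsto_tp)

lemma U_cocycle:
  assumes "t \<in> J" "r \<in> J" "s \<in> J"
  shows "U t r (U r s u) = U t s u"
proof (rule U_unique[OF _ assms(1,2)])
  have "((\<lambda>K. sol K s u r - U r s u) \<longlongrightarrow> U r s u - U r s u) at_top"
    by (intro tendsto_diff tendsto_U tendsto_const assms)
  then have lim0: "((\<lambda>K. norm (sol K s u r - U r s u)) \<longlongrightarrow> 0) at_top" by (simp add: tendsto_norm_zero)
  \<comment> \<open>Contractivity, uniform in \<open>K\<close>, allows replacing the intermediate
    state by its limit although the outer evolution varies with \<open>K\<close> too.\<close>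
  have "((\<lambda>K. sol K r (sol K s u r - U r s u) t) \<longlongrightarrow> 0) at_top"
    by (rule Lim_null_comparison[OF always_eventually lim0]) (intro allI norm_sol assms(2,1))
  from tendsto_diff[OF tendsto_U[OF assms(1,3), of u] this]
  show "((\<lambda>K. sol K r (U r s u) t) \<longlongrightarrow> U t s u) at_top"
    by (simp add: sol_diff[OF assms(2,1)] sol_cocycle[OF assms(3,2,1)])
qed

lemma unitary_op_U:
  assumes "t \<in> J" "s \<in> J"
  shows "unitary_op (U t s)"
proof -
  have "U t s (x + y) = U t s x + U t s y" for x y
  proof (rule U_unique[OF _ assms])
    show "((\<lambda>K. sol K s (x + y) t) \<longlongrightarrow> U t s x + U t s y) at_top"
      unfolding sol_add[OF assms(2,1)] by (intro tendsto_add tendsto_U assms)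
  qed
  moreover have "U t s (z *\<^sub>C x) = z *\<^sub>C U t s x" for x z
    by (rule U_unique[OF _ assms])
      (use bounded_linear.tendsto[OF bounded_linear_scaleC tendsto_U[OF assms]] in \<open>simp add: sol_scaleC[OF assms(2,1)]\<close>)
  \<comment> \<open>An isometry need not be onto; the reversed propagator provides a right
    inverse.\<close>
  moreover have "surj (U t s)" by (rule surjI[of _ "U s t"]) (simp add: U_cocycle U_refl assms del: atLeastAtMost_iff)
  moreover have "cinner (U t s x) (U t s y) = cinner x y" for x y
  proof (rule tendsto_unique[OF trivial_limit_at_top_linorder])
    show "((\<lambda>K. cinner (sol K s x t) (sol K s y t)) \<longlongrightarrow> cinner (U t s x) (U t s y)) at_top"
      by (intro tendsto_cinner tendsto_U assms)
    show "((\<lambda>K. cinner (sol K s x t) (sol K s y t)) \<longlongrightarrow> cinner x y) at_top"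
      unfolding cinner_sol[OF assms(2,1)] by (intro tendsto_cinner tendsto_tp)
  qed
  ultimately show ?thesis by (simp add: unitary_op_def clinear_on_def csubspace_def)
qed

lemma unitary_propagator_U: "unitary_propagator J U"
proof -
  have "continuous_on (J \<times> J) (\<lambda>(t, s). U t s u)" for u
    by (rule uniform_limit_theorem[OF _ uniform_limit_U]) (simp_all add: continuous_on_sol always_eventually)
  then show ?thesis
    unfolding unitary_propagator_def by (auto simp: fun_eq_iff intro: unitary_op_U U_cocycle U_refl simp del: atLeastAtMost_iff)
qed

text \<open>Unitaries are continuous, and every vector is the limit of its truncations, which lie in
  \<open>dom (\<mu> + \<sigma>)\<close>.\<close>

lemma U_determined:
  assumes V: "unitary_propagator J V" and eq: "\<And>u t s. u \<in> dom (\<mu> + \<sigma>) \<Longrightarrow> t \<in> J \<Longrightarrow> s \<in> J \<Longrightarrow> V t s u = U t s u"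
    and st: "t \<in> J" "s \<in> J"
  shows "V t s = U t s"
proof
  fix u
  have bl: "bounded_linear (V t s)" "bounded_linear (U t s)"
    using V unitary_op_U st by (auto intro!: unitary_op_bounded_linear simp: unitary_propagator_def)
  have "((\<lambda>K. V t s (tp K u)) \<longlongrightarrow> V t s u) at_top" "((\<lambda>K. U t s (tp K u)) \<longlongrightarrow> U t s u) at_top"
    by (intro bounded_linear.tendsto[OF bl(1)] bounded_linear.tendsto[OF bl(2)] tendsto_tp)+
  then show "V t s u = U t s u"
    unfolding eq[OF tp_in_dom st] using tendsto_unique[OF trivial_limit_at_top_linorder] by blast
qed

section \<open>Regularity of the limit propagator\<close>

lemma sol_in_dom: "s \<in> J \<Longrightarrow> t \<in> J \<Longrightarrow> sol K s u t \<in> dom r"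
  using tp_in_dom[of K "sol K s u t" r] tp_sol by simp

text \<open>Lower semicontinuity of the level-\<open>r\<close> norm: the truncated solutions
  converge only in the Hilbert space norm, but each finite sum of weighted components passes to the
  limit with its uniform bound.\<close>

lemma U_energy_estimate:
  assumes "commutator_bound r c'" "r \<ge> 0"
  shows "\<exists>E>0. \<forall>u\<in>dom r. \<forall>t\<in>J. \<forall>s\<in>J. U t s u \<in> dom r \<and> norm (pw r (U t s u)) \<le> E * norm (pw r u)
     \<and> (\<forall>K. norm (pw r (sol K s u t)) \<le> E * norm (pw r u))"
proof -
  obtain E where E: "E > 0" "\<And>K v s t. s \<in> J \<Longrightarrow> t \<in> J \<Longrightarrow> norm (pw r (sol K s v t)) \<le> E * norm (pw r (tp K v))"
    using energy_estimate[OF assms] by metis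
  have sol: "norm (pw r (sol K s u t)) \<le> E * norm (pw r u)" if "u \<in> dom r" "t \<in> J" "s \<in> J" for u t s K
    using E(2)[OF that(3,2), of K u] mult_left_mono[OF norm_pw_tp_le[OF that(1), of K], of E] E(1) by linarith
  have U: "U t s u \<in> dom r \<and> norm (pw r (U t s u)) \<le> E * norm (pw r u)" if u: "u \<in> dom r" and st: "t \<in> J" "s \<in> J" for u t s
  proof -
    have le: "(\<Sum>l\<in>F. (l powr r)\<^sup>2 * (norm (p l (U t s u)))\<^sup>2) \<le> (E * norm (pw r u))\<^sup>2" if F: "finite F" "F \<subseteq> S" for F
    proof (rule tendsto_upperbound)
      show "((\<lambda>K. \<Sum>l\<in>F. (l powr r)\<^sup>2 * (norm (p l (sol K s u t)))\<^sup>2)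
          \<longlongrightarrow> (\<Sum>l\<in>F. (l powr r)\<^sup>2 * (norm (p l (U t s u)))\<^sup>2)) at_top"
        using F by (intro tendsto_intros bounded_linear.tendsto[OF bounded_linear_p] tendsto_U st) auto
      have "(\<Sum>l\<in>F. (l powr r)\<^sup>2 * (norm (p l (sol K s u t)))\<^sup>2) \<le> (E * norm (pw r u))\<^sup>2" for K
        using finite_sum_le_norm_pw[OF sol_in_dom[OF st(2,1)] F, of r K u]
          power_mono[OF sol[OF u st, of K] norm_ge_zero, of 2] by linarith
      then show "\<forall>\<^sub>F K in at_top. (\<Sum>l\<in>F. (l powr r)\<^sup>2 * (norm (p l (sol K s u t)))\<^sup>2) \<le> (E * norm (pw r u))\<^sup>2"
        by (intro always_eventually) blast
    qed simp
    have "E * norm (pw r u) \<ge> 0" using E(1) by simp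
    then show ?thesis using dom_bounded[OF _ le] by blast
  qed
  show ?thesis using E(1) sol U by blast
qed

text \<open>The derivatives of the truncated solutions converge uniformly: \<open>H\<close> loses \<open>\<mu>\<close> levels, and convergence
  at level \<open>\<mu>\<close> follows by interpolating between convergence at level \<open>0\<close> and bounds at level \<open>2 \<mu>\<close>.\<close>
lemma U_has_vector_derivative:
  assumes all: "\<And>r. r \<ge> 0 \<Longrightarrow> \<exists>c'. commutator_bound r c'"
    and u: "\<And>r. u \<in> dom r" and st: "t \<in> J" "s \<in> J"
  shows "((\<lambda>\<tau>. U \<tau> s u) has_vector_derivative - (\<i> *\<^sub>C H t (U t s u))) (at t within J)"
proof -
  have energy: "\<exists>B\<ge>0. \<forall>t\<in>J. U t s u \<in> dom r \<and> norm (pw r (U t s u)) \<le> B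
      \<and> (\<forall>K. norm (pw r (sol K s u t)) \<le> B)" if r: "r \<ge> 0" for r
  proof -
    obtain c' where "commutator_bound r c'" using all[OF r] by blast
    then obtain E where "E > 0" "\<forall>u\<in>dom r. \<forall>t\<in>J. \<forall>s\<in>J. U t s u \<in> dom r \<and> norm (pw r (U t s u)) \<le> E * norm (pw r u)
     \<and> (\<forall>K. norm (pw r (sol K s u t)) \<le> E * norm (pw r u))" using U_energy_estimate r by blast
    then show ?thesis using u st by (intro exI[of _ "E * norm (pw r u)"]) auto
  qed
  \<comment> \<open>A bound at level \<open>1 + \<mu>\<close> puts the image under
    \<open>H t\<close> into \<open>dom 1\<close>, so removing the outer cutoff costs only
    \<open>1 / n\<close>. Level \<open>2 * \<mu>\<close> is the upper end of the
    interpolation.\<close>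
  have "0 \<le> 1 + \<mu>" "0 \<le> 2 * \<mu>" using mu by auto
  obtain B1 where B1: "B1 \<ge> 0" "\<And>t K. t \<in> J \<Longrightarrow> norm (pw (1 + \<mu>) (sol K s u t)) \<le> B1"
    using energy[OF \<open>0 \<le> 1 + \<mu>\<close>] by blast
  obtain B2 where B2: "B2 \<ge> 0" "\<And>t K. t \<in> J \<Longrightarrow> norm (pw (2 * \<mu>) (sol K s u t)) \<le> B2"
      "\<And>t. t \<in> J \<Longrightarrow> U t s u \<in> dom (2 * \<mu>)" "\<And>t. t \<in> J \<Longrightarrow> norm (pw (2 * \<mu>) (U t s u)) \<le> B2"
    using energy[OF \<open>0 \<le> 2 * \<mu>\<close>] by blast
  obtain A1 where A1: "A1 \<ge> 0" "\<And>t u. t \<in> J \<Longrightarrow> u \<in> dom (1 + \<mu>) \<Longrightarrow> H t u \<in> dom 1"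
      "\<And>t u. t \<in> J \<Longrightarrow> u \<in> dom (1 + \<mu>) \<Longrightarrow> norm (pw 1 (H t u)) \<le> A1 * norm (pw (1 + \<mu>) u)"
    using H_bound[of 1] by auto
  obtain A0 where A0: "A0 \<ge> 0" "\<And>t u. t \<in> J \<Longrightarrow> u \<in> dom \<mu> \<Longrightarrow> norm (H t u) \<le> A0 * norm (pw \<mu> u)"
    using H_bound[of 0] by (auto simp: pw_0)
  have U\<mu>: "U t s u \<in> dom \<mu>" if "t \<in> J" for t
    using B2(3)[OF that] dom_mono[of \<mu> "2 * \<mu>"] mu by auto
  have "\<exists>g. \<forall>t\<in>J. (\<lambda>n. sol (real n) s u t) \<longlonglongrightarrow> g t
      \<and> (g has_derivative (\<lambda>h. h *\<^sub>R - (\<i> *\<^sub>C H t (U t s u)))) (at t within J)"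
  proof (rule has_derivative_sequence[where f="\<lambda>n. sol (real n) s u"
        and f'="\<lambda>n t h. h *\<^sub>R gen (real n) t (sol (real n) s u t)", OF _ _ _ st(2) sol_LIMSEQ_U[OF st(2,2)]])
    show "(sol (real n) s u has_derivative (\<lambda>h. h *\<^sub>R gen (real n) t (sol (real n) s u t))) (at t within J)" if "t \<in> J" for n t
      using solvesD(2)[OF sol_solves[OF st(2)] that] by (simp only: has_vector_derivative_def)
    fix e :: real assume e: "e > 0"
    \<comment> \<open>The size of \<open>norm (x - y)\<close> at which interpolation makes the
      \<open>H\<close> difference at most \<open>e / 2\<close>; the added 1 keeps the denominator
      positive.\<close>
    define \<delta> where "\<delta> = (e / 2)\<^sup>2 / (A0\<^sup>2 * (2 * B2) + 1)"
    have pos: "A0\<^sup>2 * (2 * B2) + 1 > 0" using B2(1) by (simp add: add_nonneg_pos)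
    have \<delta>: "\<delta> > 0" "A0\<^sup>2 * (\<delta> * (2 * B2)) \<le> (e / 2)\<^sup>2"
    proof -
      show "\<delta> > 0" using pos e by (simp add: \<delta>_def)
      have "(A0\<^sup>2 * (2 * B2) + 1) * \<delta> = (e / 2)\<^sup>2" using pos by (simp add: \<delta>_def)
      then show "A0\<^sup>2 * (\<delta> * (2 * B2)) \<le> (e / 2)\<^sup>2" using \<open>\<delta> > 0\<close> by (simp add: algebra_simps)
    qed
    obtain K0 where K0: "K0 \<ge> 1" "\<And>K t. K \<ge> K0 \<Longrightarrow> t \<in> J \<Longrightarrow> norm (sol K s u t - U t s u) < \<delta>"
      using U_uniform[OF \<delta>(1), of u] st(2) by blast
    have "((\<lambda>n. real n powr (- 1) * (A1 * B1)) \<longlongrightarrow> 0 * (A1 * B1)) sequentially"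
      by (intro tendsto_intros tendsto_neg_powr filterlim_real_sequentially) auto
    then have "\<forall>\<^sub>F n in sequentially. real n powr (- 1) * (A1 * B1) < e / 2"
      using e by (intro order_tendstoD) auto
    moreover have "\<forall>\<^sub>F n in sequentially. K0 \<le> real n"
      using filterlim_real_sequentially by (simp add: filterlim_at_top)
    ultimately show "\<forall>\<^sub>F n in sequentially. \<forall>t\<in>J. \<forall>h. norm (h *\<^sub>R gen (real n) t (sol (real n) s u t) - h *\<^sub>R - (\<i> *\<^sub>C H t (U t s u))) \<le> e * norm h"
    proof (eventually_elim, intro ballI allI)
      fix n :: nat and t h :: real
      assume n: "real n powr (- 1) * (A1 * B1) < e / 2" "K0 \<le> real n" and t: "t \<in> J"
      define x where "x = sol (real n) s u t"
      define y where "y = U t s u"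
      have xd: "x \<in> dom r" for r unfolding x_def by (rule sol_in_dom[OF st(2) t])
      have yd: "y \<in> dom (2 * \<mu>)" "y \<in> dom \<mu>" unfolding y_def using B2(3) U\<mu> t by auto
      have xtp: "tp (real n) x = x" unfolding x_def by (rule tp_sol[OF st(2) t])
      have Hx: "H t x \<in> dom 1" "norm (pw 1 (H t x)) \<le> A1 * B1"
        using A1(2)[OF t xd] A1(3)[OF t xd] mult_left_mono[OF B1(2)[OF t, of "real n"] A1(1)]
        unfolding x_def by auto
      have "norm (H t x - tp (real n) (H t x)) \<le> real n powr (- 1) * norm (pw 1 (H t x))"
        by (rule norm_minus_tp_le) (use n K0(1) Hx in auto)
      also have "\<dots> \<le> real n powr (- 1) * (A1 * B1)" using Hx(2) by (rule mult_left_mono) simp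
      also have "\<dots> < e / 2" by (rule n(1))
      finally have 1: "norm (H t x - tp (real n) (H t x)) < e / 2" .
      have "norm (H t x - H t y) = norm (H t (x - y))" by (simp add: H_diff[OF t xd yd(2)])
      also have "\<dots> \<le> A0 * norm (pw \<mu> (x - y))" by (rule A0(2)[OF t dom_diff[OF xd yd(2)]])
      also have "\<dots> \<le> e / 2"
      proof (rule power2_le_imp_le)
        have "(norm (pw \<mu> (x - y)))\<^sup>2 \<le> norm (x - y) * norm (pw (2 * \<mu>) (x - y))"
          by (rule interpolation_inequality[OF mu dom_diff[OF xd yd(1)]])
        also have "\<dots> \<le> \<delta> * (2 * B2)"
        proof (rule mult_mono)
          show "norm (x - y) \<le> \<delta>" using K0(2)[OF n(2) t] by (simp add: x_def y_def)
          have "norm (pw (2 * \<mu>) (x - y)) \<le> norm (pw (2 * \<mu>) x) + norm (pw (2 * \<mu>) y)"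
            unfolding pw_diff[OF xd yd(1)] by (rule norm_triangle_ineq4)
          then show "norm (pw (2 * \<mu>) (x - y)) \<le> 2 * B2"
            using B2(2)[OF t, of "real n"] B2(4)[OF t] by (simp add: x_def y_def)
        qed (use \<delta> in auto)
        finally have "A0\<^sup>2 * (norm (pw \<mu> (x - y)))\<^sup>2 \<le> A0\<^sup>2 * (\<delta> * (2 * B2))" by (rule mult_left_mono) simp
        then show "(A0 * norm (pw \<mu> (x - y)))\<^sup>2 \<le> (e / 2)\<^sup>2" using \<delta>(2) by (simp add: power_mult_distrib)
      qed (use e in simp)
      finally have 2: "norm (H t x - H t y) \<le> e / 2" .
      have "gen (real n) t x - - (\<i> *\<^sub>C H t y) = \<i> *\<^sub>C (H t y - tp (real n) (H t x))"
        by (simp add: gen_def xtp scaleC_diff_right)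
      then have "norm (gen (real n) t x - - (\<i> *\<^sub>C H t y)) = norm (H t y - tp (real n) (H t x))" by simp
      also have "\<dots> = norm ((H t y - H t x) + (H t x - tp (real n) (H t x)))" by simp
      also have "\<dots> \<le> norm (H t y - H t x) + norm (H t x - tp (real n) (H t x))" by (rule norm_triangle_ineq)
      also have "\<dots> \<le> e" using 1 2 by (simp add: norm_minus_commute)
      finally have "\<bar>h\<bar> * norm (gen (real n) t x - - (\<i> *\<^sub>C H t y)) \<le> \<bar>h\<bar> * e" by (rule mult_left_mono) simp
      then have "norm (h *\<^sub>R (gen (real n) t x - - (\<i> *\<^sub>C H t y))) \<le> e * norm h"
        by (simp only: norm_scaleR real_norm_def mult.commute)
      then show "norm (h *\<^sub>R gen (real n) t (sol (real n) s u t) - h *\<^sub>R - (\<i> *\<^sub>C H t (U t s u))) \<le> e * norm h"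
        by (simp only: scaleR_diff_right x_def y_def)
    qed
  qed simp
  then obtain g where g: "\<And>t. t \<in> J \<Longrightarrow> (\<lambda>n. sol (real n) s u t) \<longlonglongrightarrow> g t"
      "\<And>t. t \<in> J \<Longrightarrow> (g has_vector_derivative - (\<i> *\<^sub>C H t (U t s u))) (at t within J)"
    unfolding has_vector_derivative_def by blast
  show ?thesis
    by (rule has_vector_derivative_transform[OF st(1) _ g(2)[OF st(1)]])
      (rule LIMSEQ_unique[OF sol_LIMSEQ_U[OF _ st(2)] g(1)])
qed

end

section \<open>The Hilbert scale of the reference operator\<close>

locale reference_operator =
  fixes D :: "'a::chilbert_space set" and H0 :: "'a \<Rightarrow> 'a"
  assumes self_adjoint: "self_adjoint D H0" and positive: "positive_op D H0"
    and compact_resolvent: "has_compact_resolvent D H0"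

sublocale reference_operator \<subseteq> strictly_positive_compact D "\<lambda>x. x + H0 x"
  using self_adjoint positive compact_resolvent by (rule strictly_positive_compact_Lambda)

context reference_operator
begin

section \<open>Identification with the abstract scale\<close>

lemma hscale_eq_dom: "hscale D H0 r = dom r"
  by (simp add: hscale_def fcalc_dom_def dom_def)

lemma Lam_pow_eq_pw: "Lam_pow D H0 r = pw r"
  by (rule ext) (simp add: Lam_pow_def fcalc_def pw_def)

lemma hscale_norm_eq: "hscale_norm D H0 r u = norm (pw r u)"
  by (simp add: hscale_norm_def Lam_pow_eq_pw)

lemma hscale_infty_iff: "u \<in> hscale_infty D H0 \<longleftrightarrow> (\<forall>r. u \<in> dom r)"
proof
  assume "u \<in> hscale_infty D H0"
  then have "u \<in> dom (max 0 r)" for r by (simp add: hscale_infty_def hscale_eq_dom)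
  then show "\<forall>r. u \<in> dom r" using dom_mono max.cobounded2 by blast
qed (simp add: hscale_infty_def hscale_eq_dom)

lemma eigenspace_shift: "eigenspace D (\<lambda>x. x + H0 x) (l + 1) = eigenspace D H0 l"
  by (auto simp: eigenspace_def algebra_simps)

lemma eigenvalues_shift: "ev = (\<lambda>l. l + 1) ` eigenvalues D H0"
proof -
  have "l \<in> ev \<longleftrightarrow> l - 1 \<in> eigenvalues D H0" for l
    using eigenspace_shift[of "l - 1"] by (simp add: eigenvalues_def)
  then show ?thesis by (force simp: image_iff)
qed

text \<open>Adding the identity shifts eigenvalues by one and keeps eigenspaces. The lower end of
  the interval imposes nothing, as Lambda has no eigenvalue below 1.\<close>

lemma trunc_proj_eq_tp: "trunc_proj D H0 N = tp (1 + N)"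
proof
  fix u
  define g where "g l = (indicator {0..N} (l - 1) :: real) *\<^sub>R orth_proj (E l) u" for l
  have "trunc_proj D H0 N u = infsum (g \<circ> (\<lambda>l. l + 1)) (eigenvalues D H0)"
    by (simp add: trunc_proj_def fcalc_def g_def comp_def eigenspace_shift)
  also have "\<dots> = infsum g ev"
    unfolding eigenvalues_shift by (rule infsum_reindex[symmetric]) simp
  also have "\<dots> = infsum (\<lambda>l. orth_proj (E l) u) {l \<in> ev. l \<le> 1 + N}"
    by (rule infsum_cong_neutral) (use ev_ge_1 in \<open>auto simp: g_def indicator_def\<close>)
  also have "\<dots> = tp (1 + N) u" by (simp add: tp_def finite_ev_below)
  finally show "trunc_proj D H0 N u = tp (1 + N) u" .
qed

text \<open>Boundedness makes the supremum finite. The zero vector is treated separately, because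
  its quotient is 0 by the convention on division.\<close>

lemma norm_le_hscale_onorm:
  assumes A: "hscale_bounded D H0 q r A" and q: "q \<ge> 0" and u: "u \<in> dom q"
  shows "norm (pw r (A u)) \<le> hscale_onorm D H0 q r A * norm (pw q u)"
proof (cases "u = 0")
  case True
  have "A (0 *\<^sub>C u) = 0 *\<^sub>C A u" using A u by (simp add: hscale_bounded_def clinear_on_def hscale_eq_dom del: scaleC_zero_left)
  then show ?thesis using True by (simp add: pw_zero)
next
  case False
  obtain C where C: "\<And>u. u \<in> dom q \<Longrightarrow> norm (pw r (A u)) \<le> C * norm (pw q u)"
    using A by (auto simp: hscale_bounded_def hscale_eq_dom hscale_norm_eq)
  have "norm (pw r (A v)) / norm (pw q v) \<le> max 0 C" if "v \<in> dom q" for v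
  proof (cases "norm (pw q v) = 0")
    case False
    have "norm (pw r (A v)) \<le> max 0 C * norm (pw q v)"
      using C[OF that] by (rule order_trans) (intro mult_right_mono, auto)
    then show ?thesis using False by (simp add: divide_le_eq)
  qed simp
  then have "bdd_above ((\<lambda>v. norm (pw r (A v)) / norm (pw q v)) ` dom q)" by (rule bdd_aboveI2)
  then have "norm (pw r (A u)) / norm (pw q u) \<le> hscale_onorm D H0 q r A"
    unfolding hscale_onorm_def hscale_eq_dom hscale_norm_eq by (rule cSUP_upper[OF u])
  moreover have "norm (pw q u) > 0"
    using norm_le_norm_pw[OF q u] False zero_less_norm_iff[of u] by linarith
  ultimately show ?thesis by (simp add: divide_le_eq)
qed

text \<open>\<open>hscale_onorm\<close> controls an operator only if that operator is bounded, so
  the differences occurring in norm continuity need this first.\<close>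

lemma hscale_bounded_diff:
  assumes "hscale_bounded D H0 q r A" "hscale_bounded D H0 q r B"
  shows "hscale_bounded D H0 q r (\<lambda>u. A u - B u)"
proof -
  obtain C C' where C: "\<forall>u\<in>dom q. norm (pw r (A u)) \<le> C * norm (pw q u)" "\<forall>u\<in>dom q. norm (pw r (B u)) \<le> C' * norm (pw q u)"
    using assms by (auto simp: hscale_bounded_def hscale_eq_dom hscale_norm_eq)
  have AB: "A u \<in> dom r" "B u \<in> dom r" if "u \<in> dom q" for u
    using assms that by (auto simp: hscale_bounded_def hscale_eq_dom)
  have "norm (pw r (A u - B u)) \<le> (C + C') * norm (pw q u)" if u: "u \<in> dom q" for u
    using norm_triangle_ineq4[of "pw r (A u)" "pw r (B u)"] bspec[OF C(1) u] bspec[OF C(2) u]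
    by (simp add: pw_diff[OF AB[OF u]] algebra_simps)
  moreover have "clinear_on (dom q) (\<lambda>u. A u - B u)"
    using assms by (simp add: hscale_bounded_def clinear_on_def hscale_eq_dom scaleC_diff_right)
  ultimately show ?thesis
    using AB dom_diff by (auto simp: hscale_bounded_def hscale_eq_dom hscale_norm_eq)
qed

lemma norm_continuous_diff_le:
  assumes "hscale_norm_continuous D H0 q r X H" "q \<ge> 0" "s \<in> X" "t \<in> X" "u \<in> dom q"
  shows "H s u \<in> dom r"
    and "norm (pw r (H s u - H t u)) \<le> hscale_onorm D H0 q r (\<lambda>u. H s u - H t u) * norm (pw q u)"
proof -
  have b: "hscale_bounded D H0 q r (H s)" "hscale_bounded D H0 q r (H t)"
    using assms by (auto simp: hscale_norm_continuous_def)
  show "H s u \<in> dom r" using b(1) assms(5) by (auto simp: hscale_bounded_def hscale_eq_dom)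
  show "norm (pw r (H s u - H t u)) \<le> hscale_onorm D H0 q r (\<lambda>u. H s u - H t u) * norm (pw q u)"
    by (rule norm_le_hscale_onorm[OF hscale_bounded_diff[OF b] assms(2,5)])
qed

text \<open>Norm continuity bounds \<open>H s\<close> for \<open>s\<close> near each
  \<open>t\<close> by the norm at \<open>t\<close> plus 1; a finite subcover of \<open>X\<close>
  makes the bound uniform.\<close>

lemma norm_continuous_uniform_bound:
  assumes cont: "hscale_norm_continuous D H0 q r X H" and q: "q \<ge> 0" and X: "compact X"
  shows "\<exists>C\<ge>0. \<forall>t\<in>X. \<forall>u\<in>dom q. H t u \<in> dom r \<and> norm (pw r (H t u)) \<le> C * norm (pw q u)"
proof -
  define N where "N t = hscale_onorm D H0 q r (H t)" for t
  define near where "near t \<delta> \<longleftrightarrow> (\<forall>s\<in>X. dist s t < \<delta> \<longrightarrow> (\<forall>u\<in>dom q. norm (pw r (H s u)) \<le> (\<bar>N t\<bar> + 1) * norm (pw q u)))" for t \<delta>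
  have "\<exists>\<delta>>0. near t \<delta>" if t: "t \<in> X" for t
  proof -
    have bt: "norm (pw r (H t u)) \<le> \<bar>N t\<bar> * norm (pw q u)" if "u \<in> dom q" for u
    proof -
      have "norm (pw r (H t u)) \<le> N t * norm (pw q u)"
        unfolding N_def using cont t that by (intro norm_le_hscale_onorm q) (auto simp: hscale_norm_continuous_def)
      also have "\<dots> \<le> \<bar>N t\<bar> * norm (pw q u)" by (intro mult_right_mono) auto
      finally show ?thesis .
    qed
    have "((\<lambda>s. hscale_onorm D H0 q r (\<lambda>u. H s u - H t u)) \<longlongrightarrow> 0) (at t within X)"
      using cont t by (simp add: hscale_norm_continuous_def)
    then have "\<forall>\<^sub>F s in at t within X. hscale_onorm D H0 q r (\<lambda>u. H s u - H t u) < 1"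
      by (rule order_tendstoD) simp
    then obtain \<delta> where \<delta>: "\<delta> > 0" "\<And>s. s \<in> X \<Longrightarrow> s \<noteq> t \<Longrightarrow> dist s t < \<delta> \<Longrightarrow> hscale_onorm D H0 q r (\<lambda>u. H s u - H t u) < 1"
      by (auto simp: eventually_at)
    have "norm (pw r (H s u)) \<le> (\<bar>N t\<bar> + 1) * norm (pw q u)" if s: "s \<in> X" "dist s t < \<delta>" and u: "u \<in> dom q" for s u
    \<comment> \<open>The limit within \<open>X\<close> says nothing about the point
      \<open>t\<close> itself, where \<open>bt\<close> applies directly.\<close>
    proof (cases "s = t")
      case False
      have "norm (pw r (H s u - H t u)) \<le> hscale_onorm D H0 q r (\<lambda>u. H s u - H t u) * norm (pw q u)"
        by (rule norm_continuous_diff_le(2)[OF cont q s(1) t u])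
      also have "\<dots> \<le> 1 * norm (pw q u)" using \<delta>(2)[OF s(1) False s(2)] by (intro mult_right_mono) auto
      finally have "norm (pw r (H s u - H t u)) \<le> norm (pw q u)" by simp
      moreover have "pw r (H s u - H t u) = pw r (H s u) - pw r (H t u)"
        by (rule pw_diff) (rule norm_continuous_diff_le(1)[OF cont q _ t u]; fact)+
      ultimately show ?thesis
        using bt[OF u] norm_triangle_ineq2[of "pw r (H s u)" "pw r (H t u)"] by (simp add: algebra_simps)
    next
      case True
      show ?thesis unfolding True distrib_right using bt[OF u] norm_ge_zero[of "pw q u"] by linarith
    qed
    then have "near t \<delta>" unfolding near_def by blast
    then show ?thesis using \<delta>(1) by blast
  qed
  then obtain \<delta> where \<delta>: "\<And>t. t \<in> X \<Longrightarrow> \<delta> t > 0" "\<And>t. t \<in> X \<Longrightarrow> near t (\<delta> t)" by metis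
  obtain T where T: "T \<subseteq> X" "finite T" "X \<subseteq> (\<Union>t\<in>T. ball t (\<delta> t))"
  proof (rule compactE_image[OF X, of X "\<lambda>t. ball t (\<delta> t)"])
    show "X \<subseteq> (\<Union>t\<in>X. ball t (\<delta> t))" using \<delta>(1) by force
  qed auto
  \<comment> \<open>The sum dominates every local bound and is still nonnegative when
    \<open>T\<close> is empty.\<close>
  define C where "C = (\<Sum>t\<in>T. \<bar>N t\<bar> + 1)"
  have "H s u \<in> dom r \<and> norm (pw r (H s u)) \<le> C * norm (pw q u)" if s: "s \<in> X" and u: "u \<in> dom q" for s u
  proof
    show "H s u \<in> dom r" by (rule norm_continuous_diff_le(1)[OF cont q s s u])
    obtain t where t: "t \<in> T" "dist s t < \<delta> t" using T(3) s by (auto simp: dist_commute)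
    have "norm (pw r (H s u)) \<le> (\<bar>N t\<bar> + 1) * norm (pw q u)" using \<delta>(2)[of t] t T(1) s u unfolding near_def by blast
    also have "\<bar>N t\<bar> + 1 \<le> C" unfolding C_def using t(1) T(2) by (intro member_le_sum) auto
    finally show "norm (pw r (H s u)) \<le> C * norm (pw q u)" by (simp add: mult_right_mono)
  qed
  moreover have "C \<ge> 0" unfolding C_def by (intro sum_nonneg) auto
  ultimately show ?thesis by blast
qed

section \<open>Transfer of the hypotheses and of the truncated propagators\<close>

lemma truncated_evolution:
  assumes "separable_space (euclidean :: 'a topology)" "a \<le> b" "\<mu> \<ge> 0"
    and cont: "\<And>r. r \<ge> 0 \<Longrightarrow> hscale_norm_continuous D H0 (r + \<mu>) r {a..b} H"
    and sym: "\<And>t v w. t \<in> {a..b} \<Longrightarrow> v \<in> hscale_infty D H0 \<Longrightarrow> w \<in> hscale_infty D H0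
                \<Longrightarrow> cinner (H t v) w = cinner v (H t w)"
  shows "truncated_evolution ev (\<lambda>l. orth_proj (E l)) a b \<mu> H"
proof
  show "a \<le> b" "0 \<le> \<mu>" by fact+
  show "\<exists>Q::'a set. countable Q \<and> closure Q = UNIV"
    using assms(1) by (auto simp: separable_space_def)
  have cont0: "hscale_norm_continuous D H0 \<mu> 0 {a..b} H" using cont[of 0] by simp
  then have b: "hscale_bounded D H0 \<mu> 0 (H t)" if "t \<in> {a..b}" for t
    using that by (simp add: hscale_norm_continuous_def)
  show "H t (u + v) = H t u + H t v" if "t \<in> {a..b}" "u \<in> dom \<mu>" "v \<in> dom \<mu>" for t u v
    using b[OF that(1)] that(2,3) by (simp add: hscale_bounded_def clinear_on_def hscale_eq_dom)
  show "H t (z *\<^sub>C u) = z *\<^sub>C H t u" if "t \<in> {a..b}" "u \<in> dom \<mu>" for t u z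
    using b[OF that(1)] that(2) by (simp add: hscale_bounded_def clinear_on_def hscale_eq_dom)
  show "\<exists>C\<ge>0. \<forall>t\<in>{a..b}. \<forall>u\<in>dom (r + \<mu>). H t u \<in> dom r \<and> norm (pw r (H t u)) \<le> C * norm (pw (r + \<mu>) u)"
    if "0 \<le> r" for r
    using that assms(3) by (intro norm_continuous_uniform_bound cont) auto
  show "continuous_on {a..b} (\<lambda>t. H t u)" if u: "u \<in> dom \<mu>" for u
    unfolding continuous_on_def
  proof
    fix t assume t: "t \<in> {a..b}"
    have "((\<lambda>s. H s u - H t u) \<longlongrightarrow> 0) (at t within {a..b})"
    proof (rule Lim_null_comparison)
      show "\<forall>\<^sub>F s in at t within {a..b}. norm (H s u - H t u)
          \<le> hscale_onorm D H0 \<mu> 0 (\<lambda>u. H s u - H t u) * norm (pw \<mu> u)"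
        unfolding eventually_at_filter
        using norm_continuous_diff_le(2)[OF cont0 assms(3) _ t u]
        by (intro always_eventually) (simp add: pw_0 del: atLeastAtMost_iff)
      have "((\<lambda>s. hscale_onorm D H0 \<mu> 0 (\<lambda>u. H s u - H t u) * norm (pw \<mu> u)) \<longlongrightarrow> 0 * norm (pw \<mu> u)) (at t within {a..b})"
        using cont0 t by (intro tendsto_intros) (simp add: hscale_norm_continuous_def)
      then show "((\<lambda>s. hscale_onorm D H0 \<mu> 0 (\<lambda>u. H s u - H t u) * norm (pw \<mu> u)) \<longlongrightarrow> 0) (at t within {a..b})"
        by simp
    qed
    then show "((\<lambda>s. H s u) \<longlongrightarrow> H t u) (at t within {a..b})" by (simp add: LIM_zero_iff)
  qed
  show "cinner (H t v) w = cinner v (H t w)"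
    if "t \<in> {a..b}" "\<And>r. v \<in> dom r" "\<And>r. w \<in> dom r" for t v w
    by (rule sym[OF that(1)]) (simp_all add: hscale_infty_iff that(2,3))
qed

text \<open>Multiplying the equation by \<open>- \<i>\<close> gives \<open>gen\<close>, and lying in
  the range of the projection means being fixed by it. Uniqueness of solutions on the interval then
  evaluates the definite description.\<close>

lemma trunc_prop_eq_sol:
  assumes ev: "truncated_evolution ev (\<lambda>l. orth_proj (E l)) a b \<mu> H"
    and st: "s \<in> {a..b}" "t \<in> {a..b}"
  shows "trunc_prop D H0 {a..b} H N t s (trunc_proj D H0 N u)
    = truncated_evolution.sol ev (\<lambda>l. orth_proj (E l)) a b H (1 + N) s u t"
proof -
  interpret truncated_evolution ev "\<lambda>l. orth_proj (E l)" a b \<mu> H by fact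
  let ?K = "1 + N"
  have ran: "v \<in> range (tp ?K) \<longleftrightarrow> tp ?K v = v" for v
    by (auto intro: range_eqI[of _ _ v])
  have "\<i> *\<^sub>C x' = w \<longleftrightarrow> x' = - (\<i> *\<^sub>C w)" for x' w :: 'a
    using scaleC_imaginary_unit[of x'] scaleC_imaginary_unit[of w] by auto
  then have ham: "\<i> *\<^sub>C x' = trunc_ham D H0 H N \<tau> v \<longleftrightarrow> x' = gen ?K \<tau> v" for x' v \<tau>
    by (simp add: trunc_ham_def trunc_proj_eq_tp gen_def)
  have "(\<forall>\<tau>\<in>J. x \<tau> \<in> range (trunc_proj D H0 N) \<and>
       (\<exists>x'. (x has_vector_derivative x') (at \<tau> within J) \<and> \<i> *\<^sub>C x' = trunc_ham D H0 H N \<tau> (x \<tau>)))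
     \<longleftrightarrow> solves ?K x" for x
    unfolding solves_def trunc_proj_eq_tp ran ham by simp
  then have "trunc_prop D H0 J H N t s (trunc_proj D H0 N u)
      = (THE w. \<exists>x. x s = tp ?K u \<and> x t = w \<and> solves ?K x)"
    by (simp only: trunc_prop_def trunc_proj_eq_tp)
  also have "\<dots> = sol ?K s u t"
  proof (rule the_equality)
    show "\<exists>x. x s = tp ?K u \<and> x t = sol ?K s u t \<and> solves ?K x"
      using sol_solves[OF st(1)] sol_initial[OF st(1)] by blast
    show "w = sol ?K s u t" if "\<exists>x. x s = tp ?K u \<and> x t = w \<and> solves ?K x" for w
    proof -
      from that obtain x where x: "x s = tp ?K u" "x t = w" "solves ?K x" by blast
      show ?thesis using sol_unique[OF x(3) st(1) x(1) st(2)] x(2) by simp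
    qed
  qed
  finally show ?thesis .
qed

lemma commutator_bound_of_energy_bound:
  assumes ev: "truncated_evolution ev (\<lambda>l. orth_proj (E l)) a b \<mu> H"
    and "nonneg_L1 {a..b} c" "energy_commutator_bound D H0 {a..b} H r c"
  shows "truncated_evolution.commutator_bound ev (\<lambda>l. orth_proj (E l)) a b H r c"
proof -
  interpret truncated_evolution ev "\<lambda>l. orth_proj (E l)" a b \<mu> H by fact
  show ?thesis
    using assms(2,3)
    unfolding commutator_bound_def nonneg_L1_def energy_commutator_bound_def Ball_def hscale_infty_iff
      Lam_pow_eq_pw hscale_norm_eq
    by (intro conjI) simp_all
qed

end

theorem theorem3p19:
  fixes D :: "'a::chilbert_space set" and H0 :: "'a \<Rightarrow> 'a"
    and a b \<mu> \<sigma> :: real and I :: "real set"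
    and H :: "real \<Rightarrow> 'a \<Rightarrow> 'a" and c :: "real \<Rightarrow> real"
  assumes separable: "separable_space (euclidean :: 'a topology)"
    and H0: "self_adjoint D H0" "positive_op D H0" "has_compact_resolvent D H0"
    and I: "a \<le> b" "I = {a..b}"
    and mu: "\<mu> \<ge> 0" and sigma: "\<sigma> > 0"
    and cont: "\<And>r. r \<ge> 0 \<Longrightarrow> hscale_norm_continuous D H0 (r + \<mu>) r I H"
    and c: "nonneg_L1 I c"
    and bound: "energy_commutator_bound D H0 I H (\<mu> + \<sigma>) c"
    and sym: "\<And>t v w. t \<in> I \<Longrightarrow> v \<in> hscale_infty D H0 \<Longrightarrow> w \<in> hscale_infty D H0
                \<Longrightarrow> cinner (H t v) w = cinner v (H t w)"
  shows
    "(\<forall>u\<in>hscale D H0 (\<mu> + \<sigma>). \<forall>\<epsilon>>0. \<exists>N0>0. \<forall>M\<ge>N0. \<forall>N\<ge>N0. \<forall>t\<in>I. \<forall>s\<in>I.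
        norm (trunc_prop D H0 I H M t s (trunc_proj D H0 M u)
            - trunc_prop D H0 I H N t s (trunc_proj D H0 N u)) < \<epsilon>)
   \<and> (\<exists>C>0. \<forall>u\<in>hscale D H0 (\<mu> + \<sigma>). \<forall>N>0. \<forall>M\<ge>N. \<forall>t\<in>I. \<forall>s\<in>I.
        norm (trunc_prop D H0 I H M t s (trunc_proj D H0 M u)
            - trunc_prop D H0 I H N t s (trunc_proj D H0 N u))
          \<le> C * (1 + N) powr (- \<sigma>) * hscale_norm D H0 (\<mu> + \<sigma>) u)
   \<and> (\<exists>U. (\<forall>u\<in>hscale D H0 (\<mu> + \<sigma>).
            uniform_limit (I \<times> I)
              (\<lambda>N (t, s). trunc_prop D H0 I H N t s (trunc_proj D H0 N u))
              (\<lambda>(t, s). U t s u) at_top)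
        \<and> unitary_propagator I U
        \<and> (\<forall>V. unitary_propagator I V
              \<and> (\<forall>u\<in>hscale D H0 (\<mu> + \<sigma>). \<forall>t\<in>I. \<forall>s\<in>I. V t s u = U t s u)
            \<longrightarrow> (\<forall>t\<in>I. \<forall>s\<in>I. V t s = U t s))
        \<and> ((\<forall>r\<ge>0. \<exists>c'. nonneg_L1 I c' \<and> energy_commutator_bound D H0 I H r c')
            \<longrightarrow> (\<forall>t\<in>I. \<forall>s\<in>I. U t s ` hscale_infty D H0 \<subseteq> hscale_infty D H0)
              \<and> (\<forall>u\<in>hscale_infty D H0. \<forall>t\<in>I. \<forall>s\<in>I. \<exists>w.
                   ((\<lambda>\<tau>. U \<tau> s u) has_vector_derivative w) (at t within I)
                   \<and> \<i> *\<^sub>C w = H t (U t s u))))"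
proof -
  interpret reference_operator D H0 by unfold_locales fact+
  note sym' = sym[unfolded I(2)] and cont' = cont[unfolded I(2)]
  have te: "truncated_evolution ev (\<lambda>l. orth_proj (E l)) a b \<mu> H"
    by (rule truncated_evolution[OF separable I(1) mu cont' sym'])
  interpret truncated_evolution ev "\<lambda>l. orth_proj (E l)" a b \<mu> H by (rule te)
  have cb: "commutator_bound r c'" if "nonneg_L1 I c'" "energy_commutator_bound D H0 I H r c'" for r c'
    using commutator_bound_of_energy_bound[OF te] that unfolding I(2) by blast
  interpret convergent_evolution ev "\<lambda>l. orth_proj (E l)" a b \<mu> H \<sigma> c
    by unfold_locales (fact sigma, rule cb[OF c bound])
  have eq: "trunc_prop D H0 {a..b} H N t s (trunc_proj D H0 N u) = sol (1 + N) s u t"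
    if "t \<in> {a..b}" "s \<in> {a..b}" for N t s u
    by (rule trunc_prop_eq_sol[OF te that(2,1)])
  \<comment> \<open>The change of variable from the cutoff of the reference operator to that of
    Lambda.\<close>
  have shift: "filterlim (\<lambda>N::real. 1 + N) at_top at_top"
    by (rule filterlim_tendsto_add_at_top[OF tendsto_const filterlim_ident])
  have Cauchy: "\<exists>N0>0. \<forall>M\<ge>N0. \<forall>N\<ge>N0. \<forall>t\<in>{a..b}. \<forall>s\<in>{a..b}.
      norm (sol (1 + M) s u t - sol (1 + N) s u t) < \<epsilon>" if \<epsilon>: "\<epsilon> > 0" for u \<epsilon>
  proof -
    obtain K0 where "K0 \<ge> 1" "\<forall>M\<ge>K0. \<forall>K\<ge>K0. \<forall>t\<in>{a..b}. \<forall>s\<in>{a..b}. norm (sol M s u t - sol K s u t) < \<epsilon>"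
      using uniformly_Cauchy[OF \<epsilon>] by blast
    \<comment> \<open>The threshold for Lambda serves for \<open>N\<close> too:
      \<open>N \<ge> K0\<close> implies \<open>1 + N \<ge> K0\<close>.\<close>
    then show ?thesis by (intro exI[of _ K0]) (simp del: atLeastAtMost_iff)
  qed
  obtain C where C: "C > 0" "\<And>u K M t s. u \<in> dom (\<mu> + \<sigma>) \<Longrightarrow> K \<ge> 1 \<Longrightarrow> M \<ge> K \<Longrightarrow> t \<in> {a..b} \<Longrightarrow> s \<in> {a..b} \<Longrightarrow>
      norm (sol M s u t - sol K s u t) \<le> C * K powr (- \<sigma>) * norm (pw (\<mu> + \<sigma>) u)"
    using truncation_rate[OF less_imp_le[OF sigma] bound] by blast
  have lim: "uniform_limit ({a..b} \<times> {a..b}) (\<lambda>N (t, s). trunc_prop D H0 {a..b} H N t s (trunc_proj D H0 N u))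
      (\<lambda>(t, s). U t s u) at_top" for u
  proof (rule uniform_limit_cong'[THEN iffD1, OF _ _ filterlim_compose[OF uniform_limit_U shift]])
    show "(case x of (t, s) \<Rightarrow> sol (1 + N) s u t)
        = (case x of (t, s) \<Rightarrow> trunc_prop D H0 {a..b} H N t s (trunc_proj D H0 N u))"
      if "x \<in> {a..b} \<times> {a..b}" for N x using that by (auto simp: eq)
  qed simp
  have regular: "U t s ` hscale_infty D H0 \<subseteq> hscale_infty D H0"
    and schroedinger: "u \<in> hscale_infty D H0 \<Longrightarrow> \<exists>w. ((\<lambda>\<tau>. U \<tau> s u) has_vector_derivative w) (at t within {a..b}) \<and> \<i> *\<^sub>C w = H t (U t s u)"
    if all: "\<forall>r\<ge>0. \<exists>c'. nonneg_L1 I c' \<and> energy_commutator_bound D H0 I H r c'"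
      and t: "t \<in> {a..b}" and s: "s \<in> {a..b}" for t s u
  proof -
    have all': "\<exists>c'. commutator_bound r c'" if "r \<ge> 0" for r using all cb that by blast
    have dom: "U t s u \<in> dom r" if "u \<in> dom r" "r \<ge> 0" for u r
      using all'[OF that(2)] U_energy_estimate[OF _ that(2)] that(1) t s by blast
    show "U t s ` hscale_infty D H0 \<subseteq> hscale_infty D H0"
      using dom by (auto simp: hscale_infty_def hscale_eq_dom)
    assume "u \<in> hscale_infty D H0"
    then have "((\<lambda>\<tau>. U \<tau> s u) has_vector_derivative - (\<i> *\<^sub>C H t (U t s u))) (at t within {a..b})"
      by (intro U_has_vector_derivative all' t s) (simp_all add: hscale_infty_iff)
    then show "\<exists>w. ((\<lambda>\<tau>. U \<tau> s u) has_vector_derivative w) (at t within {a..b}) \<and> \<i> *\<^sub>C w = H t (U t s u)"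
      by (intro exI[of _ "- (\<i> *\<^sub>C H t (U t s u))"] conjI) simp_all
  qed
  have 1: "\<forall>u\<in>dom (\<mu> + \<sigma>). \<forall>\<epsilon>>0. \<exists>N0>0. \<forall>M\<ge>N0. \<forall>N\<ge>N0. \<forall>t\<in>I. \<forall>s\<in>I.
        norm (trunc_prop D H0 I H M t s (trunc_proj D H0 M u)
            - trunc_prop D H0 I H N t s (trunc_proj D H0 N u)) < \<epsilon>"
    unfolding I(2) using Cauchy by (simp add: eq del: atLeastAtMost_iff)
  have 2: "\<exists>C>0. \<forall>u\<in>dom (\<mu> + \<sigma>). \<forall>N>0. \<forall>M\<ge>N. \<forall>t\<in>I. \<forall>s\<in>I.
        norm (trunc_prop D H0 I H M t s (trunc_proj D H0 M u)
            - trunc_prop D H0 I H N t s (trunc_proj D H0 N u)) \<le> C * (1 + N) powr (- \<sigma>) * norm (pw (\<mu> + \<sigma>) u)"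
    unfolding I(2) using C by (intro exI[of _ C]) (simp add: eq del: atLeastAtMost_iff)
  have 3: "\<forall>u\<in>dom (\<mu> + \<sigma>). uniform_limit (I \<times> I)
      (\<lambda>N (t, s). trunc_prop D H0 I H N t s (trunc_proj D H0 N u)) (\<lambda>(t, s). U t s u) at_top"
    unfolding I(2) by (intro ballI lim)
  have 4: "unitary_propagator I U" unfolding I(2) by (rule unitary_propagator_U)
  have 5: "\<forall>V. unitary_propagator I V \<and> (\<forall>u\<in>dom (\<mu> + \<sigma>). \<forall>t\<in>I. \<forall>s\<in>I. V t s u = U t s u)
      \<longrightarrow> (\<forall>t\<in>I. \<forall>s\<in>I. V t s = U t s)"
    unfolding I(2) using U_determined by (intro allI impI ballI) (simp del: atLeastAtMost_iff)
  have 6: "(\<forall>r\<ge>0. \<exists>c'. nonneg_L1 I c' \<and> energy_commutator_bound D H0 I H r c')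
      \<longrightarrow> (\<forall>t\<in>I. \<forall>s\<in>I. U t s ` hscale_infty D H0 \<subseteq> hscale_infty D H0)
        \<and> (\<forall>u\<in>hscale_infty D H0. \<forall>t\<in>I. \<forall>s\<in>I. \<exists>w.
             ((\<lambda>\<tau>. U \<tau> s u) has_vector_derivative w) (at t within I) \<and> \<i> *\<^sub>C w = H t (U t s u))"
  proof (intro impI conjI ballI)
    fix t s assume all: "\<forall>r\<ge>0. \<exists>c'. nonneg_L1 I c' \<and> energy_commutator_bound D H0 I H r c'"
      and "t \<in> I" "s \<in> I"
    then have ts: "t \<in> {a..b}" "s \<in> {a..b}" by (simp_all only: I(2))
    show "U t s ` hscale_infty D H0 \<subseteq> hscale_infty D H0" by (rule regular[OF all ts])
    show "\<exists>w. ((\<lambda>\<tau>. U \<tau> s u) has_vector_derivative w) (at t within I) \<and> \<i> *\<^sub>C w = H t (U t s u)"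
      if "u \<in> hscale_infty D H0" for u
      unfolding I(2) by (rule schroedinger[OF all ts that])
  qed
  show ?thesis
    unfolding hscale_eq_dom hscale_norm_eq by (intro conjI exI[of _ U] 1 2 3 4 5 6)
qed

end
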